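(* Let $M>0$ and $K=[-M,M]$. Let $u_0\in L^\infty(\mathbb{R})$, let $f\in C^1(\mathbb{R},\mathbb{R})$, let $p$ be a degeneracy parameter of $f$ on $K$, and let $0<s=\frac1p\le 1$. Let $u$ be the unique entropy solution on $]0,+\infty[_t\times\mathbb{R}_x$ of $$\partial_tu+\partial_xf(u)=0,\qquad u(0,x)=u_0(x),$$ satisfying the one-sided Hölder condition with exponent $s$. Assume that $p$ is finite and $|u_0|\le M$. Then $$u\in \mathrm{Lip}^s\big(]0,+\infty[_t,\,L^{1/s}_{loc}(\mathbb{R}_x,\mathbb{R})\big)\qquad\text{and}\qquad \forall t>0,\ u(t,\cdot)\in BV^s_{loc}(\mathbb{R}).$$ If moreover $u_0$ is compactly supported, then $u\in \mathrm{Lip}^s\big(]0,+\infty[_t,\,L^{1/s}(\mathbb{R}_x,\mathbb{R})\big)$ and there exists a constant $C$ such that, for all $t>0$, $$TV^su(t,\cdot)\{\mathbb{R}\}\le C\left(1+\frac1t\right).$$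
   Context: **Degeneracy.** Let $f\in C^1(I,\mathbb{R})$, $I$ an interval, $a=f'$. A real number $p$ is a degeneracy parameter of $f$ on $I$ if $0<\inf_{u,v\in I,\,u\ne v}\frac{|a(u)-a(v)|}{|u-v|^p}$ (this forces $a$ to be strictly monotone on $I$, so $f$ is strictly convex or strictly concave there, and $p\ge1$). If no such real $p$ exists, one sets $p=+\infty$. **Entropy solution and one-sided Hölder condition.** With $p$ a finite degeneracy parameter of the convex flux $f$ on $K$ and $s=1/p$, a weak solution $u$ with values in $K$ of the conservation law is called an entropy solution if for some constant $c>0$, for all $t>0$ and almost all $(x,y)$ with $x<y$, $$u(t,y)-u(t,x)\le c\,\frac{(y-x)^s}{t^s}.$$ If instead $-f$ is convex, $u$ is replaced by $-u$ in this inequality. This entropy solution is the unique Kruzhkov entropy solution. **$BV^s$.** A subdivision of an interval $I$ is a finite set $\sigma=\{x_0<\dots<x_n\}\subset I$. For $u:I\to\mathbb{R}$, $TV^su\{\sigma\}=\sum_{i=1}^n|u(x_i)-u(x_{i-1})|^{1/s}$ and $TV^su\{I\}=\sup_\sigma TV^su\{\sigma\}$ over all subdivisions of $I$. For measurable functions defined a.e., $TV^su\{I\}=\inf_{v=u\text{ a.e.}}TV^sv\{I\}$. $BV^s(I)$ is the set of $u$ with $TV^su\{I\}<\infty$; $BV^s_{loc}(\mathbb{R})$ is the set of $u$ with $u\in BV^s([\alpha,\beta])$ for every bounded interval $[\alpha,\beta]$. **Hölder continuity in time.** $u\in\mathrm{Lip}^s(]0,+\infty[_t,L^{1/s}(\mathbb{R}_x,\mathbb{R}))$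 means: for every $t_0>0$ there is a constant $C$ such that $\|u(t,\cdot)-u(\tau,\cdot)\|_{L^{1/s}(\mathbb{R})}\le C|t-\tau|^s$ for all $t,\tau\ge t_0$. $u\in\mathrm{Lip}^s(]0,+\infty[_t,L^{1/s}_{loc}(\mathbb{R}_x,\mathbb{R}))$ means the same with $L^{1/s}(\mathbb{R})$ replaced by $L^{1/s}(J)$, for every compact interval $J$ (the constant depending on $t_0$ and $J$). *)

theory Defs
  imports "HOL-Analysis.Analysis"
begin

text \<open>
  Functions of \<open>(t, x)\<close> are curried, \<open>u t x\<close>. Elements of \<open>L\<^sup>\<infinity>\<close> are given by Borel measurable
  representatives; only the values of \<open>u\<close> at \<open>t > 0\<close> matter.
\<close>

text \<open>The set of quotients is bounded below by 0, so the real infimum is the true one as soon as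
  \<open>I\<close> has two points.\<close>

definition degeneracy_parameter :: "(real \<Rightarrow> real) \<Rightarrow> real set \<Rightarrow> real \<Rightarrow> bool" where
  "degeneracy_parameter f I p \<longleftrightarrow>
     0 < (INF (v, w) \<in> {(v, w). v \<in> I \<and> w \<in> I \<and> v \<noteq> w}.
            \<bar>deriv f v - deriv f w\<bar> / \<bar>v - w\<bar> powr p)"

text \<open>\<open>test_function \<phi> \<phi>t \<phi>x\<close>: \<open>\<phi>\<close> is \<open>C\<^sup>1\<close> with compact support in the plane and has partial
  derivatives \<open>\<phi>t\<close> and \<open>\<phi>x\<close>. Its support may meet \<open>t = 0\<close>, which is how the weak formulation
  carries the initial datum.\<close>

definition test_function ::
  "(real \<times> real \<Rightarrow> real) \<Rightarrow> (real \<times> real \<Rightarrow> real) \<Rightarrow> (real \<times> real \<Rightarrow> real) \<Rightarrow> bool" where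
  "test_function \<phi> \<phi>t \<phi>x \<longleftrightarrow>
     (\<forall>z. (\<phi> has_derivative (\<lambda>(h, k). \<phi>t z * h + \<phi>x z * k)) (at z)) \<and>
     continuous_on UNIV \<phi>t \<and> continuous_on UNIV \<phi>x \<and>
     (\<exists>S. compact S \<and> (\<forall>z. z \<notin> S \<longrightarrow> \<phi> z = 0))"

text \<open>Weak solutions with values in \<open>K\<close>. For bounded \<open>K\<close> and \<open>f\<close> continuous, the integrands below
  are integrable.\<close>

definition weak_solution ::
  "(real \<Rightarrow> real) \<Rightarrow> (real \<Rightarrow> real) \<Rightarrow> real set \<Rightarrow> (real \<Rightarrow> real \<Rightarrow> real) \<Rightarrow> bool" where
  "weak_solution f u0 K u \<longleftrightarrow>
     set_borel_measurable lborel ({0<..} \<times> UNIV) (\<lambda>(t, x). u t x) \<and>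
     (AE (t, x) in lborel. 0 < t \<longrightarrow> u t x \<in> K) \<and>
     (\<forall>\<phi> \<phi>t \<phi>x. test_function \<phi> \<phi>t \<phi>x \<longrightarrow>
        (LINT z:{0<..} \<times> UNIV|lborel.
            (case z of (t, x) \<Rightarrow> u t x * \<phi>t (t, x) + f (u t x) * \<phi>x (t, x)))
        + (LINT x|lborel. u0 x * \<phi> (0, x)) = 0)"

definition one_sided_Hoelder :: "real \<Rightarrow> (real \<Rightarrow> real \<Rightarrow> real) \<Rightarrow> bool" where
  "one_sided_Hoelder s u \<longleftrightarrow>
     (\<exists>c>0. \<forall>t>0. AE (x, y) in lborel. x < y \<longrightarrow>
        u t y - u t x \<le> c * ((y - x) powr s / t powr s))"

definition entropy_solution ::
  "(real \<Rightarrow> real) \<Rightarrow> (real \<Rightarrow> real) \<Rightarrow> real set \<Rightarrow> real \<Rightarrow> (real \<Rightarrow> real \<Rightarrow> real) \<Rightarrow> bool" where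
  "entropy_solution f u0 K s u \<longleftrightarrow>
     weak_solution f u0 K u \<and>
     (convex_on K f \<and> one_sided_Hoelder s u \<or>
      concave_on K f \<and> one_sided_Hoelder s (\<lambda>t x. - u t x))"

text \<open>Subdivisions are strictly increasing lists of points of the interval.\<close>

definition TVs_pointwise :: "real \<Rightarrow> real set \<Rightarrow> (real \<Rightarrow> real) \<Rightarrow> ennreal" where
  "TVs_pointwise s I w =
     (SUP \<sigma> \<in> {\<sigma>. sorted_wrt (<) \<sigma> \<and> set \<sigma> \<subseteq> I}.
        ennreal (\<Sum>i = 1..<length \<sigma>. \<bar>w (\<sigma> ! i) - w (\<sigma> ! (i - 1))\<bar> powr (1 / s)))"

definition TVs :: "real \<Rightarrow> real set \<Rightarrow> (real \<Rightarrow> real) \<Rightarrow> ennreal" where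
  "TVs s I w = (INF v \<in> {v. AE x in lborel. x \<in> I \<longrightarrow> v x = w x}. TVs_pointwise s I v)"

definition BVs :: "real \<Rightarrow> real set \<Rightarrow> (real \<Rightarrow> real) set" where
  "BVs s I = {w. TVs s I w < \<infinity>}"

definition BVs_loc :: "real \<Rightarrow> (real \<Rightarrow> real) set" where
  "BVs_loc s = {w. \<forall>\<alpha> \<beta>. w \<in> BVs s {\<alpha>..\<beta>}}"

definition Lq :: "real \<Rightarrow> real set \<Rightarrow> (real \<Rightarrow> real) set" where
  "Lq q J = {w. set_borel_measurable lborel J w \<and> set_integrable lborel J (\<lambda>x. \<bar>w x\<bar> powr q)}"

definition Lq_norm :: "real \<Rightarrow> real set \<Rightarrow> (real \<Rightarrow> real) \<Rightarrow> real" where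
  "Lq_norm q J w = (LINT x:J|lborel. \<bar>w x\<bar> powr q) powr (1 / q)"

definition Lip_Lq :: "real \<Rightarrow> real \<Rightarrow> real set \<Rightarrow> (real \<Rightarrow> real \<Rightarrow> real) set" where
  "Lip_Lq s q J = {u. (\<forall>t>0. u t \<in> Lq q J) \<and>
     (\<forall>t0>0. \<exists>C. \<forall>t\<ge>t0. \<forall>\<tau>\<ge>t0. Lq_norm q J (\<lambda>x. u t x - u \<tau> x) \<le> C * \<bar>t - \<tau>\<bar> powr s)}"

definition Lip_Lq_loc :: "real \<Rightarrow> real \<Rightarrow> (real \<Rightarrow> real \<Rightarrow> real) set" where
  "Lip_Lq_loc s q = {u. \<forall>\<alpha> \<beta>. u \<in> Lip_Lq s q {\<alpha>..\<beta>}}"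

text \<open>Compact support in the almost everywhere sense.\<close>

definition compactly_supported :: "(real \<Rightarrow> real) \<Rightarrow> bool" where
  "compactly_supported w \<longleftrightarrow> (\<exists>S. compact S \<and> (AE x in lborel. x \<notin> S \<longrightarrow> w x = 0))"

text \<open>Two functions representing the same element of \<open>L\<^sup>\<infinity>(]0,\<infinity>[ \<times> \<real>)\<close>. A weak solution and the
  one-sided condition leave \<open>u t\<close> essentially free for a null set of times \<open>t\<close> (for instance \<open>u t\<close>
  may be replaced by a constant at one \<open>t\<close>), so, as usual, regularity in time is a property of a
  representative.\<close>

definition ae_equal :: "(real \<Rightarrow> real \<Rightarrow> real) \<Rightarrow> (real \<Rightarrow> real \<Rightarrow> real) \<Rightarrow> bool" where
  "ae_equal u v \<longleftrightarrow> (AE (t, x) in lborel. 0 < t \<longrightarrow> u t x = v t x)"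

end

theory Submission
  imports Defs
begin

text \<open>
  The one-sided Hoelder condition alone does not bound \<open>TV\<^sup>s\<close> when \<open>s < 1\<close>: sums of sawtooth functions
  over all scales satisfy it. The regularity is that of the Lax-Oleinik solution. For a convex flux
  \<open>f\<close>, let \<open>L q = max (q v - f v)\<close> over \<open>v \<in> K\<close>, with maximizer \<open>G q\<close>, and let \<open>W\<close> be a primitive
  of \<open>u0\<close>. If \<open>Y t x\<close> minimizes \<open>W y + t L ((x - y) / t)\<close>, then \<open>v t x = G ((x - Y t x) / t)\<close>.
  Degeneracy gives \<open>\<bar>G q - G r\<bar>\<^sup>p \<le> \<bar>q - r\<bar> / \<delta>\<close>, and \<open>Y t\<close> is monotone, so \<open>TV\<^sup>s\<close> of \<open>v t\<close> is bounded by
  the total variation of \<open>(x - Y t x) / t\<close>. Since \<open>v\<close> is constant along the segments from \<open>(0, Y t x)\<close>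
  to \<open>(t, x)\<close>, that variation also bounds the change of \<open>v\<close> in time.

  It remains to see that an entropy solution is this \<open>v\<close>. A potential \<open>U\<close> with \<open>\<partial>\<^sub>x U = u\<close> and
  \<open>\<partial>\<^sub>t U = - f u\<close> is compared with the Hopf-Lax function \<open>V\<close>. For \<open>U \<le> V\<close>, test with a window moving at
  constant speed and use the inequality of Fenchel and Young. For \<open>V \<le> U\<close>, consider the minimum over
  \<open>y\<close> of \<open>U \<tau> y + (t - \<tau>) L ((x - y) / (t - \<tau>))\<close>: at a minimizer \<open>U \<tau>\<close> is touched from below by
  a \<open>C\<^sup>1\<close> function, so the one-sided condition makes \<open>u\<close> nearly constant there, and the
  minimum does not increase as \<open>\<tau>\<close> decreases from \<open>t\<close> to \<open>0\<close>.
\<close>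

section \<open>Convex fluxes and their Legendre transform\<close>

text \<open>The weak formulation fixes \<open>u t\<close> only for almost every \<open>t\<close> and
  gives \<open>f u\<close> no meaning on a vertical line. The potentials are therefore built from
  the flux averaged by a mollifier of width \<open>\<eta>\<close>: they exist at all times and
  places, are Lipschitz, and have \<open>u\<close> as mollified slope on almost every slice only.
  Inequalities found on slices reach every time by continuity. The two comparisons are not
  symmetric. Averaging the Fenchel-Young inequality costs nothing, so \<open>U \<le> V\<close> holds
  for every weak solution with values in \<open>K\<close>. The converse needs an upper bound for an
  average of a convex function, which fails for non-entropic shocks. Touching at distance
  \<open>d\<close> produces errors that vanish with \<open>d\<close> and errors of size
  \<open>\<eta> / d\<close>, hence the later choice of \<open>d\<close> as the square root of
  \<open>\<eta>\<close>. \<open>L\<close> is the transform of \<open>f\<close> restricted to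
  \<open>K\<close>. It grows only linearly, with slope \<open>M\<close> at infinity, which is
  exactly the Lipschitz constant of \<open>W\<close>. Minimizers exist because \<open>L\<close> is
  already affine outside \<open>[-A, A]\<close>, where \<open>A\<close> is the Lipschitz constant of
  \<open>f\<close> on \<open>K\<close>; the same \<open>A\<close> bounds the speed of
  propagation.\<close>

locale convex_flux =
  fixes M A \<delta> p :: real and f a :: "real \<Rightarrow> real"
  assumes M_pos: "0 < M" and A_pos: "0 < A" and \<delta>_pos: "0 < \<delta>" and p_pos: "0 < p"
    and f_deriv: "\<And>x. (f has_real_derivative a x) (at x)"
    and f_lip: "\<And>v w. v \<in> {-M..M} \<Longrightarrow> w \<in> {-M..M} \<Longrightarrow> \<bar>f v - f w\<bar> \<le> A * \<bar>v - w\<bar>"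
    and degenerate: "\<And>v w. -M \<le> v \<Longrightarrow> v < w \<Longrightarrow> w \<le> M \<Longrightarrow> \<delta> * (w - v) powr p \<le> a w - a v"
begin

lemma f_cont: "continuous_on S f"
  using f_deriv by (meson DERIV_isCont continuous_at_imp_continuous_on)

lemma f_measurable [measurable]: "f \<in> borel_measurable borel"
  using f_cont by (rule borel_measurable_continuous_onI)

definition G :: "real \<Rightarrow> real" where
  "G q = (SOME g. g \<in> {-M..M} \<and> (\<forall>v\<in>{-M..M}. q * v - f v \<le> q * g - f g))"

definition L :: "real \<Rightarrow> real" where
  "L q = q * G q - f (G q)"

lemma G_props: "G q \<in> {-M..M} \<and> (\<forall>v\<in>{-M..M}. q * v - f v \<le> q * G q - f (G q))"
proof -
  have "\<exists>g\<in>{-M..M}. \<forall>v\<in>{-M..M}. q * v - f v \<le> q * g - f g"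
    by (rule continuous_attains_sup) (use M_pos f_cont in \<open>auto intro!: continuous_intros\<close>)
  then have "\<exists>g. g \<in> {-M..M} \<and> (\<forall>v\<in>{-M..M}. q * v - f v \<le> q * g - f g)" by blast
  from someI_ex[OF this] show ?thesis unfolding G_def .
qed

lemma G_mem: "G q \<in> {-M..M}" using G_props by blast

lemma abs_G_le: "\<bar>G q\<bar> \<le> M" using G_mem[of q] by auto

lemma Fenchel_Young: "v \<in> {-M..M} \<Longrightarrow> q * v - f v \<le> L q"
  using G_props unfolding L_def by blast

text \<open>The maximizer at \<open>q\<close> is a competitor at \<open>q'\<close>, so
  \<open>G q\<close> is a subgradient of \<open>L\<close> at \<open>q\<close>. This stands in for
  differentiability of \<open>L\<close> throughout.\<close>

lemma L_diff_ge: "(q' - q) * G q \<le> L q' - L q"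
  using Fenchel_Young[OF G_mem, of q' q] by (simp add: L_def algebra_simps)

lemma L_diff_le: "L q' - L q \<le> (q' - q) * G q'"
  using L_diff_ge[of q q'] by (simp add: algebra_simps)

lemma L_lipschitz: "\<bar>L q' - L q\<bar> \<le> M * \<bar>q' - q\<bar>"
proof -
  have "\<bar>(q' - q) * G r\<bar> \<le> M * \<bar>q' - q\<bar>" for r
    using mult_right_mono[OF abs_G_le[of r], of "\<bar>q' - q\<bar>"] by (simp add: abs_mult mult.commute)
  from this[of q] this[of q'] show ?thesis
    using L_diff_ge[of q' q] L_diff_le[of q' q] by linarith
qed

lemma L_cont: "continuous_on S L"
  by (rule continuous_on_subset[OF lipschitz_on_continuous_on[of M UNIV]])
     (use M_pos in \<open>auto intro!: lipschitz_onI simp: dist_real_def L_lipschitz\<close>)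

lemma L_measurable [measurable]: "L \<in> borel_measurable borel"
  using L_cont by (rule borel_measurable_continuous_onI)

text \<open>First-order optimality: a maximizer that is not the right end of \<open>K\<close> can be
  moved to the right, which must not increase \<open>q v - f v\<close>. At an end of
  \<open>K\<close> only one of the two conditions survives.\<close>

lemma G_deriv_le:
  assumes "G q < M" shows "q \<le> a (G q)"
proof (rule ccontr)
  assume "\<not> ?thesis"
  then have pos: "0 < q - a (G q)" by simp
  have "((\<lambda>v. q * v - f v) has_real_derivative q - a (G q)) (at (G q))"
    by (auto intro!: derivative_eq_intros f_deriv)
  from DERIV_pos_inc_right[OF this pos] obtain d where d: "d > 0"
    "\<And>h. h > 0 \<Longrightarrow> h < d \<Longrightarrow> q * G q - f (G q) < q * (G q + h) - f (G q + h)" by blast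
  define h where "h = min (d / 2) (M - G q)"
  have h: "h > 0" "h < d" "h \<le> M - G q" using d assms by (auto simp: h_def)
  have "G q + h \<in> {-M..M}" using h G_mem[of q] by auto
  from Fenchel_Young[OF this, of q] d(2)[OF h(1,2)] show False by (simp add: L_def)
qed

lemma G_deriv_ge:
  assumes "-M < G q" shows "a (G q) \<le> q"
proof (rule ccontr)
  assume "\<not> ?thesis"
  then have neg: "q - a (G q) < 0" by simp
  have "((\<lambda>v. q * v - f v) has_real_derivative q - a (G q)) (at (G q))"
    by (auto intro!: derivative_eq_intros f_deriv)
  from DERIV_neg_dec_left[OF this neg] obtain d where d: "d > 0"
    "\<And>h. h > 0 \<Longrightarrow> h < d \<Longrightarrow> q * G q - f (G q) < q * (G q - h) - f (G q - h)" by blast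
  define h where "h = min (d / 2) (G q + M)"
  have h: "h > 0" "h < d" "h \<le> G q + M" using d assms by (auto simp: h_def)
  have "G q - h \<in> {-M..M}" using h G_mem[of q] by auto
  from Fenchel_Young[OF this, of q] d(2)[OF h(1,2)] show False by (simp add: L_def)
qed

text \<open>If \<open>G q < G r\<close>, the first is not the right end of \<open>K\<close> and the
  second not the left end, so each has the optimality condition pointing the useful way. Degeneracy
  then turns the gap of slopes of \<open>f\<close> into a gap between \<open>q\<close> and
  \<open>r\<close>.\<close>

lemma G_less:
  assumes "G q < G r" shows "\<delta> * (G r - G q) powr p \<le> r - q"
proof -
  have "q \<le> a (G q)" "a (G r) \<le> r"
    using G_deriv_le[of q] G_deriv_ge[of r] G_mem[of q] G_mem[of r] assms by auto
  moreover have "\<delta> * (G r - G q) powr p \<le> a (G r) - a (G q)"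
    using degenerate[of "G q" "G r"] G_mem[of q] G_mem[of r] assms by auto
  ultimately show ?thesis by linarith
qed

lemma G_mono: "q \<le> r \<Longrightarrow> G q \<le> G r"
proof (rule ccontr)
  assume "q \<le> r" "\<not> G q \<le> G r"
  moreover have "0 < \<delta> * (G q - G r) powr p" using \<delta>_pos \<open>\<not> G q \<le> G r\<close> by simp
  ultimately show False using G_less[of r q] by linarith
qed

lemma G_measurable [measurable]: "G \<in> borel_measurable borel"
  using borel_measurable_mono[of G] G_mono by (simp add: mono_def)

lemma G_Hoelder_powr: "\<bar>G q - G r\<bar> powr p \<le> \<bar>q - r\<bar> / \<delta>"
proof -
  consider "G q < G r" | "G r < G q" | "G q = G r" by linarith
  then show ?thesis
  proof cases
    case 1
    with G_less[OF 1] \<delta>_pos show ?thesis by (auto simp: field_simps abs_if)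
  next
    case 2
    with G_less[OF 2] \<delta>_pos show ?thesis by (auto simp: field_simps abs_if)
  next
    case 3
    with \<delta>_pos p_pos show ?thesis by simp
  qed
qed

lemma G_Hoelder: "\<bar>G q - G r\<bar> \<le> (\<bar>q - r\<bar> / \<delta>) powr (1 / p)"
proof -
  have "\<bar>G q - G r\<bar> = (\<bar>G q - G r\<bar> powr p) powr (1 / p)"
    using p_pos by (simp add: powr_powr)
  also have "\<dots> \<le> (\<bar>q - r\<bar> / \<delta>) powr (1 / p)"
    using p_pos G_Hoelder_powr by (intro powr_mono2) auto
  finally show ?thesis .
qed

text \<open>For \<open>q\<close> above the Lipschitz constant of \<open>f\<close>,
  \<open>q v - f v\<close> is nondecreasing on \<open>K\<close>, so its maximum sits at the end
  \<open>M\<close>.\<close>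

lemma G_A: "A \<le> q \<Longrightarrow> L q = q * M - f M"
proof -
  assume "A \<le> q"
  have "M - G q \<ge> 0" using G_mem[of q] by auto
  have "f M - f (G q) \<le> A * (M - G q)"
    using f_lip[of M "G q"] G_mem[of q] M_pos by auto
  also have "\<dots> \<le> q * (M - G q)"
    using \<open>A \<le> q\<close> \<open>M - G q \<ge> 0\<close> by (intro mult_right_mono)
  finally have "L q \<le> q * M - f M" by (simp add: L_def algebra_simps)
  with Fenchel_Young[of M q] M_pos show ?thesis by auto
qed

lemma G_minus_A: "q \<le> - A \<Longrightarrow> L q = - q * M - f (- M)"
proof -
  assume "q \<le> - A"
  have "G q + M \<ge> 0" using G_mem[of q] by auto
  have "f (-M) - f (G q) \<le> A * (G q + M)"
    using f_lip[of "-M" "G q"] G_mem[of q] M_pos by auto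
  also have "\<dots> \<le> (-q) * (G q + M)"
    using \<open>q \<le> -A\<close> \<open>G q + M \<ge> 0\<close> by (intro mult_right_mono) auto
  finally have "L q \<le> - q * M - f (-M)" by (simp add: L_def algebra_simps)
  with Fenchel_Young[of "-M" q] M_pos show ?thesis by auto
qed

text \<open>\<open>r L (X / r)\<close> is the cost of a straight path with displacement
  \<open>X\<close> in time \<open>r\<close>. It is the supremum over \<open>v\<close> in
  \<open>K\<close> of the linear forms \<open>X v - r f v\<close>.\<close>

lemma perspective_ge:
  assumes "0 < r" "v \<in> {-M..M}"
  shows "X * v - r * f v \<le> r * L (X / r)"
proof -
  have "r * (X / r * v - f v) \<le> r * L (X / r)"
    using assms by (intro mult_left_mono Fenchel_Young) auto
  then show ?thesis using assms by (simp add: algebra_simps)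
qed

text \<open>A supremum of linear forms is subadditive: a broken path costs at least as much as the
  direct one. The maximizer for the direct path is tested in both pieces.\<close>

lemma perspective_le:
  assumes "0 < r" "0 < r'"
  shows "(r + r') * L ((X + X') / (r + r')) \<le> r * L (X / r) + r' * L (X' / r')"
proof -
  define g where "g = G ((X + X') / (r + r'))"
  have "X * g - r * f g \<le> r * L (X / r)" "X' * g - r' * f g \<le> r' * L (X' / r')"
    using assms unfolding g_def by (auto intro!: perspective_ge G_mem simp del: atLeastAtMost_iff)
  moreover have "(r + r') * L ((X + X') / (r + r')) = (X + X') * g - (r + r') * f g"
    using assms by (simp add: L_def g_def right_diff_distrib)
  ultimately show ?thesis using assms by (simp add: algebra_simps)
qed

text \<open>The derivative of \<open>r L (X / r)\<close> in \<open>r\<close> is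
  \<open>- f (G (X / r))\<close>. Taking the maximizer at the later time \<open>r + h\<close> gives
  an inequality without remainder.\<close>

lemma perspective_increment:
  assumes "0 < r" "0 < h"
  shows "(r + h) * L (X / (r + h)) \<le> r * L (X / r) - h * f (G (X / (r + h)))"
proof -
  define g where "g = G (X / (r + h))"
  have "(r + h) * L (X / (r + h)) = X * g - (r + h) * f g"
    using assms by (simp add: L_def g_def right_diff_distrib)
  moreover have "X * g - r * f g \<le> r * L (X / r)"
    using assms unfolding g_def by (intro perspective_ge G_mem)
  ultimately show ?thesis using assms unfolding g_def by (simp add: algebra_simps)
qed

end

section \<open>The Lax-Oleinik formula\<close>

context convex_flux
begin

text \<open>Beyond distance \<open>r A\<close> the cost is affine with slope \<open>M\<close>, while
  \<open>W\<close> falls at rate at most \<open>M\<close>. A competitor out there is no better than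
  the nearer end of the interval, so a minimum over the compact interval is global.\<close>

lemma minimizer_exists:
  assumes W: "\<And>y y'. \<bar>W y - W y'\<bar> \<le> M * \<bar>y - y'\<bar>" and r: "0 < r"
  shows "\<exists>y\<in>{x - r * A..x + r * A}. \<forall>y'. W y + r * L ((x - y) / r) \<le> W y' + r * L ((x - y') / r)"
proof -
  let ?E = "\<lambda>y. W y + r * L ((x - y) / r)"
  have Wc: "continuous_on S W" for S
    by (rule continuous_on_subset[OF lipschitz_on_continuous_on[of M UNIV]])
       (use M_pos W in \<open>auto intro!: lipschitz_onI simp: dist_real_def\<close>)
  have "continuous_on {x - r * A..x + r * A} ?E"
    by (intro continuous_intros Wc continuous_on_compose2[OF L_cont[of UNIV]]) (use r in auto)
  then have "\<exists>y\<in>{x - r * A..x + r * A}. \<forall>y'\<in>{x - r * A..x + r * A}. ?E y \<le> ?E y'"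
    using r A_pos by (intro continuous_attains_inf) auto
  then obtain y where y: "y \<in> {x - r * A..x + r * A}"
      "\<And>y'. y' \<in> {x - r * A..x + r * A} \<Longrightarrow> ?E y \<le> ?E y'" by blast
  have "?E y \<le> ?E y'" for y'
  proof -
    consider "y' \<in> {x - r * A..x + r * A}" | "y' < x - r * A" | "x + r * A < y'" by fastforce
    then show ?thesis
    proof cases
      case 1
      then show ?thesis by (rule y(2))
    next
      case 2
      let ?e = "x - r * A"
      have "L ((x - y') / r) = (x - y') / r * M - f M"
        using 2 r by (intro G_A) (auto simp: field_simps)
      then have "r * L ((x - y') / r) = (x - y') * M - r * f M"
        using r by (simp add: right_diff_distrib)
      moreover have "r * L ((x - ?e) / r) = r * A * M - r * f M"
        using r G_A[of A] by (simp add: right_diff_distrib)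
      moreover have "?E y \<le> ?E ?e" using r A_pos by (intro y(2)) auto
      moreover have "W ?e \<le> W y' + M * (?e - y')" using W[of ?e y'] 2 by auto
      ultimately show ?thesis by (simp add: algebra_simps)
    next
      case 3
      let ?e = "x + r * A"
      have "L ((x - y') / r) = - ((x - y') / r) * M - f (-M)"
        using 3 r by (intro G_minus_A) (auto simp: field_simps)
      then have "r * L ((x - y') / r) = - ((x - y') * M) - r * f (-M)"
        using r by (simp add: right_diff_distrib)
      moreover have "r * L ((x - ?e) / r) = r * A * M - r * f (-M)"
        using r G_minus_A[of "-A"] by (simp add: right_diff_distrib)
      moreover have "?E y \<le> ?E ?e" using r A_pos by (intro y(2)) auto
      moreover have "W ?e \<le> W y' + M * (y' - ?e)" using W[of ?e y'] 3 by auto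
      ultimately show ?thesis by (simp add: algebra_simps)
    qed
  qed
  with y(1) show ?thesis by blast
qed

text \<open>Convexity: pulling two points together with fixed sum does not raise the sum of the
  values. This is what uncrosses minimizing paths in \<open>Y_mono\<close>.\<close>

lemma L_exchange:
  assumes "\<alpha> \<le> \<gamma>" "\<alpha> \<le> \<gamma>'" "\<gamma> + \<gamma>' = \<alpha> + \<beta>"
  shows "L \<gamma> + L \<gamma>' \<le> L \<alpha> + L \<beta>"
proof -
  have *: "L c + L c' \<le> L \<alpha> + L \<beta>" if "\<alpha> \<le> c" "c \<le> c'" "c + c' = \<alpha> + \<beta>" for c c'
  proof -
    have "L c - L \<alpha> \<le> (c - \<alpha>) * G c" by (rule L_diff_le)
    also have "\<dots> \<le> (c - \<alpha>) * G c'" using that G_mono[of c c'] by (intro mult_left_mono) auto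
    also have "c - \<alpha> = \<beta> - c'" using that by simp
    also have "(\<beta> - c') * G c' \<le> L \<beta> - L c'" by (rule L_diff_ge)
    finally show ?thesis by simp
  qed
  from *[of \<gamma> \<gamma>'] *[of \<gamma>' \<gamma>] assms show ?thesis by (cases "\<gamma> \<le> \<gamma>'") auto
qed

end

locale lax_oleinik = convex_flux +
  fixes W :: "real \<Rightarrow> real"
  assumes W_lip: "\<And>y y'. \<bar>W y - W y'\<bar> \<le> M * \<bar>y - y'\<bar>"
begin

definition E :: "real \<Rightarrow> real \<Rightarrow> real \<Rightarrow> real" where
  "E t x y = W y + t * L ((x - y) / t)"

definition S :: "real \<Rightarrow> real \<Rightarrow> real set" where
  "S t x = {y \<in> {x - t * A..x + t * A}. \<forall>y'. E t x y \<le> E t x y'}"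

text \<open>Choosing the largest minimizer makes \<open>Y t\<close> monotone without strict convexity of \<open>L\<close>.\<close>

definition Y :: "real \<Rightarrow> real \<Rightarrow> real" where "Y t x = Sup (S t x)"
definition V :: "real \<Rightarrow> real \<Rightarrow> real" where "V t x = E t x (Y t x)"
definition Q :: "real \<Rightarrow> real \<Rightarrow> real" where "Q t x = (x - Y t x) / t"
definition v :: "real \<Rightarrow> real \<Rightarrow> real" where "v t x = G (Q t x)"

lemma W_cont: "continuous_on U W"
  by (rule continuous_on_subset[OF lipschitz_on_continuous_on[of M UNIV]])
     (use M_pos W_lip in \<open>auto intro!: lipschitz_onI simp: dist_real_def\<close>)

lemma E_cont: "continuous_on U (E t x)"
  unfolding E_def
  by (cases "t = 0")
     (auto intro!: continuous_intros W_cont continuous_on_compose2[OF L_cont[of UNIV]])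

lemma E_cont2: "continuous_on UNIV (\<lambda>(x, y). E t x y)"
  unfolding E_def case_prod_beta
  by (cases "t = 0")
     (auto intro!: continuous_intros continuous_on_compose2[OF W_cont[of UNIV]] continuous_on_compose2[OF L_cont[of UNIV]])

lemma Y_in_S:
  assumes "0 < t" shows "Y t x \<in> S t x"
proof -
  have "S t x = {x - t * A..x + t * A} \<inter> (\<Inter>y'. {y. E t x y \<le> E t x y'})"
    by (auto simp: S_def)
  moreover have "closed {y. E t x y \<le> E t x y'}" for y'
    using closed_Collect_le[OF E_cont[of UNIV t x] continuous_on_const, of "E t x y'"] by simp
  ultimately have "closed (S t x)" by (metis closed_Int closed_INT closed_atLeastAtMost)
  moreover have "S t x \<noteq> {}"
    using minimizer_exists[of W t x, OF W_lip assms] by (auto simp: S_def E_def)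
  moreover have "bdd_above (S t x)" by (auto simp: S_def intro!: bdd_aboveI[of _ "x + t * A"])
  ultimately show ?thesis unfolding Y_def by (intro closed_contains_Sup)
qed

lemma Y_max: "y \<in> S t x \<Longrightarrow> y \<le> Y t x"
  unfolding Y_def by (rule cSup_upper) (auto simp: S_def intro!: bdd_aboveI[of _ "x + t * A"])

lemma Y_min: "0 < t \<Longrightarrow> E t x (Y t x) \<le> E t x y"
  using Y_in_S[of t x] by (auto simp: S_def)

lemma Y_bounds: "0 < t \<Longrightarrow> x - t * A \<le> Y t x \<and> Y t x \<le> x + t * A"
  using Y_in_S[of t x] by (auto simp: S_def)

lemma abs_Q_le: "0 < t \<Longrightarrow> \<bar>Q t x\<bar> \<le> A"
  using Y_bounds[of t x] by (auto simp: Q_def abs_le_iff field_simps)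

lemma abs_v_le: "\<bar>v t x\<bar> \<le> M"
  unfolding v_def by (rule abs_G_le)

lemma V_le: "0 < t \<Longrightarrow> V t x \<le> E t x y"
  unfolding V_def by (rule Y_min)

text \<open>Paths do not cross: if \<open>Y t x'\<close> were left of \<open>Y t x\<close>,
  exchanging the feet would not raise the total cost, so \<open>Y t x\<close> would also be optimal
  at \<open>x'\<close>, against the choice of the largest minimizer.\<close>

lemma Y_mono:
  assumes t: "0 < t" and "x \<le> x'" shows "Y t x \<le> Y t x'"
proof (rule ccontr)
  let ?y = "Y t x" and ?y' = "Y t x'"
  assume "\<not> ?thesis"
  then have less: "?y' < ?y" by simp
  have "L ((x - ?y') / t) + L ((x' - ?y) / t) \<le> L ((x - ?y) / t) + L ((x' - ?y') / t)"
    using assms less by (intro L_exchange) (auto simp: divide_right_mono add_divide_distrib diff_divide_distrib)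
  then have "t * L ((x - ?y') / t) + t * L ((x' - ?y) / t)
      \<le> t * L ((x - ?y) / t) + t * L ((x' - ?y') / t)"
    using t by (simp flip: distrib_left)
  moreover have "E t x ?y \<le> E t x ?y'" by (rule Y_min[OF t])
  ultimately have "E t x' ?y \<le> E t x' ?y'" by (simp add: E_def)
  then have "E t x' ?y \<le> E t x' y" for y using Y_min[OF t, of x' y] by (rule order_trans)
  moreover have "?y \<in> {x' - t * A..x' + t * A}"
    using less Y_bounds[OF t, of x] Y_bounds[OF t, of x'] assms by auto
  ultimately have "?y \<in> S t x'" by (auto simp: S_def)
  from Y_max[OF this] less show False by simp
qed

text \<open>Constancy along characteristics: a point on the segment from \<open>(0, Y t x)\<close> to \<open>(t, x)\<close> has the
  same largest minimizer as \<open>(t, x)\<close>.\<close>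

lemma Q_transport:
  assumes \<tau>: "0 < \<tau>" "\<tau> < t"
  shows "Q \<tau> (x - (t - \<tau>) * Q t x) = Q t x"
proof -
  define q y z where "q = Q t x" and "y = Y t x" and "z = x - (t - \<tau>) * q"
  define y' where "y' = Y \<tau> z"
  have t: "0 < t" using \<tau> by simp
  have xy: "x - y = t * q" using t by (simp add: q_def y_def Q_def)
  have zy: "z - y = \<tau> * q" using xy by (simp add: z_def algebra_simps)
  have zq: "(z - y) / \<tau> = q" "(x - y) / t = q" using zy xy \<tau> by auto
  have qA: "\<bar>q\<bar> \<le> A" unfolding q_def by (rule abs_Q_le[OF t])
  \<comment> \<open>The direct path from \<open>y'\<close> to \<open>x\<close> is compared with the
    one broken at \<open>z\<close>, whose last piece has speed \<open>q\<close>.\<close>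
  have "t * L ((x - y') / t) \<le> \<tau> * L ((z - y') / \<tau>) + (t - \<tau>) * L q"
    using perspective_le[of \<tau> "t - \<tau>" "z - y'" "(t - \<tau>) * q"] \<tau> by (simp add: z_def)
  then have 1: "E t x y' \<le> E \<tau> z y' + (t - \<tau>) * L q" by (simp add: E_def)
  have 2: "E t x y = E \<tau> z y + (t - \<tau>) * L q" by (simp add: E_def zq algebra_simps)
  have 3: "E t x y \<le> E t x y'" unfolding y_def by (rule Y_min[OF t])
  have 4: "E \<tau> z y' \<le> E \<tau> z y" unfolding y'_def by (rule Y_min[OF \<tau>(1)])
  \<comment> \<open>\<open>1\<close> to \<open>4\<close> form a closed chain of inequalities, hence
    all are equalities: \<open>y'\<close> is optimal at \<open>(t, x)\<close> and \<open>y\<close>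
    at \<open>(\<tau>, z)\<close>. As each is the largest minimizer at its own point, they
    coincide.\<close>
  have "E t x y' \<le> E t x w" for w
    using 1 2 4 Y_min[OF t, of x w] by (simp add: y_def)
  moreover have "\<bar>(t - \<tau>) * q\<bar> \<le> (t - \<tau>) * A"
    using qA \<tau> by (simp add: abs_mult mult_left_mono)
  then have "\<bar>x - z\<bar> \<le> (t - \<tau>) * A" by (simp add: z_def)
  then have "y' \<in> {x - t * A..x + t * A}"
    using Y_bounds[OF \<tau>(1), of z] by (auto simp: y'_def algebra_simps abs_le_iff)
  ultimately have "y' \<in> S t x" by (auto simp: S_def)
  then have "y' \<le> y" unfolding y_def by (rule Y_max)
  moreover have "E \<tau> z y \<le> E \<tau> z w" for w
    using 1 2 3 Y_min[OF \<tau>(1), of z w] by (simp add: y'_def)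
  moreover have "\<bar>\<tau> * q\<bar> \<le> \<tau> * A"
    using qA \<tau> by (simp add: abs_mult mult_left_mono)
  then have "\<bar>z - y\<bar> \<le> \<tau> * A" by (simp add: zy)
  then have "y \<in> {z - \<tau> * A..z + \<tau> * A}" by (auto simp: abs_le_iff)
  ultimately have "y \<in> S \<tau> z" "y' \<le> y" by (auto simp: S_def)
  then have "y \<le> y'" unfolding y'_def by (intro Y_max)
  with \<open>y' \<le> y\<close> have "y' = y" by simp
  then show ?thesis
    using zq by (simp add: Q_def[of \<tau>] y'_def flip: z_def q_def)
qed

section \<open>Slope of \<open>V t\<close> in space\<close>

lemma V_diff_le:
  assumes "0 < t" shows "V t x' - V t x \<le> (x' - x) * G ((x' - Y t x) / t)"
proof -
  let ?y = "Y t x"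
  have "V t x' - V t x \<le> E t x' ?y - E t x ?y" using V_le[OF assms, of x' ?y] by (simp add: V_def)
  also have "\<dots> = t * (L ((x' - ?y) / t) - L ((x - ?y) / t))" by (simp add: E_def algebra_simps)
  also have "\<dots> \<le> t * (((x' - ?y) / t - (x - ?y) / t) * G ((x' - ?y) / t))"
    using assms by (intro mult_left_mono L_diff_le) auto
  also have "\<dots> = (x' - x) * G ((x' - ?y) / t)" using assms by (simp flip: diff_divide_distrib)
  finally show ?thesis .
qed

lemma V_diff_ge:
  assumes "0 < t" shows "(x' - x) * G ((x - Y t x') / t) \<le> V t x' - V t x"
  using V_diff_le[OF assms, of x x'] by (simp add: algebra_simps)

lemma V_lipschitz:
  assumes "0 < t" shows "\<bar>V t x' - V t x\<bar> \<le> M * \<bar>x' - x\<bar>"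
proof -
  have "\<bar>(x' - x) * G r\<bar> \<le> M * \<bar>x' - x\<bar>" for r
    using mult_right_mono[OF abs_G_le[of r], of "\<bar>x' - x\<bar>"] by (simp add: abs_mult mult.commute)
  from this[of "(x' - Y t x) / t"] this[of "(x - Y t x') / t"] show ?thesis
    using V_diff_le[OF assms, of x' x] V_diff_ge[OF assms, of x' x] by linarith
qed

lemma V_cont: "0 < t \<Longrightarrow> continuous_on U (V t)"
  by (rule continuous_on_subset[OF lipschitz_on_continuous_on[of M UNIV]])
     (use M_pos V_lipschitz in \<open>auto intro!: lipschitz_onI simp: dist_real_def\<close>)

lemma G_tendsto:
  assumes "(g \<longlongrightarrow> q) F" shows "((\<lambda>x. G (g x)) \<longlongrightarrow> G q) F"
proof (rule Lim_null[THEN iffD2], rule Lim_null_comparison)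
  show "\<forall>\<^sub>F x in F. norm (G (g x) - G q) \<le> (\<bar>g x - q\<bar> / \<delta>) powr (1 / p)"
    using G_Hoelder by (intro always_eventually) auto
  have "((\<lambda>x. \<bar>g x - q\<bar> / \<delta>) \<longlongrightarrow> 0) F"
    using tendsto_divide[OF tendsto_rabs[OF tendsto_diff[OF assms tendsto_const[of q]]] tendsto_const[of \<delta>]] \<delta>_pos
    by simp
  then show "((\<lambda>x. (\<bar>g x - q\<bar> / \<delta>) powr (1 / p)) \<longlongrightarrow> 0) F"
    using \<delta>_pos p_pos by (intro tendsto_zero_powrI[where b="1/p"]) auto
qed

text \<open>The quotient lies between the values of \<open>G\<close> for the old foot seen from the
  new point and for the new foot seen from the old point. Both tend to \<open>v t x\<close> once the
  feet converge.\<close>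

lemma quotient_tendsto_v:
  assumes t: "0 < t" and g: "(g \<longlongrightarrow> x) F" "((\<lambda>i. Y t (g i)) \<longlongrightarrow> Y t x) F" "\<forall>\<^sub>F i in F. g i \<noteq> x"
  shows "((\<lambda>i. (V t (g i) - V t x) / (g i - x)) \<longlongrightarrow> v t x) F"
proof -
  let ?a = "\<lambda>i. G ((g i - Y t x) / t)" and ?b = "\<lambda>i. G ((x - Y t (g i)) / t)"
  have a: "(?a \<longlongrightarrow> v t x) F" unfolding v_def Q_def
    using t by (intro G_tendsto tendsto_intros g) auto
  have b: "(?b \<longlongrightarrow> v t x) F" unfolding v_def Q_def
    using t by (intro G_tendsto tendsto_intros g) auto
  have *: "min (?a i) (?b i) \<le> (V t (g i) - V t x) / (g i - x) \<and>
      (V t (g i) - V t x) / (g i - x) \<le> max (?a i) (?b i)" if "g i \<noteq> x" for i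
  proof (cases "g i > x")
    case True
    then show ?thesis
      using V_diff_le[OF t, of "g i" x] V_diff_ge[OF t, of "g i" x]
      by (simp add: field_simps min_le_iff_disj le_max_iff_disj)
  next
    case False
    then show ?thesis
      using that V_diff_le[OF t, of "g i" x] V_diff_ge[OF t, of "g i" x]
      by (simp add: field_simps min_le_iff_disj le_max_iff_disj)
  qed
  show ?thesis
  proof (rule tendsto_sandwich)
    show "\<forall>\<^sub>F i in F. min (?a i) (?b i) \<le> (V t (g i) - V t x) / (g i - x)"
      using g(3) by eventually_elim (use * in blast)
    show "\<forall>\<^sub>F i in F. (V t (g i) - V t x) / (g i - x) \<le> max (?a i) (?b i)"
      using g(3) by eventually_elim (use * in blast)
    show "((\<lambda>i. min (?a i) (?b i)) \<longlongrightarrow> v t x) F" using tendsto_min[OF a b] by simp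
    show "((\<lambda>i. max (?a i) (?b i)) \<longlongrightarrow> v t x) F" using tendsto_max[OF a b] by simp
  qed
qed

text \<open>A limit of minimizers is a minimizer, hence at most the largest one; monotonicity gives
  the reverse. So forward quotients of \<open>V t\<close> converge to \<open>v t\<close> at every
  point, not just almost everywhere.\<close>

lemma Y_right_limit:
  assumes t: "0 < t"
  shows "(\<lambda>n. Y t (x + 1 / real (Suc n))) \<longlonglongrightarrow> Y t x"
proof -
  let ?x = "\<lambda>n. x + 1 / real (Suc n)"
  have dec: "decseq (\<lambda>n. Y t (?x n))"
    by (intro decseq_SucI Y_mono[OF t]) (auto simp: field_simps)
  have "\<forall>n. Y t x \<le> Y t (?x n)" by (intro allI Y_mono[OF t]) auto
  from decseq_convergent[OF dec this] obtain l where l: "(\<lambda>n. Y t (?x n)) \<longlonglongrightarrow> l" "\<forall>n. l \<le> Y t (?x n)"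
    by blast
  have x: "?x \<longlonglongrightarrow> x"
    using tendsto_add[OF tendsto_const[of x] LIMSEQ_inverse_real_of_nat] by (simp only: inverse_eq_divide add_0_right)
  have E: "(\<lambda>n. E t (?x n) (w n)) \<longlonglongrightarrow> E t x w'" if "w \<longlonglongrightarrow> w'" for w w'
  proof -
    have "isCont (\<lambda>(x, y). E t x y) (x, w')"
      using E_cont2[of t] by (simp add: continuous_on_eq_continuous_at)
    from isCont_tendsto_compose[OF this tendsto_Pair[OF x that]] show ?thesis by simp
  qed
  have "E t x l \<le> E t x w" for w
    by (rule LIMSEQ_le[OF E[OF l(1)] E[OF tendsto_const]]) (use Y_min[OF t] in auto)
  moreover have "l \<le> x + t * A"
    by (rule LIMSEQ_le[OF l(1) tendsto_add[OF x tendsto_const]]) (use Y_bounds[OF t] in auto)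
  moreover have "x - t * A \<le> l"
    by (rule LIMSEQ_le[OF tendsto_diff[OF x tendsto_const] l(1)]) (use Y_bounds[OF t] in auto)
  ultimately have "l \<in> S t x" by (auto simp: S_def)
  then have "l \<le> Y t x" by (rule Y_max)
  moreover have "Y t x \<le> l"
    by (rule LIMSEQ_le_const[OF l(1)]) (auto intro!: Y_mono[OF t])
  ultimately show ?thesis using l(1) by simp
qed

text \<open>Forward quotients converge to \<open>v t\<close> everywhere, are bounded by
  \<open>M\<close>, and their integrals telescope to averages of \<open>V t\<close> over short
  intervals at the two ends. Dominated convergence finishes, without a theorem on almost everywhere
  differentiability.\<close>

lemma V_integral:
  assumes t: "0 < t" and "y \<le> z"
  shows "(v t has_integral (V t z - V t y)) {y..z}"
proof -
  define h where "h n = 1 / real (Suc n)" for n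
  define D where "D n x = (V t (x + h n) - V t x) / h n" for n x
  have h: "0 < h n" for n by (simp add: h_def)
  have h0: "h \<longlonglongrightarrow> 0"
    unfolding h_def using LIMSEQ_inverse_real_of_nat by (simp only: inverse_eq_divide)
  have x: "(\<lambda>n. x + h n) \<longlonglongrightarrow> x" for x
    using tendsto_add[OF tendsto_const[of x] h0] by simp
  have int: "V t integrable_on {a..b}" for a b by (intro integrable_continuous_real V_cont t)
  have Dc: "continuous_on {y..z} (D n)" for n
    unfolding D_def using h[of n]
    by (intro continuous_intros V_cont[OF t] continuous_on_compose2[OF V_cont[OF t, of UNIV]]) auto
  have local: "\<bar>integral {c..c + h n} (V t) / h n - V t c\<bar> \<le> M * h n" for c n
  proof -
    have "norm (integral {c..c + h n} (\<lambda>w. V t w - V t c)) \<le> M * h n * (c + h n - c)"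
    proof (rule integral_bound)
      show "c \<le> c + h n" using h[of n] by simp
      show "continuous_on {c..c + h n} (\<lambda>w. V t w - V t c)" by (intro continuous_intros V_cont t)
      fix w assume "w \<in> {c..c + h n}"
      then have "M * \<bar>w - c\<bar> \<le> M * h n" using M_pos by (intro mult_left_mono) auto
      with V_lipschitz[OF t, of w c] show "norm (V t w - V t c) \<le> M * h n" by simp
    qed
    also have "integral {c..c + h n} (\<lambda>w. V t w - V t c) = integral {c..c + h n} (V t) - h n * V t c"
      using h[of n] by (subst integral_diff) (auto intro: int)
    finally show ?thesis using h[of n]
      by (simp add: abs_le_iff field_simps)
  qed
  have local_lim: "(\<lambda>n. integral {c..c + h n} (V t) / h n) \<longlonglongrightarrow> V t c" for c
  proof (rule Lim_null[THEN iffD2], rule Lim_null_comparison)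
    show "\<forall>\<^sub>F n in sequentially. norm (integral {c..c + h n} (V t) / h n - V t c) \<le> M * h n"
      using local by simp
    show "(\<lambda>n. M * h n) \<longlonglongrightarrow> 0" using tendsto_mult[OF tendsto_const[of M] h0] by simp
  qed
  have eq: "integral {y..z} (D n) = integral {z..z + h n} (V t) / h n - integral {y..y + h n} (V t) / h n" for n
  proof -
    have "integral {y..z} (\<lambda>x. V t (x + h n)) = integral {y + h n..z + h n} (V t)"
      using integral_shift[of y "h n" z "V t"] V_cont[OF t] by (simp add: o_def add.commute)
    moreover have "integral {y..y + h n} (V t) + integral {y + h n..z + h n} (V t) = integral {y..z + h n} (V t)"
      using h[of n] \<open>y \<le> z\<close> by (intro Henstock_Kurzweil_Integration.integral_combine int) auto
    moreover have "integral {y..z} (V t) + integral {z..z + h n} (V t) = integral {y..z + h n} (V t)"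
      using h[of n] \<open>y \<le> z\<close> by (intro Henstock_Kurzweil_Integration.integral_combine int) auto
    moreover have "integral {y..z} (D n)
        = (integral {y..z} (\<lambda>x. V t (x + h n)) - integral {y..z} (V t)) / h n"
      unfolding D_def integral_divide
      by (subst integral_diff)
         (auto intro!: integrable_continuous_real V_cont[OF t] continuous_intros continuous_on_compose2[OF V_cont[OF t, of UNIV]])
    ultimately show ?thesis by (simp flip: diff_divide_distrib)
  qed
  show ?thesis
  proof (rule has_integral_dominated_convergence)
    show "(D n has_integral (integral {z..z + h n} (V t) / h n - integral {y..y + h n} (V t) / h n)) {y..z}" for n
      unfolding eq[symmetric] by (intro integrable_integral integrable_continuous_real Dc)
    show "(\<lambda>x. M) integrable_on {y..z}" by (intro integrable_continuous_real continuous_intros)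
    have "norm (D n x) \<le> M" for n x
      using V_lipschitz[OF t, of "x + h n" x] h[of n] by (simp add: D_def pos_divide_le_eq)
    then show "\<forall>x\<in>{y..z}. norm (D n x) \<le> M" for n by blast
    show "\<forall>x\<in>{y..z}. (\<lambda>n. D n x) \<longlonglongrightarrow> v t x"
      using quotient_tendsto_v[OF t x] Y_right_limit[OF t] h by (simp add: D_def h_def)
    show "(\<lambda>n. integral {z..z + h n} (V t) / h n - integral {y..y + h n} (V t) / h n) \<longlonglongrightarrow> V t z - V t y"
      by (intro tendsto_diff local_lim)
  qed
qed

text \<open>By continuity in \<open>y\<close> the minimum is an infimum over rational
  \<open>y\<close>; joint measurability of \<open>V\<close> in \<open>(t, x)\<close> rests on this
  countability.\<close>

lemma V_less_iff:
  assumes "0 < t" shows "V t x < c \<longleftrightarrow> (\<exists>y\<in>\<rat>. E t x y < c)"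
proof
  assume "V t x < c"
  then have "Y t x \<in> {y. E t x y < c}" by (simp add: V_def)
  moreover have "open {y. E t x y < c}"
    using open_Collect_less[OF E_cont[of UNIV t x] continuous_on_const, of c] by simp
  ultimately obtain e where e: "e > 0" "ball (Y t x) e \<subseteq> {y. E t x y < c}"
    using openE by blast
  obtain y where "y \<in> \<rat>" "Y t x < y" "y < Y t x + e"
    using Rats_dense_in_real[of "Y t x" "Y t x + e"] e(1) by auto
  then show "\<exists>y\<in>\<rat>. E t x y < c" using e(2) by (intro bexI[of _ y]) (auto simp: ball_def dist_real_def subset_iff)
next
  assume "\<exists>y\<in>\<rat>. E t x y < c"
  then show "V t x < c" using V_le[OF assms] by (meson order_le_less_trans)
qed

lemma V_measurable: "(\<lambda>(t, x). if 0 < t then V t x else 0) \<in> borel_measurable (borel \<Otimes>\<^sub>M borel)"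
proof (rule borel_measurable_iff_less[THEN iffD2], rule allI)
  fix c :: real
  have "{z \<in> space (borel \<Otimes>\<^sub>M borel). (case z of (t, x) \<Rightarrow> if 0 < t then V t x else 0) < c}
      = (\<Union>y\<in>\<rat>. {z \<in> space (borel \<Otimes>\<^sub>M borel). 0 < fst z \<and> E (fst z) (snd z) y < c})
        \<union> {z \<in> space (borel \<Otimes>\<^sub>M borel). \<not> 0 < fst z \<and> 0 < c}"
    by (auto simp: V_less_iff split: if_splits)
  also have "\<dots> \<in> sets (borel \<Otimes>\<^sub>M borel)"
  proof (rule sets.Un)
    show "(\<Union>y\<in>\<rat>. {z \<in> space (borel \<Otimes>\<^sub>M borel). 0 < fst z \<and> E (fst z) (snd z) y < c}) \<in> sets (borel \<Otimes>\<^sub>M borel)"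
      unfolding E_def by (rule sets.countable_UN'[OF countable_rat]) (rule image_subsetI, measurable)
  qed measurable
  finally show "{z \<in> space (borel \<Otimes>\<^sub>M borel). (case z of (t, x) \<Rightarrow> if 0 < t then V t x else 0) < c}
    \<in> sets (borel \<Otimes>\<^sub>M borel)" .
qed

text \<open>A pointwise limit of forward quotients of \<open>V\<close>; the value 0 for
  \<open>t \<le> 0\<close> makes it a Borel function on the whole plane.\<close>

lemma v_measurable: "(\<lambda>(t, x). if 0 < t then v t x else 0) \<in> borel_measurable (borel \<Otimes>\<^sub>M borel)"
proof -
  define V' where "V' z = (if 0 < fst z then V (fst z) (snd z) else 0)" for z :: "real \<times> real"
  have V' [measurable]: "V' \<in> borel_measurable (borel \<Otimes>\<^sub>M borel)"
    using V_measurable unfolding V'_def case_prod_beta .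
  show ?thesis
  proof (rule borel_measurable_LIMSEQ_real)
    fix z :: "real \<times> real"
    obtain t x where z: "z = (t, x)" by fastforce
    show "(\<lambda>n. real (Suc n) * (V' (fst z, snd z + 1 / real (Suc n)) - V' z)) \<longlonglongrightarrow> (case z of (t, x) \<Rightarrow> if 0 < t then v t x else 0)"
    proof (cases "0 < t")
      case True
      have "(\<lambda>n. x + 1 / real (Suc n)) \<longlonglongrightarrow> x"
        using tendsto_add[OF tendsto_const[of x] LIMSEQ_inverse_real_of_nat] by (simp add: inverse_eq_divide)
      from quotient_tendsto_v[OF True this Y_right_limit[OF True]]
      show ?thesis using True by (simp add: z V'_def mult.commute)
    qed (simp add: z V'_def)
  qed measurable
qed

lemma v_measurable_snd: "0 < t \<Longrightarrow> v t \<in> borel_measurable borel"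
proof -
  assume t: "0 < t"
  have [measurable]: "Y t \<in> borel_measurable borel"
    by (rule borel_measurable_mono) (simp add: mono_def Y_mono[OF t])
  show ?thesis unfolding v_def Q_def by measurable
qed

text \<open>Where the initial potential is locally constant, \<open>L\<close> is minimal at \<open>Q t x\<close>, so its slope \<open>v t x\<close>
  there vanishes.\<close>

lemma v_eq_0:
  assumes t: "0 < t" and R: "\<And>y. R \<le> y \<Longrightarrow> W y = W R" "\<And>y. y \<le> - R \<Longrightarrow> W y = W (- R)"
    and x: "R + t * A < \<bar>x\<bar>"
  shows "v t x = 0"
proof -
  let ?y = "Y t x"
  have "R < ?y \<or> ?y < - R" using x Y_bounds[OF t, of x] by linarith
  then obtain e where e: "e > 0" "\<And>w. \<bar>w - ?y\<bar> < e \<Longrightarrow> W w = W ?y"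
  proof
    assume "R < ?y"
    then have "W w = W ?y" if "\<bar>w - ?y\<bar> < ?y - R" for w
      using R(1)[of w] R(1)[of ?y] that by linarith
    moreover have "0 < ?y - R" using \<open>R < ?y\<close> by simp
    ultimately show thesis using that by blast
  next
    assume "?y < - R"
    then have "W w = W ?y" if "\<bar>w - ?y\<bar> < - R - ?y" for w
      using R(2)[of w] R(2)[of ?y] that by linarith
    moreover have "0 < - R - ?y" using \<open>?y < - R\<close> by simp
    ultimately show thesis using that by blast
  qed
  \<comment> \<open>Moving the foot by \<open>- t h\<close> leaves \<open>W\<close> unchanged, so
    optimality of the foot makes \<open>Q t x\<close> a local minimum of \<open>L\<close>. The
    subgradient at \<open>Q t x + h\<close> then cannot have the sign opposite to
    \<open>h\<close>.\<close>
  have pos: "0 \<le> h * G (Q t x + h)" if "\<bar>h\<bar> < e / t" for h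
  proof -
    have "\<bar>?y - t * h - ?y\<bar> < e" using that t by (simp add: abs_mult field_simps)
    then have "W (?y - t * h) = W ?y" by (rule e(2))
    moreover have "(x - (?y - t * h)) / t = Q t x + h" using t by (simp add: Q_def field_simps)
    ultimately have "t * L (Q t x) \<le> t * L (Q t x + h)"
      using Y_min[OF t, of x "?y - t * h"] by (simp add: E_def Q_def)
    then have "L (Q t x) \<le> L (Q t x + h)" using t by simp
    with L_diff_le[of "Q t x + h" "Q t x"] show ?thesis by simp
  qed
  have lim: "((\<lambda>h. G (Q t x + h)) \<longlongrightarrow> v t x) (at 0 within T)" for T
    unfolding v_def by (rule G_tendsto) (auto intro!: tendsto_eq_intros)
  have "0 \<le> v t x"
  proof (rule tendsto_lowerbound[OF lim[of "{0<..}"]])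
    have "\<forall>\<^sub>F h in at_right 0. h \<in> {0<..<e / t}" using e(1) t by (intro eventually_at_right_real) auto
    then show "\<forall>\<^sub>F h in at_right 0. 0 \<le> G (Q t x + h)"
    proof eventually_elim
      case (elim h)
      then show ?case using pos[of h] by (simp add: zero_le_mult_iff)
    qed
  qed simp
  moreover have "v t x \<le> 0"
  proof (rule tendsto_upperbound[OF lim[of "{..<0}"]])
    have "\<forall>\<^sub>F h in at_left 0. h \<in> {- (e / t)<..<0}" using e(1) t by (intro eventually_at_left_real) auto
    then show "\<forall>\<^sub>F h in at_left 0. G (Q t x + h) \<le> 0"
    proof eventually_elim
      case (elim h)
      then show ?case using pos[of h] by (simp add: zero_le_mult_iff)
    qed
  qed simp
  ultimately show ?thesis by simp
qed

end

section \<open>Regularity of the Lax-Oleinik solution\<close>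

lemma set_integrable_bounded_Icc:
  fixes g :: "real \<Rightarrow> real"
  assumes [measurable]: "g \<in> borel_measurable borel" and "\<And>x. x \<in> {\<alpha>..\<beta>} \<Longrightarrow> \<bar>g x\<bar> \<le> B"
  shows "set_integrable lborel {\<alpha>..\<beta>} g"
  unfolding set_integrable_def
  by (rule integrableI_bounded_set_indicator[where B = B]) (use assms(2) in \<open>auto simp: emeasure_lborel_Icc_eq\<close>)

text \<open>The increments of \<open>F\<close> dominate and telescope along every subdivision. The
  function itself serves as representative in the infimum.\<close>

lemma TVs_le:
  assumes w: "\<And>x x'. x \<in> I \<Longrightarrow> x' \<in> I \<Longrightarrow> x \<le> x' \<Longrightarrow> \<bar>w x' - w x\<bar> powr (1 / s) \<le> F x' - F x"
    and F: "\<And>x x'. x \<in> I \<Longrightarrow> x' \<in> I \<Longrightarrow> F x' - F x \<le> B" and B: "0 \<le> B"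
  shows "TVs s I w \<le> ennreal B"
proof -
  have "TVs s I w \<le> TVs_pointwise s I w" unfolding TVs_def by (rule INF_lower) simp
  also have "\<dots> \<le> ennreal B" unfolding TVs_pointwise_def
  proof (rule SUP_least, elim CollectE conjE)
    fix \<sigma> assume \<sigma>: "sorted_wrt (<) \<sigma>" "set \<sigma> \<subseteq> I"
    have mem: "\<sigma> ! i \<in> I" if "i < length \<sigma>" for i using that \<sigma>(2) by auto
    have "(\<Sum>i = 1..<length \<sigma>. \<bar>w (\<sigma> ! i) - w (\<sigma> ! (i - 1))\<bar> powr (1 / s)) \<le> B"
    proof (cases "length \<sigma>")
      case 0
      then show ?thesis using B by simp
    next
      case (Suc m)
      have "(\<Sum>i = 1..<length \<sigma>. \<bar>w (\<sigma> ! i) - w (\<sigma> ! (i - 1))\<bar> powr (1 / s))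
          = (\<Sum>i<m. \<bar>w (\<sigma> ! Suc i) - w (\<sigma> ! i)\<bar> powr (1 / s))"
        unfolding Suc One_nat_def sum.shift_bounds_Suc_ivl by (simp add: atLeast0LessThan)
      also have "\<dots> \<le> (\<Sum>i<m. F (\<sigma> ! Suc i) - F (\<sigma> ! i))"
        using Suc \<sigma>(1) by (intro sum_mono w mem) (auto simp: sorted_wrt_iff_nth_less less_imp_le)
      also have "\<dots> = F (\<sigma> ! m) - F (\<sigma> ! 0)" by (rule sum_lessThan_telescope)
      also have "\<dots> \<le> B" using Suc by (intro F mem) auto
      finally show ?thesis .
    qed
    then show "ennreal (\<Sum>i = 1..<length \<sigma>. \<bar>w (\<sigma> ! i) - w (\<sigma> ! (i - 1))\<bar> powr (1 / s)) \<le> ennreal B"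
      by (rule ennreal_leI)
  qed
  finally show ?thesis .
qed

lemma TVs_uminus: "TVs s I (\<lambda>x. - w x) \<le> TVs s I w"
proof -
  have eq: "TVs_pointwise s I (\<lambda>x. - w x) = TVs_pointwise s I w" for w
    unfolding TVs_pointwise_def by (simp add: abs_minus_commute)
  show ?thesis unfolding TVs_def
  proof (rule INF_mono)
    fix z assume "z \<in> {z. AE x in lborel. x \<in> I \<longrightarrow> z x = w x}"
    then have "(\<lambda>x. - z x) \<in> {z. AE x in lborel. x \<in> I \<longrightarrow> z x = - w x}" by auto
    then show "\<exists>z'\<in>{z. AE x in lborel. x \<in> I \<longrightarrow> z x = - w x}. TVs_pointwise s I z' \<le> TVs_pointwise s I z"
      by (intro bexI[of _ "\<lambda>x. - z x"]) (simp_all add: eq)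
  qed
qed

lemma BVs_loc_uminus: "w \<in> BVs_loc s \<Longrightarrow> (\<lambda>x. - w x) \<in> BVs_loc s"
  unfolding BVs_loc_def BVs_def using TVs_uminus order_le_less_trans by blast

lemma Lip_Lq_uminus: "w \<in> Lip_Lq s q J \<Longrightarrow> (\<lambda>t x. - w t x) \<in> Lip_Lq s q J"
proof -
  have eq: "Lq_norm q J (\<lambda>x. - a x - - b x) = Lq_norm q J (\<lambda>x. a x - b x)" for a b :: "real \<Rightarrow> real"
    unfolding Lq_norm_def by (simp add: abs_minus_commute)
  have "(\<lambda>x. - a x) \<in> Lq q J" if "a \<in> Lq q J" for a
    using that unfolding Lq_def set_borel_measurable_def by simp
  then show "w \<in> Lip_Lq s q J \<Longrightarrow> (\<lambda>t x. - w t x) \<in> Lip_Lq s q J"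
    unfolding Lip_Lq_def by (simp only: mem_Collect_eq eq) blast
qed

lemma Lip_Lq_loc_uminus: "w \<in> Lip_Lq_loc s q \<Longrightarrow> (\<lambda>t x. - w t x) \<in> Lip_Lq_loc s q"
  unfolding Lip_Lq_loc_def using Lip_Lq_uminus by blast

section \<open>Estimates for \<open>v\<close> in space and in time\<close>

context lax_oleinik
begin

lemma v_diff_powr: "\<bar>v t x - v \<tau> x'\<bar> powr p \<le> \<bar>Q t x - Q \<tau> x'\<bar> / \<delta>"
  unfolding v_def by (rule G_Hoelder_powr)

text \<open>\<open>Q t\<close> is the difference of the nondecreasing functions \<open>x / t\<close>
  and \<open>Y t x / t\<close>, so its increments are bounded by those of their sum, which becomes
  the dominating function in \<open>TVs_le\<close>.\<close>

lemma v_diff_powr_space: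
  assumes "0 < t" "x \<le> x'"
  shows "\<bar>v t x' - v t x\<bar> powr p \<le> (x' + Y t x') / (\<delta> * t) - (x + Y t x) / (\<delta> * t)"
proof -
  have "\<bar>Q t x' - Q t x\<bar> = \<bar>(x' - x) - (Y t x' - Y t x)\<bar> / t"
    using assms(1) by (simp add: Q_def abs_divide flip: diff_divide_distrib)
  also have "\<dots> \<le> ((x' - x) + (Y t x' - Y t x)) / t"
    using assms Y_mono[OF assms] by (intro divide_right_mono) auto
  finally have "\<bar>Q t x' - Q t x\<bar> / \<delta> \<le> ((x' - x) + (Y t x' - Y t x)) / t / \<delta>"
    using \<delta>_pos by (intro divide_right_mono) auto
  also have "\<dots> = (x' + Y t x') / (\<delta> * t) - (x + Y t x) / (\<delta> * t)"
    by (simp add: mult.commute flip: diff_divide_distrib)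
  finally show ?thesis using v_diff_powr[of t x' t x] by linarith
qed

lemma v_BVs_loc: "0 < t \<Longrightarrow> v t \<in> BVs_loc (1 / p)"
proof -
  assume t: "0 < t"
  have "TVs (1 / p) {\<alpha>..\<beta>} (v t) < \<infinity>" for \<alpha> \<beta>
  proof -
    let ?F = "\<lambda>x. (x + Y t x) / (\<delta> * t)"
    have "TVs (1 / p) {\<alpha>..\<beta>} (v t) \<le> ennreal \<bar>?F \<beta> - ?F \<alpha>\<bar>"
    proof (rule TVs_le[where F = ?F])
      fix x x' assume x: "x \<in> {\<alpha>..\<beta>}" "x' \<in> {\<alpha>..\<beta>}"
      have "?F x' \<le> ?F \<beta>" "?F \<alpha> \<le> ?F x"
        using x t \<delta>_pos by (auto intro!: divide_right_mono add_mono Y_mono)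
      then show "?F x' - ?F x \<le> \<bar>?F \<beta> - ?F \<alpha>\<bar>" by linarith
    qed (use v_diff_powr_space[OF t] in auto)
    then show ?thesis by (simp add: order_le_less_trans)
  qed
  then show ?thesis by (simp add: BVs_loc_def BVs_def)
qed

lemma v_TVs_UNIV:
  assumes t: "0 < t" and R: "0 \<le> R" "\<And>x. R + t * A < \<bar>x\<bar> \<Longrightarrow> v t x = 0"
  shows "TVs (1 / p) UNIV (v t) \<le> ennreal ((4 * R + 4 + 6 * A) / \<delta> * (1 + 1 / t))"
proof (rule TVs_le)
  \<comment> \<open>The margin 1 puts both ends \<open>R'\<close> and \<open>- R'\<close> strictly
    inside the region where \<open>v t\<close> vanishes, so truncating the argument by
    \<open>c\<close> does not change \<open>v t\<close>. The dominating function then has bounded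
    increments on the whole line.\<close>
  define R' where "R' = R + t * A + 1"
  define c where "c x = max (- R') (min R' x)" for x :: real
  have R': "0 \<le> R'" using R t A_pos by (simp add: R'_def)
  have c: "\<bar>c x\<bar> \<le> R'" for x using R' by (auto simp: c_def)
  have vc: "v t x = v t (c x)" for x
  proof (cases "\<bar>x\<bar> \<le> R'")
    case True
    then have "c x = x" by (auto simp: c_def)
    then show ?thesis by simp
  next
    case False
    then have "\<bar>c x\<bar> = R'" using R' by (auto simp: c_def)
    then show ?thesis using R(2)[of x] R(2)[of "c x"] False by (auto simp: R'_def)
  qed
  let ?F = "\<lambda>x. (c x + Y t (c x)) / (\<delta> * t)"
  show "\<bar>v t x' - v t x\<bar> powr (1 / (1 / p)) \<le> ?F x' - ?F x" if "x \<le> x'" for x x'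
    using v_diff_powr_space[OF t, of "c x" "c x'"] that by (simp add: vc[of x] vc[of x'] c_def)
  show "?F x' - ?F x \<le> (4 * R + 4 + 6 * A) / \<delta> * (1 + 1 / t)" for x x'
  proof -
    \<comment> \<open>The truncated points contribute \<open>2 R'\<close> and their feet
      \<open>2 R' + 2 t A\<close>, in total \<open>4 R + 4 + 6 t A\<close>. The factor
      \<open>1 + t\<close>, divided by \<open>t\<close>, is the origin of
      \<open>1 + 1 / t\<close>.\<close>
    have "c x' + Y t (c x') - (c x + Y t (c x)) \<le> 4 * R' + 2 * (t * A)"
      using c[of x] c[of x'] Y_bounds[OF t, of "c x"] Y_bounds[OF t, of "c x'"] by linarith
    also have "\<dots> \<le> (4 * R + 4 + 6 * A) * (1 + t)"
      using t R(1) A_pos by (simp add: R'_def algebra_simps)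
    finally have "?F x' - ?F x \<le> (4 * R + 4 + 6 * A) * (1 + t) / (\<delta> * t)"
      using t \<delta>_pos by (simp add: divide_right_mono flip: diff_divide_distrib)
    also have "\<dots> = (4 * R + 4 + 6 * A) / \<delta> * (1 + 1 / t)"
      using t \<delta>_pos by (simp add: field_simps)
    finally show ?thesis .
  qed
  show "0 \<le> (4 * R + 4 + 6 * A) / \<delta> * (1 + 1 / t)" using t R(1) A_pos \<delta>_pos by simp
qed

lemma Y_integrable: "0 < t \<Longrightarrow> Y t integrable_on {\<alpha>..\<beta>}"
  by (rule integrable_on_mono_on) (auto simp: mono_on_def Y_mono)

lemma v_diff_measurable: "0 < t \<Longrightarrow> 0 < \<tau> \<Longrightarrow> (\<lambda>x. \<bar>v t x - v \<tau> x\<bar> powr p) \<in> borel_measurable borel"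
  using v_measurable_snd[of t] v_measurable_snd[of \<tau>] by measurable

lemma v_diff_bound: "\<bar>\<bar>v t x - v \<tau> x\<bar> powr p\<bar> \<le> (2 * M) powr p"
  using abs_v_le[of t x] abs_v_le[of \<tau> x] p_pos by (simp add: powr_mono2)

text \<open>By \<open>Q_transport\<close>, \<open>v t x\<close> is \<open>v \<tau> z\<close> at the
  point \<open>z\<close> where the characteristic passes at time \<open>\<tau>\<close>, within
  \<open>A (t - \<tau>)\<close> of \<open>x\<close>. Monotonicity bounds the change of foot between
  \<open>z\<close> and \<open>x\<close> by the increment of \<open>Y \<tau>\<close> over the window
  around \<open>x\<close>.\<close>

lemma v_diff_powr_time:
  assumes \<tau>: "0 < \<tau>" "\<tau> < t"
  shows "\<bar>v t x - v \<tau> x\<bar> powr p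
    \<le> (A * (t - \<tau>) + Y \<tau> (x + A * (t - \<tau>)) - Y \<tau> (x - A * (t - \<tau>))) / (\<delta> * \<tau>)"
proof -
  define l z where "l = A * (t - \<tau>)" and "z = x - (t - \<tau>) * Q t x"
  have "\<bar>(t - \<tau>) * Q t x\<bar> \<le> (t - \<tau>) * A"
    using \<tau> abs_Q_le[of t x] by (simp add: abs_mult mult_left_mono)
  then have z: "\<bar>z - x\<bar> \<le> l" by (simp add: z_def l_def mult.commute)
  have "Y \<tau> (x - l) \<le> Y \<tau> z" "Y \<tau> z \<le> Y \<tau> (x + l)" "Y \<tau> (x - l) \<le> Y \<tau> x" "Y \<tau> x \<le> Y \<tau> (x + l)"
    using z by (auto intro!: Y_mono[OF \<tau>(1)])
  then have "\<bar>(z - x) - (Y \<tau> z - Y \<tau> x)\<bar> \<le> l + Y \<tau> (x + l) - Y \<tau> (x - l)" using z by linarith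
  moreover have "Q \<tau> z - Q \<tau> x = ((z - x) - (Y \<tau> z - Y \<tau> x)) / \<tau>"
    by (simp add: Q_def flip: diff_divide_distrib)
  ultimately have "\<bar>Q \<tau> z - Q \<tau> x\<bar> \<le> (l + Y \<tau> (x + l) - Y \<tau> (x - l)) / \<tau>"
    using \<tau> by (simp add: abs_divide divide_right_mono)
  then have "\<bar>Q \<tau> z - Q \<tau> x\<bar> / \<delta> \<le> (l + Y \<tau> (x + l) - Y \<tau> (x - l)) / \<tau> / \<delta>"
    using \<delta>_pos by (intro divide_right_mono) auto
  moreover have "\<bar>v t x - v \<tau> x\<bar> powr p \<le> \<bar>Q \<tau> z - Q \<tau> x\<bar> / \<delta>"
    using v_diff_powr[of t x \<tau> x] Q_transport[OF \<tau>, of x] by (simp add: z_def)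
  ultimately show ?thesis by (simp add: l_def mult.commute)
qed

text \<open>With \<open>l = A (t - \<tau>)\<close>, the common part of the integrals of
  \<open>Y \<tau> (x + l)\<close> and \<open>Y \<tau> (x - l)\<close> cancels. Two intervals of
  length \<open>2 l\<close> at the ends remain, so the bound is of order \<open>l\<close> although
  \<open>Y \<tau>\<close> may jump.\<close>

lemma v_time_integral:
  assumes \<tau>: "0 < \<tau>" "\<tau> < t" and "\<alpha> \<le> \<beta>"
  shows "(LINT x:{\<alpha>..\<beta>}|lborel. \<bar>v t x - v \<tau> x\<bar> powr p)
    \<le> A * (t - \<tau>) * (3 * (\<beta> - \<alpha>) + 4 * (A * (t - \<tau>)) + 4 * (\<tau> * A)) / (\<delta> * \<tau>)"
proof -
  define l where "l = A * (t - \<tau>)"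
  have l: "0 < l" using \<tau> A_pos by (simp add: l_def)
  have int: "Y \<tau> integrable_on {a..b}" for a b by (rule Y_integrable[OF \<tau>(1)])
  have shift: "((\<lambda>x. Y \<tau> (x + c)) has_integral integral {\<alpha> + c..\<beta> + c} (Y \<tau>)) {\<alpha>..\<beta>}" for c
    using has_integral_shift_real_ivl[OF integrable_integral[OF int[of "\<alpha> + c" "\<beta> + c"]], of c] by simp
  define I where "I = integral {\<alpha> + l..\<beta> + l} (Y \<tau>) - integral {\<alpha> - l..\<beta> - l} (Y \<tau>)"
  have "((\<lambda>x. l + Y \<tau> (x + l) - Y \<tau> (x - l)) has_integral (l * (\<beta> - \<alpha>) + integral {\<alpha> + l..\<beta> + l} (Y \<tau>) - integral {\<alpha> - l..\<beta> - l} (Y \<tau>))) {\<alpha>..\<beta>}"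
    using has_integral_const_real[of l \<alpha> \<beta>] shift[of l] shift[of "- l"] \<open>\<alpha> \<le> \<beta>\<close>
    by (intro has_integral_diff has_integral_add) (auto simp: mult.commute)
  then have rhs: "((\<lambda>x. (l + Y \<tau> (x + l) - Y \<tau> (x - l)) / (\<delta> * \<tau>)) has_integral (l * (\<beta> - \<alpha>) + I) / (\<delta> * \<tau>)) {\<alpha>..\<beta>}"
    unfolding I_def by (intro has_integral_divide) (simp add: algebra_simps)
  have "integral {\<alpha> - l..\<alpha> + l} (Y \<tau>) + integral {\<alpha> + l..\<beta> + l} (Y \<tau>) = integral {\<alpha> - l..\<beta> + l} (Y \<tau>)"
    using l \<open>\<alpha> \<le> \<beta>\<close> by (intro Henstock_Kurzweil_Integration.integral_combine int) auto
  moreover have "integral {\<alpha> - l..\<beta> - l} (Y \<tau>) + integral {\<beta> - l..\<beta> + l} (Y \<tau>) = integral {\<alpha> - l..\<beta> + l} (Y \<tau>)"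
    using l \<open>\<alpha> \<le> \<beta>\<close> by (intro Henstock_Kurzweil_Integration.integral_combine int) auto
  ultimately have I: "I = integral {\<beta> - l..\<beta> + l} (Y \<tau>) - integral {\<alpha> - l..\<alpha> + l} (Y \<tau>)" by (simp add: I_def)
  have "integral {\<beta> - l..\<beta> + l} (Y \<tau>) \<le> integral {\<beta> - l..\<beta> + l} (\<lambda>x. \<beta> + l + \<tau> * A)"
  proof (intro integral_le int integrable_const_ivl)
    show "Y \<tau> x \<le> \<beta> + l + \<tau> * A" if "x \<in> {\<beta> - l..\<beta> + l}" for x using Y_bounds[OF \<tau>(1), of x] that by simp
  qed
  moreover have "integral {\<alpha> - l..\<alpha> + l} (\<lambda>x. \<alpha> - l - \<tau> * A) \<le> integral {\<alpha> - l..\<alpha> + l} (Y \<tau>)"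
  proof (intro integral_le int integrable_const_ivl)
    show "\<alpha> - l - \<tau> * A \<le> Y \<tau> x" if "x \<in> {\<alpha> - l..\<alpha> + l}" for x using Y_bounds[OF \<tau>(1), of x] that by simp
  qed
  ultimately have "I \<le> 2 * l * (\<beta> - \<alpha> + 2 * l + 2 * (\<tau> * A))"
    using l I by (simp add: algebra_simps)
  then have "l * (\<beta> - \<alpha>) + I \<le> l * (3 * (\<beta> - \<alpha>) + 4 * l + 4 * (\<tau> * A))"
    by (simp add: algebra_simps)
  then have le: "(l * (\<beta> - \<alpha>) + I) / (\<delta> * \<tau>) \<le> l * (3 * (\<beta> - \<alpha>) + 4 * l + 4 * (\<tau> * A)) / (\<delta> * \<tau>)"
    using \<tau> \<delta>_pos by (intro divide_right_mono) auto
  have si: "set_integrable lborel {\<alpha>..\<beta>} (\<lambda>x. \<bar>v t x - v \<tau> x\<bar> powr p)"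
    using \<tau> by (intro set_integrable_bounded_Icc[of _ _ _ "(2 * M) powr p"] v_diff_measurable v_diff_bound) auto
  note set_borel_integral_eq_integral[OF si]
  then have "(LINT x:{\<alpha>..\<beta>}|lborel. \<bar>v t x - v \<tau> x\<bar> powr p) \<le> (l * (\<beta> - \<alpha>) + I) / (\<delta> * \<tau>)"
    using v_diff_powr_time[OF \<tau>] rhs unfolding l_def[symmetric]
    by (metis (no_types, lifting) has_integral_le integrable_integral)
  with le show ?thesis by (simp add: l_def)
qed

text \<open>The interval may widen like \<open>1 + t\<close>, so that one constant also serves the
  expanding support of a compactly supported solution.\<close>

lemma v_time_Lip:
  assumes t0: "0 < t0" and \<kappa>: "0 \<le> \<kappa>"
  obtains C where "0 \<le> C"
    "\<And>t \<tau> \<alpha> \<beta>. t0 \<le> \<tau> \<Longrightarrow> \<tau> < t \<Longrightarrow> \<alpha> \<le> \<beta> \<Longrightarrow> \<beta> - \<alpha> \<le> \<kappa> * (1 + t) \<Longrightarrow>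
      (LINT x:{\<alpha>..\<beta>}|lborel. \<bar>v t x - v \<tau> x\<bar> powr p) \<le> C * (t - \<tau>)"
proof
  let ?C1 = "A / \<delta> * (3 * \<kappa> * (1 / t0 + 2) + 8 * A)" and ?C2 = "(2 * M) powr p * \<kappa> * (1 / t0 + 2)"
  have pos: "0 \<le> ?C1" "0 \<le> ?C2" using t0 \<kappa> A_pos \<delta>_pos by auto
  show "0 \<le> ?C1 + ?C2" using pos by linarith
  fix t \<tau> \<alpha> \<beta> :: real
  assume \<tau>: "t0 \<le> \<tau>" "\<tau> < t" and \<alpha>: "\<alpha> \<le> \<beta>" "\<beta> - \<alpha> \<le> \<kappa> * (1 + t)"
  let ?I = "LINT x:{\<alpha>..\<beta>}|lborel. \<bar>v t x - v \<tau> x\<bar> powr p"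
  have \<tau>0: "0 < \<tau>" using \<tau> t0 by simp
  show "?I \<le> (?C1 + ?C2) * (t - \<tau>)"
  \<comment> \<open>For \<open>t \<le> 2 \<tau>\<close> the factor \<open>1 / \<tau>\<close> absorbs
    the growth of the interval. For larger \<open>t\<close>, \<open>t0\<close> is below
    \<open>t - \<tau>\<close> and \<open>t\<close> below \<open>2 (t - \<tau>)\<close>, so the bound
    \<open>M\<close> on \<open>v\<close> is enough.\<close>
  proof (cases "t \<le> 2 * \<tau>")
    case True
    have "1 \<le> \<tau> / t0" using \<tau> t0 by simp
    have "3 * (\<beta> - \<alpha>) + 4 * (A * (t - \<tau>)) + 4 * (\<tau> * A) \<le> 3 * (\<kappa> * (1 + 2 * \<tau>)) + 8 * (\<tau> * A)"
    proof -
      have "\<kappa> * (1 + t) \<le> \<kappa> * (1 + 2 * \<tau>)" using True \<kappa> by (intro mult_left_mono) auto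
      moreover have "A * (t - \<tau>) \<le> A * \<tau>" using True A_pos by (intro mult_left_mono) auto
      ultimately show ?thesis using \<alpha>(2) by (simp add: mult.commute)
    qed
    also have "\<dots> \<le> 3 * (\<kappa> * (\<tau> / t0 + 2 * \<tau>)) + 8 * (\<tau> * A)"
      using \<open>1 \<le> \<tau> / t0\<close> \<kappa> \<tau>0 by (intro add_mono mult_left_mono) auto
    also have "\<dots> = \<tau> * (3 * \<kappa> * (1 / t0 + 2) + 8 * A)" by (simp add: algebra_simps)
    finally have "A * (t - \<tau>) * (3 * (\<beta> - \<alpha>) + 4 * (A * (t - \<tau>)) + 4 * (\<tau> * A)) / (\<delta> * \<tau>)
        \<le> A * (t - \<tau>) * (\<tau> * (3 * \<kappa> * (1 / t0 + 2) + 8 * A)) / (\<delta> * \<tau>)"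
      using A_pos \<tau> \<tau>0 \<delta>_pos by (intro divide_right_mono mult_left_mono) auto
    also have "\<dots> = ?C1 * (t - \<tau>)" using \<tau>0 by simp
    finally have "?I \<le> ?C1 * (t - \<tau>)" using v_time_integral[OF \<tau>0 \<tau>(2) \<alpha>(1)] by linarith
    also have "\<dots> \<le> (?C1 + ?C2) * (t - \<tau>)" using pos \<tau> by (intro mult_right_mono) auto
    finally show ?thesis .
  next
    case False
    have "?I \<le> (LINT x:{\<alpha>..\<beta>}|lborel. (2 * M) powr p)"
      using \<tau>0 \<tau> v_diff_bound[of t _ \<tau>]
      by (intro set_integral_mono set_integrable_bounded_Icc[of _ _ _ "(2 * M) powr p"] v_diff_measurable v_diff_bound) auto
    also have "\<dots> = (2 * M) powr p * (\<beta> - \<alpha>)" using \<alpha> by (simp add: set_lebesgue_integral_def)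
    also have "\<dots> \<le> (2 * M) powr p * (\<kappa> * (1 + t))" using \<alpha> by (intro mult_left_mono) auto
    also have "\<dots> \<le> (2 * M) powr p * (\<kappa> * ((1 / t0 + 2) * (t - \<tau>)))"
    proof (intro mult_left_mono \<kappa>)
      have "1 \<le> (t - \<tau>) / t0" using False \<tau> t0 by simp
      then show "1 + t \<le> (1 / t0 + 2) * (t - \<tau>)" using False by (simp add: algebra_simps)
    qed simp
    also have "\<dots> = ?C2 * (t - \<tau>)" by simp
    also have "\<dots> \<le> (?C1 + ?C2) * (t - \<tau>)" using pos \<tau> by (intro mult_right_mono) auto
    finally show ?thesis .
  qed
qed

lemma Lq_norm_v_diff_commute: "Lq_norm q J (\<lambda>x. v t x - v \<tau> x) = Lq_norm q J (\<lambda>x. v \<tau> x - v t x)"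
  unfolding Lq_norm_def by (simp add: abs_minus_commute)

lemma v_Lip_LqI:
  assumes Lq: "\<And>t. 0 < t \<Longrightarrow> v t \<in> Lq p J"
    and C: "\<And>t0. 0 < t0 \<Longrightarrow> \<exists>C\<ge>0. \<forall>\<tau>\<ge>t0. \<forall>t>\<tau>. (LINT x:J|lborel. \<bar>v t x - v \<tau> x\<bar> powr p) \<le> C * (t - \<tau>)"
  shows "v \<in> Lip_Lq (1 / p) p J"
proof -
  have "\<exists>C. \<forall>t\<ge>t0. \<forall>\<tau>\<ge>t0. Lq_norm p J (\<lambda>x. v t x - v \<tau> x) \<le> C * \<bar>t - \<tau>\<bar> powr (1 / p)" if t0: "0 < t0" for t0
  proof -
    from C[OF t0] obtain C where C: "C \<ge> 0"
      "\<And>t \<tau>. t0 \<le> \<tau> \<Longrightarrow> \<tau> < t \<Longrightarrow> (LINT x:J|lborel. \<bar>v t x - v \<tau> x\<bar> powr p) \<le> C * (t - \<tau>)" by blast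
    have less: "Lq_norm p J (\<lambda>x. v t x - v \<tau> x) \<le> C powr (1 / p) * \<bar>t - \<tau>\<bar> powr (1 / p)" if "t0 \<le> \<tau>" "\<tau> < t" for t \<tau>
    proof -
      have "0 \<le> (LINT x:J|lborel. \<bar>v t x - v \<tau> x\<bar> powr p)"
        unfolding set_lebesgue_integral_def by (intro Bochner_Integration.integral_nonneg) auto
      then have "Lq_norm p J (\<lambda>x. v t x - v \<tau> x) \<le> (C * (t - \<tau>)) powr (1 / p)"
        unfolding Lq_norm_def using C(2)[OF that] p_pos by (intro powr_mono2) auto
      also have "\<dots> = C powr (1 / p) * \<bar>t - \<tau>\<bar> powr (1 / p)" using C(1) that by (simp add: powr_mult)
      finally show ?thesis .
    qed
    have "Lq_norm p J (\<lambda>x. v t x - v \<tau> x) \<le> C powr (1 / p) * \<bar>t - \<tau>\<bar> powr (1 / p)" if "t0 \<le> t" "t0 \<le> \<tau>" for t \<tau>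
    proof -
      consider "\<tau> < t" | "t < \<tau>" | "t = \<tau>" by linarith
      then show ?thesis
      proof cases
        case 1 then show ?thesis using less that by blast
      next
        case 2 then show ?thesis using less[of t \<tau>] that Lq_norm_v_diff_commute[of p J t \<tau>] by (simp add: abs_minus_commute)
      next
        case 3 then show ?thesis using p_pos by (simp add: Lq_norm_def set_lebesgue_integral_def)
      qed
    qed
    then show ?thesis by blast
  qed
  with Lq show ?thesis unfolding Lip_Lq_def by blast
qed

lemma v_powr_measurable: "0 < t \<Longrightarrow> (\<lambda>x. \<bar>v t x\<bar> powr p) \<in> borel_measurable borel"
  using v_measurable_snd[of t] by measurable

lemma v_powr_integrable: "0 < t \<Longrightarrow> set_integrable lborel {\<alpha>..\<beta>} (\<lambda>x. \<bar>v t x\<bar> powr p)"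
  using abs_v_le[of t] p_pos
  by (intro set_integrable_bounded_Icc[where B = "M powr p"] v_powr_measurable) (auto intro!: powr_mono2)

lemma v_Lip_Lq_loc: "v \<in> Lip_Lq_loc (1 / p) p"
proof -
  have "v \<in> Lip_Lq (1 / p) p {\<alpha>..\<beta>}" for \<alpha> \<beta>
  proof (rule v_Lip_LqI)
    fix t0 :: real assume t0: "0 < t0"
    show "\<exists>C\<ge>0. \<forall>\<tau>\<ge>t0. \<forall>t>\<tau>. (LINT x:{\<alpha>..\<beta>}|lborel. \<bar>v t x - v \<tau> x\<bar> powr p) \<le> C * (t - \<tau>)"
    proof (cases "\<alpha> \<le> \<beta>")
      case True
      obtain C where C: "0 \<le> C" "\<And>t \<tau> a b. t0 \<le> \<tau> \<Longrightarrow> \<tau> < t \<Longrightarrow> a \<le> b \<Longrightarrow> b - a \<le> (\<beta> - \<alpha>) * (1 + t) \<Longrightarrow>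
          (LINT x:{a..b}|lborel. \<bar>v t x - v \<tau> x\<bar> powr p) \<le> C * (t - \<tau>)"
        using v_time_Lip[OF t0, of "\<beta> - \<alpha>"] True by auto
      have "\<beta> - \<alpha> \<le> (\<beta> - \<alpha>) * (1 + t)" if "0 < t" for t
        using True that mult_left_mono[of 1 "1 + t" "\<beta> - \<alpha>"] by simp
      then show ?thesis using C(1) True t0 by (intro exI[of _ C] conjI allI impI C(2)) auto
    next
      case False
      then show ?thesis by (intro exI[of _ 0]) (simp add: set_lebesgue_integral_def)
    qed
  next
    show "v t \<in> Lq p {\<alpha>..\<beta>}" if "0 < t" for t
      using v_measurable_snd[OF that] v_powr_integrable[OF that]
      unfolding Lq_def set_borel_measurable_def by simp
  qed
  then show ?thesis by (simp add: Lip_Lq_loc_def)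
qed

text \<open>Both \<open>v \<tau>\<close> and \<open>v t\<close> vanish outside
  \<open>[- R' t, R' t]\<close>, whose length is at most \<open>2 (R + 1 + A) (1 + t)\<close>; this
  supplies the constant \<open>\<kappa>\<close> of \<open>v_time_Lip\<close>.\<close>

lemma v_Lip_Lq_UNIV:
  assumes R: "0 \<le> R" "\<And>t x. 0 < t \<Longrightarrow> R + t * A < \<bar>x\<bar> \<Longrightarrow> v t x = 0"
  shows "v \<in> Lip_Lq (1 / p) p UNIV"
proof (rule v_Lip_LqI)
  define R' where "R' t = R + t * A + 1" for t
  have restrict: "(LINT x:UNIV|lborel. \<bar>v t x - v \<tau> x\<bar> powr p)
      = (LINT x:{- R' t..R' t}|lborel. \<bar>v t x - v \<tau> x\<bar> powr p)" if "0 < \<tau>" "\<tau> < t" for t \<tau>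
  proof -
    have "v \<tau> x = 0 \<and> v t x = 0" if "x \<notin> {- R' t..R' t}" for x
    proof -
      have "\<tau> * A \<le> t * A" using \<open>\<tau> < t\<close> A_pos by (intro mult_right_mono) auto
      then show ?thesis using that \<open>0 < \<tau>\<close> \<open>\<tau> < t\<close> R(2)[of t x] R(2)[of \<tau> x] by (auto simp: R'_def)
    qed
    then have "indicator UNIV x *\<^sub>R (\<bar>v t x - v \<tau> x\<bar> powr p)
        = indicator {- R' t..R' t} x *\<^sub>R (\<bar>v t x - v \<tau> x\<bar> powr p)" for x
      by (cases "x \<in> {- R' t..R' t}") simp_all
    then show ?thesis unfolding set_lebesgue_integral_def by (simp only:)
  qed
  fix t0 :: real assume t0: "0 < t0"
  show "\<exists>C\<ge>0. \<forall>\<tau>\<ge>t0. \<forall>t>\<tau>. (LINT x:UNIV|lborel. \<bar>v t x - v \<tau> x\<bar> powr p) \<le> C * (t - \<tau>)"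
  proof -
    obtain C where C: "0 \<le> C" "\<And>t \<tau> a b. t0 \<le> \<tau> \<Longrightarrow> \<tau> < t \<Longrightarrow> a \<le> b \<Longrightarrow> b - a \<le> (2 * (R + 1 + A)) * (1 + t) \<Longrightarrow>
        (LINT x:{a..b}|lborel. \<bar>v t x - v \<tau> x\<bar> powr p) \<le> C * (t - \<tau>)"
      using v_time_Lip[OF t0, of "2 * (R + 1 + A)"] R(1) A_pos by auto
    have "(LINT x:UNIV|lborel. \<bar>v t x - v \<tau> x\<bar> powr p) \<le> C * (t - \<tau>)" if "t0 \<le> \<tau>" "\<tau> < t" for \<tau> t
    proof -
      have "0 \<le> t * A" "0 \<le> R * t" using that t0 A_pos R(1) by auto
      then have "(LINT x:{- R' t..R' t}|lborel. \<bar>v t x - v \<tau> x\<bar> powr p) \<le> C * (t - \<tau>)"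
        using R(1) A_pos that t0 by (intro C(2)) (auto simp: R'_def algebra_simps)
      with restrict[of \<tau> t] that t0 show ?thesis by simp
    qed
    with C(1) show ?thesis by blast
  qed
next
  fix t :: real assume t: "0 < t"
  let ?R = "R + t * A"
  have "(\<lambda>x. indicator UNIV x *\<^sub>R (\<bar>v t x\<bar> powr p)) = (\<lambda>x. indicator {- ?R..?R} x *\<^sub>R (\<bar>v t x\<bar> powr p))"
  proof
    fix x
    show "indicator UNIV x *\<^sub>R (\<bar>v t x\<bar> powr p) = indicator {- ?R..?R} x *\<^sub>R (\<bar>v t x\<bar> powr p)"
    proof (cases "x \<in> {- ?R..?R}")
      case False
      then have "?R < \<bar>x\<bar>" by auto
      then show ?thesis using R(2)[OF t] by simp
    qed simp
  qed
  then have "set_integrable lborel UNIV (\<lambda>x. \<bar>v t x\<bar> powr p)"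
    using v_powr_integrable[OF t, of "- ?R" ?R] unfolding set_integrable_def by simp
  then show "v t \<in> Lq p UNIV"
    using v_measurable_snd[OF t] unfolding Lq_def set_borel_measurable_def by simp
qed

end

section \<open>Mollifiers and a weak differential equation\<close>

text \<open>Adding \<open>C\<close> turns both functions into densities of finite measures on
  \<open>[lo, hi]\<close>. The measures agree on half-lines, hence everywhere, so the densities
  agree almost everywhere.\<close>

lemma AE_eq_if_interval_integrals_eq:
  fixes g h :: "real \<Rightarrow> real"
  assumes [measurable]: "g \<in> borel_measurable borel" "h \<in> borel_measurable borel"
    and bound: "\<And>x. x \<in> {lo..hi} \<Longrightarrow> \<bar>g x\<bar> \<le> C" "\<And>x. x \<in> {lo..hi} \<Longrightarrow> \<bar>h x\<bar> \<le> C"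
    and eq: "\<And>y. lo \<le> y \<Longrightarrow> y \<le> hi \<Longrightarrow> (LINT x:{y..hi}|lborel. g x) = (LINT x:{y..hi}|lborel. h x)"
  shows "AE x in lborel. x \<in> {lo..hi} \<longrightarrow> g x = h x"
proof -
  define F where "F k x = indicator {lo..hi} x * (k x + C)" for k :: "real \<Rightarrow> real" and x
  have [measurable]: "F g \<in> borel_measurable borel" "F h \<in> borel_measurable borel"
    unfolding F_def by measurable
  have em: "emeasure (density lborel (\<lambda>x. ennreal (F k x))) {x<..}
      = ennreal ((LINT z:{max lo x..hi}|lborel. k z) + (LINT z:{max lo x..hi}|lborel. C))"
    if [measurable]: "k \<in> borel_measurable borel" and k: "\<And>x. x \<in> {lo..hi} \<Longrightarrow> \<bar>k x\<bar> \<le> C" for k x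
  proof -
    let ?I = "{max lo x..hi}"
    have [measurable]: "F k \<in> borel_measurable borel" unfolding F_def by measurable
    have int: "set_integrable lborel ?I k" "set_integrable lborel ?I (\<lambda>x. C)"
      unfolding set_integrable_def
      by (rule integrableI_bounded_set_indicator[where B = C], use k in \<open>auto simp: emeasure_lborel_Icc_eq\<close>)
    have "emeasure (density lborel (\<lambda>x. ennreal (F k x))) {x<..}
        = (\<integral>\<^sup>+ z. ennreal (F k z) * indicator {x<..} z \<partial>lborel)"
      by (rule emeasure_density) measurable
    also have "\<dots> = (\<integral>\<^sup>+ z. ennreal (indicator ?I z *\<^sub>R (k z + C)) \<partial>lborel)"
    proof (rule nn_integral_cong_AE)
      show "AE z in lborel. ennreal (F k z) * indicator {x<..} z = ennreal (indicator ?I z *\<^sub>R (k z + C))"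
        using AE_lborel_singleton[of x]
        by eventually_elim (auto simp: F_def indicator_def)
    qed
    also have "\<dots> = ennreal (LINT z|lborel. indicator ?I z *\<^sub>R (k z + C))"
    proof (rule nn_integral_eq_integral)
      show "integrable lborel (\<lambda>z. indicator ?I z *\<^sub>R (k z + C))"
        using set_integral_add(1)[OF int] unfolding set_integrable_def .
      show "AE z in lborel. 0 \<le> indicator ?I z *\<^sub>R (k z + C)"
      proof (rule AE_I2)
        show "0 \<le> indicator ?I z *\<^sub>R (k z + C)" for z
          using k[of z] by (auto simp: indicator_def)
      qed
    qed
    also have "(LINT z|lborel. indicator ?I z *\<^sub>R (k z + C)) = (LINT z:?I|lborel. k z) + (LINT z:?I|lborel. C)"
      using set_integral_add(2)[OF int] by (simp add: set_lebesgue_integral_def)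
    finally show ?thesis .
  qed
  have "density lborel (\<lambda>x. ennreal (F g x)) = density lborel (\<lambda>x. ennreal (F h x))"
  proof (rule measure_eqI_lessThan)
    fix x :: real
    show "emeasure (density lborel (\<lambda>x. ennreal (F g x))) {x<..} < \<infinity>"
      by (subst em[OF assms(1) bound(1)]) auto
    have "(LINT z:{max lo x..hi}|lborel. g z) = (LINT z:{max lo x..hi}|lborel. h z)"
      using eq[of "max lo x"] by (cases "max lo x \<le> hi") (auto simp: set_lebesgue_integral_def)
    then show "emeasure (density lborel (\<lambda>x. ennreal (F g x))) {x<..}
        = emeasure (density lborel (\<lambda>x. ennreal (F h x))) {x<..}"
      by (simp only: em[OF assms(1) bound(1)] em[OF assms(2) bound(2)])
  qed simp_all
  then have "AE x in lborel. ennreal (F g x) = ennreal (F h x)"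
    by (intro sigma_finite_measure.density_unique[OF sigma_finite_lborel]) auto
  then show ?thesis
  proof eventually_elim
    case (elim x)
    show ?case
    proof
      assume x: "x \<in> {lo..hi}"
      then have "0 \<le> g x + C" "0 \<le> h x + C" using bound[of x] by auto
      with elim x show "g x = h x" by (simp add: F_def)
    qed
  qed
qed

lemma integrable_mult_bounded:
  fixes g k :: "'a \<Rightarrow> real"
  assumes "integrable N k" "g \<in> borel_measurable N" "\<And>x. \<bar>g x\<bar> \<le> C"
  shows "integrable N (\<lambda>x. g x * k x)"
proof (rule Bochner_Integration.integrable_bound)
  show "integrable N (\<lambda>x. C * k x)" using assms(1) by simp
  show "(\<lambda>x. g x * k x) \<in> borel_measurable N"
    using assms(2) borel_measurable_integrable[OF assms(1)] by measurable
  have "\<bar>g x\<bar> \<le> \<bar>C\<bar>" for x using assms(3)[of x] by linarith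
  then show "AE x in N. norm (g x * k x) \<le> norm (C * k x)"
    by (intro AE_I2) (auto simp: abs_mult intro!: mult_right_mono)
qed

lemma integral_mult_bounded:
  fixes g k :: "'a \<Rightarrow> real"
  assumes "integrable N k" "g \<in> borel_measurable N" "\<And>x. \<bar>g x\<bar> \<le> C" "\<And>x. 0 \<le> k x"
  shows "\<bar>LINT x|N. g x * k x\<bar> \<le> C * (LINT x|N. k x)"
proof -
  have "\<bar>LINT x|N. g x * k x\<bar> \<le> (LINT x|N. \<bar>g x * k x\<bar>)" by (rule integral_abs_bound)
  also have "\<dots> \<le> (LINT x|N. C * k x)"
    using assms by (intro integral_mono integrable_abs integrable_mult_bounded) (auto simp: abs_mult intro!: mult_right_mono)
  finally show ?thesis by simp
qed

section \<open>Cut-off functions of class \<open>C^1\<close> made from powers of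
  \<open>max 0 x\<close>\<close>

lemma DERIV_max_0_power:
  assumes "0 < n"
  shows "((\<lambda>x::real. max 0 x ^ Suc n) has_real_derivative real (Suc n) * max 0 x ^ n) (at x)"
proof -
  consider "x < 0" | "0 < x" | "x = 0" by linarith
  then show ?thesis
  proof cases
    case 1
    have "((\<lambda>x::real. 0) has_real_derivative 0) (at x)" by simp
    then have "((\<lambda>x::real. max 0 x ^ Suc n) has_real_derivative 0) (at x)"
      by (rule has_field_derivative_transform_within_open[of _ _ _ "{..<0}"]) (use 1 in \<open>auto simp: max_def\<close>)
    moreover have "real (Suc n) * max 0 x ^ n = 0" using 1 assms by (simp add: max_def)
    ultimately show ?thesis by (simp only:)
  next
    case 2
    have "((\<lambda>x::real. x ^ Suc n) has_real_derivative real (Suc n) * x ^ n) (at x)"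
      by (rule derivative_eq_intros refl)+ simp
    then have "((\<lambda>x::real. max 0 x ^ Suc n) has_real_derivative real (Suc n) * x ^ n) (at x)"
      by (rule has_field_derivative_transform_within_open[of _ _ _ "{0<..}"]) (use 2 in \<open>auto simp: max_def\<close>)
    then show ?thesis using 2 by (simp add: max_def)
  next
    case 3
    have "((\<lambda>h::real. max 0 h ^ n) \<longlongrightarrow> max 0 0 ^ n) (at 0)"
      by (intro tendsto_intros)
    moreover have "max 0 0 ^ n = (0::real)" using assms by simp
    ultimately have lim: "((\<lambda>h::real. max 0 h ^ n) \<longlongrightarrow> 0) (at 0)" by (simp only:)
    have "((\<lambda>h::real. (max 0 (0 + h) ^ Suc n - max 0 0 ^ Suc n) / h) \<longlongrightarrow> 0) (at 0)"
    proof (rule Lim_null_comparison[OF _ lim])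
      show "\<forall>\<^sub>F h in at 0. norm ((max 0 (0 + h) ^ Suc n - max 0 0 ^ Suc n) / h) \<le> max 0 (h::real) ^ n"
        by (rule eventually_at_filter[THEN iffD2], rule always_eventually) (auto simp: max_def abs_mult)
    qed
    moreover have "real (Suc n) * max 0 x ^ n = 0" using 3 assms by simp
    ultimately show ?thesis unfolding DERIV_def 3 by (simp only:)
  qed
qed

lemma DERIV_max_0_2: "((\<lambda>x::real. max 0 x ^ 2) has_real_derivative 2 * max 0 x) (at x)"
  using DERIV_max_0_power[of 1 x] by (simp add: numeral_2_eq_2)

lemma DERIV_max_0_3: "((\<lambda>x::real. max 0 x ^ 3) has_real_derivative 3 * max 0 x ^ 2) (at x)"
  using DERIV_max_0_power[of 2 x] by (simp add: numeral_3_eq_3 numeral_2_eq_2)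

lemmas DERIV_max_0_intros [derivative_intros] = DERIV_max_0_2[THEN DERIV_chain2] DERIV_max_0_3[THEN DERIV_chain2]

text \<open>Second differences of powers of \<open>max 0 x\<close>, so that each function is an antiderivative of the
  one before.\<close>

definition tent :: "real \<Rightarrow> real \<Rightarrow> real" where
  "tent \<eta> x = (max 0 (x + \<eta>) - 2 * max 0 x + max 0 (x - \<eta>)) / \<eta>\<^sup>2"
definition step :: "real \<Rightarrow> real \<Rightarrow> real" where
  "step \<eta> x = (max 0 (x + \<eta>) ^ 2 - 2 * max 0 x ^ 2 + max 0 (x - \<eta>) ^ 2) / (2 * \<eta>\<^sup>2)"
definition ramp :: "real \<Rightarrow> real \<Rightarrow> real" where
  "ramp \<eta> x = (max 0 (x + \<eta>) ^ 3 - 2 * max 0 x ^ 3 + max 0 (x - \<eta>) ^ 3) / (6 * \<eta>\<^sup>2)"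

lemma DERIV_step: "0 < \<eta> \<Longrightarrow> (step \<eta> has_real_derivative tent \<eta> x) (at x)"
  unfolding step_def tent_def
  by (rule derivative_eq_intros refl | simp)+ (simp add: field_simps)

lemma DERIV_ramp: "0 < \<eta> \<Longrightarrow> (ramp \<eta> has_real_derivative step \<eta> x) (at x)"
  unfolding ramp_def step_def
  by (rule derivative_eq_intros refl | simp)+ (simp add: field_simps)

lemma DERIV_step_shift: "0 < \<eta> \<Longrightarrow> ((\<lambda>x. step \<eta> (x - z)) has_real_derivative tent \<eta> (x - z)) (at x)"
  using DERIV_chain2[OF DERIV_step DERIV_diff[OF DERIV_ident DERIV_const], of \<eta> z x] by simp

lemma DERIV_ramp_shift: "0 < \<eta> \<Longrightarrow> ((\<lambda>x. ramp \<eta> (x - z)) has_real_derivative step \<eta> (x - z)) (at x)"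
  using DERIV_chain2[OF DERIV_ramp DERIV_diff[OF DERIV_ident DERIV_const], of \<eta> z x] by simp

lemma tent_cont: "continuous_on S (tent \<eta>)"
  unfolding tent_def by (cases "\<eta> = 0") (auto intro!: continuous_intros)

lemma step_cont: "continuous_on S (step \<eta>)"
  unfolding step_def by (cases "\<eta> = 0") (auto intro!: continuous_intros)

lemma tent_measurable [measurable]: "tent \<eta> \<in> borel_measurable borel"
  and step_measurable [measurable]: "step \<eta> \<in> borel_measurable borel"
  using tent_cont step_cont by (auto intro: borel_measurable_continuous_onI)

context
  fixes \<eta> :: real assumes \<eta>: "0 < \<eta>"
begin

lemma tent_nonneg: "0 \<le> tent \<eta> x"
  unfolding tent_def using \<eta> by (intro divide_nonneg_pos) (auto simp: max_def)

lemma tent_outside: "\<eta> \<le> \<bar>x\<bar> \<Longrightarrow> tent \<eta> x = 0"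
  unfolding tent_def using \<eta> by (auto simp: max_def)

lemma step_left: "x \<le> - \<eta> \<Longrightarrow> step \<eta> x = 0"
  unfolding step_def using \<eta> by (simp add: max_def)

lemma step_right: "\<eta> \<le> x \<Longrightarrow> step \<eta> x = 1"
  unfolding step_def using \<eta> by (simp add: max_def power2_eq_square field_simps)

lemma step_mono: "x \<le> y \<Longrightarrow> step \<eta> x \<le> step \<eta> y"
  by (rule DERIV_nonneg_imp_nondecreasing[of x y "step \<eta>"])
     (use DERIV_step[OF \<eta>] tent_nonneg in blast)+

lemma step_nonneg: "0 \<le> step \<eta> x"
  using step_mono[of "- \<eta>" x] step_left[of x] step_left[of "- \<eta>"] by (cases "x \<le> - \<eta>") auto

lemma step_le_1: "step \<eta> x \<le> 1"
  using step_mono[of x \<eta>] step_right[of x] step_right[of \<eta>] by (cases "\<eta> \<le> x") auto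

lemma ramp_left: "x \<le> - \<eta> \<Longrightarrow> ramp \<eta> x = 0"
  unfolding ramp_def using \<eta> by (simp add: max_def)

lemma ramp_right: "\<eta> \<le> x \<Longrightarrow> ramp \<eta> x = x"
  unfolding ramp_def using \<eta> by (simp add: max_def power3_eq_cube power2_eq_square field_simps)

lemma tent_integral:
  "integrable lborel (\<lambda>x. tent \<eta> (x - z))" "(LINT x|lborel. tent \<eta> (x - z)) = 1"
proof -
  let ?F = "\<lambda>x. indicator {z - \<eta>..z + \<eta>} x *\<^sub>R tent \<eta> (x - z)"
  have "has_bochner_integral lborel (\<lambda>x. tent \<eta> (x - z) * indicator {z - \<eta>..z + \<eta>} x) (step \<eta> (z + \<eta> - z) - step \<eta> (z - \<eta> - z))"
    using \<eta> by (intro has_bochner_integral_FTC_Icc_nonneg[where F = "\<lambda>x. step \<eta> (x - z)"])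
      (auto intro!: DERIV_step_shift tent_nonneg continuous_at_imp_continuous_on
         continuous_on_compose2[OF tent_cont[of UNIV]] continuous_intros)
  moreover have "tent \<eta> (x - z) * indicator {z - \<eta>..z + \<eta>} x = tent \<eta> (x - z)" for x
    using tent_outside[of "x - z"] by (cases "x \<in> {z - \<eta>..z + \<eta>}") auto
  ultimately have "has_bochner_integral lborel (\<lambda>x. tent \<eta> (x - z)) 1"
    by (simp add: step_left step_right)
  then show "integrable lborel (\<lambda>x. tent \<eta> (x - z))" "(LINT x|lborel. tent \<eta> (x - z)) = 1"
    by (auto simp: has_bochner_integral_iff)
qed

end

text \<open>A \<open>C^1\<close> indicator of the interval from \<open>y\<close> to
  \<open>z\<close>, signed by the order of its ends, so that its integral is always
  \<open>z - y\<close> and windows add up like oriented integrals.\<close>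

definition bump :: "real \<Rightarrow> real \<Rightarrow> real \<Rightarrow> real \<Rightarrow> real" where
  "bump \<eta> y z x = step \<eta> (x - y) - step \<eta> (x - z)"

lemma bump_measurable [measurable]: "bump \<eta> y z \<in> borel_measurable borel"
  unfolding bump_def by measurable

lemma bump_swap: "bump \<eta> z y x = - bump \<eta> y z x"
  by (simp add: bump_def)

context
  fixes \<eta> :: real assumes \<eta>: "0 < \<eta>"
begin

lemma bump_nonneg: "y \<le> z \<Longrightarrow> 0 \<le> bump \<eta> y z x"
  unfolding bump_def using step_mono[OF \<eta>, of "x - z" "x - y"] by simp

lemma bump_le_1: "bump \<eta> y z x \<le> 1"
  unfolding bump_def using step_le_1[OF \<eta>, of "x - y"] step_nonneg[OF \<eta>, of "x - z"] by simp

lemma bump_outside: "x \<notin> {min y z - \<eta>..max y z + \<eta>} \<Longrightarrow> bump \<eta> y z x = 0"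
  unfolding bump_def
  using step_left[OF \<eta>, of "x - y"] step_left[OF \<eta>, of "x - z"]
    step_right[OF \<eta>, of "x - y"] step_right[OF \<eta>, of "x - z"] by (auto simp: not_le)

lemma bump_integral_le:
  assumes "y \<le> z"
  shows "integrable lborel (bump \<eta> y z)" "(LINT x|lborel. bump \<eta> y z x) = z - y"
proof -
  let ?I = "{y - \<eta>..z + \<eta>}"
  have "has_bochner_integral lborel (\<lambda>x. bump \<eta> y z x * indicator ?I x)
      ((ramp \<eta> (z + \<eta> - y) - ramp \<eta> (z + \<eta> - z)) - (ramp \<eta> (y - \<eta> - y) - ramp \<eta> (y - \<eta> - z)))"
    using \<eta> assms unfolding bump_def
    by (intro has_bochner_integral_FTC_Icc_nonneg[where F = "\<lambda>x. ramp \<eta> (x - y) - ramp \<eta> (x - z)"])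
      (auto intro!: DERIV_diff DERIV_ramp_shift step_mono continuous_at_imp_continuous_on continuous_on_compose2[OF step_cont[of UNIV]] continuous_intros)
  moreover have "bump \<eta> y z x * indicator ?I x = bump \<eta> y z x" for x
    using bump_outside[of x y z] assms by (cases "x \<in> ?I") auto
  ultimately have "has_bochner_integral lborel (bump \<eta> y z) (z - y)"
    using assms \<eta> by (simp add: ramp_left ramp_right)
  then show "integrable lborel (bump \<eta> y z)" "(LINT x|lborel. bump \<eta> y z x) = z - y"
    by (auto simp: has_bochner_integral_iff)
qed

lemma bump_integrable: "integrable lborel (bump \<eta> y z)"
proof (cases "y \<le> z")
  case False
  then have "integrable lborel (\<lambda>x. - bump \<eta> z y x)" using bump_integral_le(1)[of z y] by auto
  then show ?thesis by (simp only: bump_swap[of \<eta> z y] minus_minus)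
qed (rule bump_integral_le)

lemma bump_integral: "(LINT x|lborel. bump \<eta> y z x) = z - y"
proof (cases "y \<le> z")
  case False
  have "(LINT x|lborel. - bump \<eta> z y x) = - (y - z)" using bump_integral_le(2)[of z y] False by simp
  then show ?thesis by (simp only: bump_swap[of \<eta> z y] minus_minus minus_diff_eq)
qed (rule bump_integral_le)

lemma mult_bump_integrable:
  fixes g :: "real \<Rightarrow> real"
  assumes "g \<in> borel_measurable borel" "\<And>x. \<bar>g x\<bar> \<le> C"
  shows "integrable lborel (\<lambda>x. g x * bump \<eta> y z x)"
  by (rule integrable_mult_bounded[where C = C]) (use bump_integrable assms in auto)

lemma mult_bump_bound:
  fixes g :: "real \<Rightarrow> real"
  assumes g: "g \<in> borel_measurable borel" "\<And>x. \<bar>g x\<bar> \<le> C"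
  shows "\<bar>LINT x|lborel. g x * bump \<eta> y z x\<bar> \<le> C * \<bar>z - y\<bar>"
proof -
  have le: "\<bar>LINT x|lborel. g x * bump \<eta> a b x\<bar> \<le> C * (b - a)" if "a \<le> b" for a b
    using integral_mult_bounded[of lborel "bump \<eta> a b" g C] that g bump_integrable
      bump_nonneg[OF that] bump_integral[of a b] by auto
  show ?thesis
  proof (cases "y \<le> z")
    case True then show ?thesis using le[OF True] by simp
  next
    case False
    have "(LINT x|lborel. g x * bump \<eta> y z x) = - (LINT x|lborel. g x * bump \<eta> z y x)"
      by (subst bump_swap) simp
    then show ?thesis using le[of z y] False by simp
  qed
qed

lemma step_minus_indicator: "\<bar>step \<eta> x - indicator {0..} x\<bar> \<le> indicator {- \<eta>..\<eta>} x"
  using step_left[OF \<eta>, of x] step_right[OF \<eta>, of x] step_nonneg[OF \<eta>, of x] step_le_1[OF \<eta>, of x] \<eta>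
  by (auto simp: indicator_def)

end

text \<open>A \<open>C^1\<close> version of \<open>max 0 x\<close>: the slope rises linearly from 0
  to 1 on \<open>[0, \<epsilon>]\<close>, and the function still vanishes for
  \<open>x \<le> 0\<close>.\<close>

definition soft_max0 :: "real \<Rightarrow> real \<Rightarrow> real" where
  "soft_max0 \<epsilon> x = (max 0 x ^ 2 - max 0 (x - \<epsilon>) ^ 2) / (2 * \<epsilon>)"
definition soft_max0' :: "real \<Rightarrow> real \<Rightarrow> real" where
  "soft_max0' \<epsilon> x = (max 0 x - max 0 (x - \<epsilon>)) / \<epsilon>"

lemma DERIV_soft_max0: "0 < \<epsilon> \<Longrightarrow> (soft_max0 \<epsilon> has_real_derivative soft_max0' \<epsilon> x) (at x)"
  unfolding soft_max0_def soft_max0'_def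
  by (rule derivative_eq_intros refl | simp)+ (simp add: field_simps)

lemma soft_max0'_cont: "continuous_on S (soft_max0' \<epsilon>)"
  unfolding soft_max0'_def by (cases "\<epsilon> = 0") (auto intro!: continuous_intros)

lemma soft_max0_measurable [measurable]: "soft_max0 \<epsilon> \<in> borel_measurable borel"
  and soft_max0'_measurable [measurable]: "soft_max0' \<epsilon> \<in> borel_measurable borel"
  unfolding soft_max0_def[abs_def] soft_max0'_def[abs_def] by measurable

lemma soft_max0_bounds:
  assumes "0 < \<epsilon>"
  shows "0 \<le> soft_max0' \<epsilon> x" "soft_max0' \<epsilon> x \<le> 1" "0 \<le> soft_max0 \<epsilon> x" "soft_max0 \<epsilon> x \<le> max 0 x"
proof -
  show "0 \<le> soft_max0' \<epsilon> x" "soft_max0' \<epsilon> x \<le> 1"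
    using assms by (auto simp: soft_max0'_def max_def field_simps)
  have "max 0 (x - \<epsilon>) ^ 2 \<le> max 0 x ^ 2" using assms by (intro power_mono) auto
  then show "0 \<le> soft_max0 \<epsilon> x" using assms by (simp add: soft_max0_def)
  have "max 0 x ^ 2 - max 0 (x - \<epsilon>) ^ 2 \<le> 2 * \<epsilon> * max 0 x"
  proof (cases "x \<le> \<epsilon>")
    case True
    then have "max 0 x * max 0 x \<le> \<epsilon> * max 0 x" using assms by (intro mult_right_mono) auto
    moreover have "0 \<le> \<epsilon> * max 0 x" using assms by simp
    ultimately show ?thesis using True by (simp add: power2_eq_square)
  next
    case False
    then show ?thesis using assms by (simp add: max_def power2_eq_square algebra_simps)
  qed
  then show "soft_max0 \<epsilon> x \<le> max 0 x" using assms by (simp add: soft_max0_def pos_divide_le_eq mult.commute)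
qed

lemma soft_max0_limits:
  assumes \<epsilon>: "\<epsilon> \<longlonglongrightarrow> 0" "\<And>n::nat. 0 < \<epsilon> n"
  shows "(\<lambda>n. soft_max0' (\<epsilon> n) x) \<longlonglongrightarrow> indicator {0<..} x"
    and "(\<lambda>n. soft_max0 (\<epsilon> n) x) \<longlonglongrightarrow> max 0 x"
proof -
  consider "x \<le> 0" | "0 < x" by linarith
  then have "(\<lambda>n. soft_max0' (\<epsilon> n) x) \<longlonglongrightarrow> indicator {0<..} x \<and> (\<lambda>n. soft_max0 (\<epsilon> n) x) \<longlonglongrightarrow> max 0 x"
  proof cases
    case 1
    then have "soft_max0' (\<epsilon> n) x = 0" "soft_max0 (\<epsilon> n) x = 0" for n
      using \<epsilon>(2)[of n] by (auto simp: soft_max0_def soft_max0'_def max_def)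
    then show ?thesis using 1 by simp
  next
    case 2
    have small: "\<forall>\<^sub>F n in sequentially. \<epsilon> n < x" by (rule order_tendstoD(2)[OF \<epsilon>(1) 2])
    have "\<forall>\<^sub>F n in sequentially. soft_max0' (\<epsilon> n) x = 1"
      using small
    proof eventually_elim
      case (elim n)
      then show ?case using \<epsilon>(2)[of n] 2 by (simp add: soft_max0'_def)
    qed
    then have "(\<lambda>n. soft_max0' (\<epsilon> n) x) \<longlonglongrightarrow> 1" by (rule tendsto_eventually)
    moreover have ev: "\<forall>\<^sub>F n in sequentially. soft_max0 (\<epsilon> n) x = x - \<epsilon> n / 2"
      using small
    proof eventually_elim
      case (elim n)
      then show ?case using \<epsilon>(2)[of n] 2 by (simp add: soft_max0_def power2_eq_square field_simps)
    qed
    have "(\<lambda>n. x - \<epsilon> n / 2) \<longlonglongrightarrow> x - 0 / 2" by (intro tendsto_intros \<epsilon>) simp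
    then have "(\<lambda>n. soft_max0 (\<epsilon> n) x) \<longlonglongrightarrow> x"
      using ev by (simp add: tendsto_cong)
    ultimately show ?thesis using 2 by simp
  qed
  then show "(\<lambda>n. soft_max0' (\<epsilon> n) x) \<longlonglongrightarrow> indicator {0<..} x" "(\<lambda>n. soft_max0 (\<epsilon> n) x) \<longlonglongrightarrow> max 0 x"
    by blast+
qed

text \<open>Fubini's theorem on the triangle \<open>0 \<le> s \<le> t \<le> b\<close>.\<close>

lemma integral_primitive:
  fixes h :: "real \<Rightarrow> real"
  assumes [measurable]: "h \<in> borel_measurable borel" and h: "\<And>t. t \<in> {0..b} \<Longrightarrow> \<bar>h t\<bar> \<le> C"
  shows "(LINT t:{0..b}|lborel. LINT s:{0..t}|lborel. h s) = (LINT s:{0..b}|lborel. (b - s) * h s)"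
proof -
  let ?g = "\<lambda>z. indicator {(t, s). 0 \<le> s \<and> s \<le> t \<and> t \<le> b} z *\<^sub>R h (snd z)"
  have "closed {z :: real \<times> real. 0 \<le> snd z \<and> snd z \<le> fst z \<and> fst z \<le> b}"
    by (intro closed_Collect_conj closed_Collect_le continuous_intros)
  then have [measurable]: "{(t::real, s). 0 \<le> s \<and> s \<le> t \<and> t \<le> b} \<in> sets borel"
    by (simp add: case_prod_beta')
  have sub: "{(t::real, s). 0 \<le> s \<and> s \<le> t \<and> t \<le> b} \<subseteq> cbox (0, 0) (b, b)"
    by (auto simp: cbox_Pair_eq)
  have "integrable lborel (\<lambda>z. indicator {(t, s). 0 \<le> s \<and> s \<le> t \<and> t \<le> b} z *\<^sub>R h (snd z))"
  proof (rule integrableI_bounded_set_indicator[where B = C])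
    have "emeasure lborel {(t::real, s). 0 \<le> s \<and> s \<le> t \<and> t \<le> b} \<le> emeasure lborel (cbox (0::real, 0::real) (b, b))"
      by (rule emeasure_mono[OF sub]) simp
    also have "\<dots> < \<infinity>" by (rule emeasure_lborel_cbox_finite)
    finally show "emeasure lborel {(t::real, s). 0 \<le> s \<and> s \<le> t \<and> t \<le> b} < \<infinity>" .
    show "(\<lambda>z::real \<times> real. h (snd z)) \<in> borel_measurable lborel"
      by (simp add: borel_prod[symmetric])
  qed (use h in auto)
  then have int: "integrable (lborel \<Otimes>\<^sub>M lborel) (\<lambda>(t, s). ?g (t, s))"
    by (simp add: lborel_prod case_prod_beta')
  have 1: "(LINT s|lborel. LINT t|lborel. ?g (t, s)) = (LINT t|lborel. LINT s|lborel. ?g (t, s))"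
    using lborel_pair.Fubini_integral[of "\<lambda>t s. ?g (t, s)"] int by simp
  have 2: "(LINT s|lborel. ?g (t, s)) = indicator {0..b} t *\<^sub>R (LINT s:{0..t}|lborel. h s)" for t
    unfolding set_lebesgue_integral_def
    by (cases "t \<in> {0..b}") (auto simp: indicator_def intro!: Bochner_Integration.integral_cong integral_eq_zero_AE AE_I2)
  have 3: "(LINT t|lborel. ?g (t, s)) = indicator {0..b} s *\<^sub>R ((b - s) * h s)" for s
  proof (cases "s \<in> {0..b}")
    case True
    then have "(LINT t|lborel. ?g (t, s)) = (LINT t|lborel. indicator {s..b} t *\<^sub>R h s)"
      by (intro Bochner_Integration.integral_cong) (auto simp: indicator_def)
    then show ?thesis using True by simp
  next
    case False
    then have "(\<lambda>t. ?g (t, s)) = (\<lambda>t. 0)" by (auto simp: indicator_def)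
    then have "(LINT t|lborel. ?g (t, s)) = (LINT t|(lborel :: real measure). (0 :: real))"
      by (simp only:)
    then show ?thesis using False by simp
  qed
  show ?thesis using 1[symmetric] unfolding 2 3 by (simp only: set_lebesgue_integral_def)
qed

text \<open>Testing with the positive part of \<open>b - t\<close> gives the primitive of
  \<open>g\<close> at each \<open>b\<close>. The candidate \<open>H\<close> has the same primitives
  by Fubini, so the two agree almost everywhere. The bound -3 leaves room for a cut-off at negative
  times.\<close>

lemma weak_ode:
  fixes g h :: "real \<Rightarrow> real"
  assumes [measurable]: "g \<in> borel_measurable borel" "h \<in> borel_measurable borel"
    and g: "\<And>t. t \<in> {0..T} \<Longrightarrow> \<bar>g t\<bar> \<le> C" and h: "\<And>t. t \<in> {0..T} \<Longrightarrow> \<bar>h t\<bar> \<le> C"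
    and weak: "\<And>\<psi> \<psi>'. (\<And>t. (\<psi> has_real_derivative \<psi>' t) (at t)) \<Longrightarrow> continuous_on UNIV \<psi>' \<Longrightarrow>
      (\<And>t. t \<notin> {-3..T} \<Longrightarrow> \<psi> t = 0 \<and> \<psi>' t = 0) \<Longrightarrow>
      (LINT t:{0<..}|lborel. \<psi>' t * g t + \<psi> t * h t) + \<psi> 0 * g0 = 0"
  shows "AE t in lborel. t \<in> {0..T} \<longrightarrow> g t = g0 + (LINT s:{0..t}|lborel. h s)"
proof -
  have primitive: "(LINT t:{0..b}|lborel. g t) = b * g0 + (LINT s:{0..b}|lborel. (b - s) * h s)"
    if b: "0 \<le> b" "b \<le> T" for b
  proof -
    define \<epsilon> where "\<epsilon> n = 1 / real (Suc n)" for n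
    have \<epsilon>: "\<epsilon> \<longlonglongrightarrow> 0" "\<And>n. 0 < \<epsilon> n"
      unfolding \<epsilon>_def using LIMSEQ_inverse_real_of_nat by (simp only: inverse_eq_divide) simp
    have "0 \<le> C" using g[of 0] b by auto
    define F where "F n t = - soft_max0' (\<epsilon> n) (b - t) * g t + soft_max0 (\<epsilon> n) (b - t) * h t" for n t
    have eq: "(LINT t:{0<..}|lborel. F n t) + soft_max0 (\<epsilon> n) b * g0 = 0" for n
    proof -
      \<comment> \<open>The factor \<open>step 1 (t + 2)\<close> is 1 for \<open>t \<ge> -1\<close>
        and 0 for \<open>t \<le> -3\<close>; it secures compact support and is invisible to the
        integral over \<open>t > 0\<close>.\<close>
      define \<psi> where "\<psi> t = soft_max0 (\<epsilon> n) (b - t) * step 1 (t + 2)" for t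
      define \<psi>' where "\<psi>' t = - soft_max0' (\<epsilon> n) (b - t) * step 1 (t + 2) + soft_max0 (\<epsilon> n) (b - t) * tent 1 (t + 2)" for t
      have sm: "((\<lambda>t. soft_max0 (\<epsilon> n) (b - t)) has_real_derivative - soft_max0' (\<epsilon> n) (b - t)) (at t)" for t
        using DERIV_chain2[OF DERIV_soft_max0[OF \<epsilon>(2)] DERIV_diff[OF DERIV_const DERIV_ident], of n b t] by simp
      have st: "((\<lambda>t. step 1 (t + 2)) has_real_derivative tent 1 (t + 2)) (at t)" for t
        using DERIV_step_shift[of 1 "-2" t] by simp
      have \<psi>: "(\<psi> has_real_derivative \<psi>' t) (at t)" for t
        unfolding \<psi>_def \<psi>'_def by (rule DERIV_cong[OF DERIV_mult[OF sm st]]) simp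
      have "continuous_on UNIV (\<lambda>t. soft_max0 (\<epsilon> n) (b - t))"
        using sm by (meson DERIV_isCont continuous_at_imp_continuous_on)
      then have "continuous_on UNIV \<psi>'" unfolding \<psi>'_def
        by (intro continuous_intros continuous_on_compose2[OF soft_max0'_cont[of UNIV]]
            continuous_on_compose2[OF step_cont[of UNIV]] continuous_on_compose2[OF tent_cont[of UNIV]]) auto
      moreover have "\<psi> t = 0 \<and> \<psi>' t = 0" if "t \<notin> {-3..T}" for t
        using that b \<epsilon>(2)[of n] step_left[of 1 "t + 2"] tent_outside[of 1 "t + 2"]
        by (auto simp: \<psi>_def \<psi>'_def soft_max0_def soft_max0'_def not_le)
      ultimately have "(LINT t:{0<..}|lborel. \<psi>' t * g t + \<psi> t * h t) + \<psi> 0 * g0 = 0"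
        using \<psi> by (intro weak)
      moreover have "(LINT t:{0<..}|lborel. \<psi>' t * g t + \<psi> t * h t) = (LINT t:{0<..}|lborel. F n t)"
        by (intro set_lebesgue_integral_cong)
           (auto simp: \<psi>_def \<psi>'_def F_def step_right tent_outside)
      ultimately show ?thesis by (simp add: \<psi>_def step_right)
    qed
    have lim: "(\<lambda>n. LINT t:{0<..}|lborel. F n t) \<longlonglongrightarrow>
        (LINT t|lborel. indicator {0<..} t *\<^sub>R (- indicator {0<..} (b - t) * g t + max 0 (b - t) * h t))"
      unfolding set_lebesgue_integral_def
    proof (rule integral_dominated_convergence[where w = "\<lambda>t. indicator {0..b} t *\<^sub>R (C + b * C)"])
      show "integrable lborel (\<lambda>t. indicator {0..b} t *\<^sub>R (C + b * C))"
        by (intro integrable_scaleR_left integrable_real_indicator) (auto simp: emeasure_lborel_Icc_eq)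
      show "(\<lambda>t. indicat_real {0<..} t *\<^sub>R F n t) \<in> borel_measurable lborel" for n
        unfolding F_def by measurable
      show "AE t in lborel. (\<lambda>n. indicator {0<..} t *\<^sub>R F n t) \<longlonglongrightarrow>
        indicator {0<..} t *\<^sub>R (- indicator {0<..} (b - t) * g t + max 0 (b - t) * h t)"
        unfolding F_def by (intro AE_I2 tendsto_intros soft_max0_limits \<epsilon>)
      show "AE t in lborel. norm (indicator {0<..} t *\<^sub>R F n t) \<le> indicator {0..b} t *\<^sub>R (C + b * C)" for n
      proof (rule AE_I2)
        fix t :: real
        consider "t \<le> 0" | "b < t" | "0 < t" "t \<le> b" by linarith
        then show "norm (indicator {0<..} t *\<^sub>R F n t) \<le> indicator {0..b} t *\<^sub>R (C + b * C)"
        proof cases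
          case 1 then show ?thesis using \<open>0 \<le> C\<close> b by (simp add: indicator_def)
        next
          case 2 
          then have "F n t = 0" using \<epsilon>(2)[of n] by (simp add: F_def soft_max0_def soft_max0'_def)
          then show ?thesis using \<open>0 \<le> C\<close> b by (simp add: indicator_def)
        next
          case 3
          have "\<bar>soft_max0' (\<epsilon> n) (b - t) * g t\<bar> \<le> 1 * C"
            unfolding abs_mult using 3 b soft_max0_bounds(1,2)[OF \<epsilon>(2)[of n], of "b - t"]
            by (intro mult_mono g) auto
          moreover have "\<bar>soft_max0 (\<epsilon> n) (b - t) * h t\<bar> \<le> b * C"
            unfolding abs_mult using 3 b soft_max0_bounds(3,4)[OF \<epsilon>(2)[of n], of "b - t"]
            by (intro mult_mono h) auto
          ultimately show ?thesis using 3 by (simp add: F_def abs_le_iff)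
        qed
      qed
    qed measurable
    have "(\<lambda>n. LINT t:{0<..}|lborel. F n t) \<longlonglongrightarrow> - (b * g0)"
    proof -
      have "(LINT t:{0<..}|lborel. F n t) = - (soft_max0 (\<epsilon> n) b * g0)" for n using eq[of n] by simp
      then show ?thesis
        using soft_max0_limits(2)[OF \<epsilon>, of b] b by (auto intro!: tendsto_intros)
    qed
    with lim have "(LINT t|lborel. indicator {0<..} t *\<^sub>R (- indicator {0<..} (b - t) * g t + max 0 (b - t) * h t)) = - (b * g0)"
      by (rule LIMSEQ_unique)
    moreover have "(LINT t|lborel. indicator {0<..} t *\<^sub>R (- indicator {0<..} (b - t) * g t + max 0 (b - t) * h t))
        = (LINT t:{0..b}|lborel. (b - t) * h t - g t)"
      unfolding set_lebesgue_integral_def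
    proof (rule integral_cong_AE)
      show "AE t in lborel. indicator {0<..} t *\<^sub>R (- indicator {0<..} (b - t) * g t + max 0 (b - t) * h t)
        = indicat_real {0..b} t *\<^sub>R ((b - t) * h t - g t)"
        using AE_lborel_singleton[of 0] AE_lborel_singleton[of b]
        by eventually_elim (auto simp: indicator_def)
    qed measurable
    moreover have "(LINT t:{0..b}|lborel. (b - t) * h t - g t)
        = (LINT t:{0..b}|lborel. (b - t) * h t) - (LINT t:{0..b}|lborel. g t)"
    proof (rule set_integral_diff)
      show "set_integrable lborel {0..b} g" using b by (intro set_integrable_bounded_Icc[of _ _ _ C] g) auto
      show "set_integrable lborel {0..b} (\<lambda>t. (b - t) * h t)"
      proof (rule set_integrable_bounded_Icc[of _ _ _ "b * C"])
        show "\<bar>(b - t) * h t\<bar> \<le> b * C" if "t \<in> {0..b}" for t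
          unfolding abs_mult using that b by (intro mult_mono h) auto
      qed measurable
    qed
    ultimately show ?thesis by simp
  qed
  define H where "H t = g0 + (LINT s:{0..t}|lborel. h s)" for t
  \<comment> \<open>Continuity of \<open>H\<close> is available on \<open>[0, T]\<close> only; the
    extension by 0 is a Borel function on the line.\<close>
  define H' where "H' t = (if t \<in> {0..T} then H t else 0)" for t
  have int: "set_integrable lborel {0..t} h" if "t \<le> T" for t
    using that by (intro set_integrable_bounded_Icc[of _ _ _ C] h) auto
  have Hc: "continuous_on {0..T} H"
  proof -
    have "(LINT s:{0..t}|lborel. h s) = integral {0..t} h" if "t \<le> T" for t
      using set_borel_integral_eq_integral(2)[OF int[OF that]] .
    moreover have "continuous_on {0..T} (\<lambda>t. g0 + integral {0..t} h)"
      by (intro continuous_intros indefinite_integral_continuous_1 set_borel_integral_eq_integral(1) int) simp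
    ultimately show ?thesis unfolding H_def by (auto intro: continuous_on_eq)
  qed
  have [measurable]: "H' \<in> borel_measurable borel"
    unfolding H'_def by (rule borel_measurable_continuous_on_if[OF _ Hc continuous_on_const]) simp
  obtain D where D: "\<And>t. t \<in> {0..T} \<Longrightarrow> \<bar>H' t\<bar> \<le> D"
  proof -
    have "bounded (H ` {0..T})" by (rule compact_imp_bounded[OF compact_continuous_image[OF Hc]]) simp
    then obtain D where "\<forall>y\<in>H ` {0..T}. norm y \<le> D" unfolding bounded_iff by blast
    then show thesis using that[of D] by (simp add: H'_def)
  qed
  have H0: "(LINT t:{0..b}|lborel. H' t) = b * g0 + (LINT s:{0..b}|lborel. (b - s) * h s)" if b: "0 \<le> b" "b \<le> T" for b
  proof -
    have si: "set_integrable lborel {0..b} H'"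
      using b by (intro set_integrable_bounded_Icc[of _ _ _ D] D) auto
    have c: "set_integrable lborel {0..b} (\<lambda>t. g0)"
      by (rule set_integrable_bounded_Icc[of _ _ _ "\<bar>g0\<bar>"]) auto
    have "(LINT t:{0..b}|lborel. H' t) - (LINT t:{0..b}|lborel. g0) = (LINT t:{0..b}|lborel. H' t - g0)"
      using set_integral_diff(2)[OF si c] by simp
    also have "\<dots> = (LINT t:{0..b}|lborel. LINT s:{0..t}|lborel. h s)"
      using b by (intro set_lebesgue_integral_cong) (auto simp: H'_def H_def)
    also have "\<dots> = (LINT s:{0..b}|lborel. (b - s) * h s)"
      using b h by (intro integral_primitive[of _ _ C]) auto
    finally show ?thesis using b by (simp add: set_lebesgue_integral_def)
  qed
  have "AE t in lborel. t \<in> {0..T} \<longrightarrow> g t = H' t"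
  proof (rule AE_eq_if_interval_integrals_eq[where C = "max C D"])
    show "\<bar>g x\<bar> \<le> max C D" "\<bar>H' x\<bar> \<le> max C D" if "x \<in> {0..T}" for x
      using g[OF that] D[OF that] by auto
    fix y assume y: "0 \<le> y" "y \<le> T"
    have "(LINT t:{0..T}|lborel. k t) = (LINT t:{0..y}|lborel. k t) + (LINT t:{y..T}|lborel. k t)"
      if [measurable]: "k \<in> borel_measurable borel" and k: "\<And>t. t \<in> {0..T} \<Longrightarrow> \<bar>k t\<bar> \<le> K" for k :: "real \<Rightarrow> real" and K
    proof -
      have si: "set_integrable lborel {a..b} k" if "0 \<le> a" "b \<le> T" for a b
        using that k by (intro set_integrable_bounded_Icc[of _ _ _ K]) auto
      show ?thesis
        using si[of 0 T] si[of 0 y] si[of y T] y Henstock_Kurzweil_Integration.integral_combine[of 0 y T k]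
        by (simp add: set_borel_integral_eq_integral)
    qed
    from this[of g C] this[of H' D] primitive[of T] primitive[of y] H0[of T] H0[of y] y g D
    show "(LINT t:{y..T}|lborel. g t) = (LINT t:{y..T}|lborel. H' t)" by simp
  qed simp_all
  then show ?thesis by eventually_elim (simp add: H'_def H_def)
qed

section \<open>Mollified potentials of a weak solution\<close>

text \<open>Bounds and measurability are required at every point, not just almost everywhere. An
  arbitrary entropy solution is brought to this form by truncation in
  \<open>convex_case\<close>.\<close>

locale entropy_flow = convex_flux +
  fixes u0 :: "real \<Rightarrow> real" and u :: "real \<Rightarrow> real \<Rightarrow> real" and c :: real
  assumes u0_measurable [measurable]: "u0 \<in> borel_measurable borel"
    and u0_bound: "\<And>x. \<bar>u0 x\<bar> \<le> M"
    and u_measurable: "(\<lambda>z. u (fst z) (snd z)) \<in> borel_measurable borel"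
    and u_bound: "\<And>t x. \<bar>u t x\<bar> \<le> M"
    and weak: "\<And>\<phi> \<phi>t \<phi>x. test_function \<phi> \<phi>t \<phi>x \<Longrightarrow>
      (LINT z:{0<..} \<times> UNIV|lborel. u (fst z) (snd z) * \<phi>t z + f (u (fst z) (snd z)) * \<phi>x z)
      + (LINT x|lborel. u0 x * \<phi> (0, x)) = 0"
    and c_nonneg: "0 \<le> c"
    and one_sided: "\<And>t. 0 < t \<Longrightarrow> AE (x, y) in lborel. x < y \<longrightarrow>
      u t y - u t x \<le> c * ((y - x) powr (1 / p) / t powr (1 / p))"
begin

lemma u_measurable_comp [measurable]:
  assumes [measurable]: "g \<in> borel_measurable N" "h \<in> borel_measurable N"
  shows "(\<lambda>x. u (g x) (h x)) \<in> borel_measurable N"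
  using measurable_compose[OF _ u_measurable, of "\<lambda>x. (g x, h x)" N] by (simp add: borel_prod[symmetric])

definition Bf :: real where "Bf = \<bar>f 0\<bar> + A * M"

lemma Bf_nonneg: "0 \<le> Bf" using A_pos M_pos by (simp add: Bf_def)

lemma f_bound: "\<bar>w\<bar> \<le> M \<Longrightarrow> \<bar>f w\<bar> \<le> Bf"
proof -
  assume w: "\<bar>w\<bar> \<le> M"
  then have "\<bar>f w - f 0\<bar> \<le> A * \<bar>w\<bar>" using f_lip[of w 0] M_pos by (auto simp: abs_le_iff)
  also have "\<dots> \<le> A * M" using w A_pos by (intro mult_left_mono) auto
  finally show ?thesis by (simp add: Bf_def)
qed

lemma fu_bound: "\<bar>f (u t x)\<bar> \<le> Bf" by (rule f_bound[OF u_bound])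

lemma flux_diff_bound: "\<bar>f (u t x) - q * u t x\<bar> \<le> Bf + \<bar>q\<bar> * M"
proof -
  have "\<bar>q * u t x\<bar> \<le> \<bar>q\<bar> * M" using u_bound[of t x] by (simp add: abs_mult mult_left_mono)
  then show ?thesis using fu_bound[of t x] by linarith
qed

text \<open>Balance of mass in a window whose left end moves with speed \<open>q\<close>, with
  inflow \<open>f u - q u\<close>, while the right end rests. The test function is a time profile
  times the window, and Fubini reduces the weak formulation to \<open>weak_ode\<close>. Speed 0
  yields the slices of \<open>P\<close>, general speed the bound \<open>P_upper\<close>.\<close>

lemma slice_identity:
  assumes \<eta>: "0 < \<eta>" and T: "0 \<le> T"
  shows "AE t in lborel. t \<in> {0..T} \<longrightarrow> (LINT x|lborel. u t x * bump \<eta> (y + q * t) z x) =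
    (LINT x|lborel. u0 x * bump \<eta> y z x) +
    (LINT s:{0..t}|lborel. LINT x|lborel. (f (u s x) - q * u s x) * tent \<eta> (x - (y + q * s)) - f (u s x) * tent \<eta> (x - z))"
proof (rule weak_ode)
  let ?g = "\<lambda>t. LINT x|lborel. u t x * bump \<eta> (y + q * t) z x"
  let ?h = "\<lambda>s. LINT x|lborel. (f (u s x) - q * u s x) * tent \<eta> (x - (y + q * s)) - f (u s x) * tent \<eta> (x - z)"
  let ?C = "M * (\<bar>z\<bar> + \<bar>y\<bar> + \<bar>q\<bar> * T) + (2 * Bf + \<bar>q\<bar> * M)"
  have ii: "integrable lborel (\<lambda>x. (f (u s x) - q * u s x) * tent \<eta> (x - a))" for s a
    by (rule integrable_mult_bounded[OF _ _ flux_diff_bound]) (use tent_integral[OF \<eta>] in auto)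
  have ib: "integrable lborel (\<lambda>x. u s x * bump \<eta> a b x)" for s a b
    by (rule integrable_mult_bounded[where C = M]) (use bump_integrable[OF \<eta>] u_bound in auto)
  have iv: "integrable lborel (\<lambda>x. f (u s x) * tent \<eta> (x - a))" for s a
    by (rule integrable_mult_bounded[OF _ _ fu_bound]) (use tent_integral[OF \<eta>] in auto)
  show "?g \<in> borel_measurable borel"
    unfolding bump_def by measurable
  show "?h \<in> borel_measurable borel"
    by measurable
  show "\<bar>?g t\<bar> \<le> ?C" if t: "t \<in> {0..T}" for t
  proof -
    have "\<bar>?g t\<bar> \<le> M * \<bar>z - (y + q * t)\<bar>"
      by (rule mult_bump_bound[OF \<eta> _ u_bound]) measurable
    also have "\<dots> \<le> M * (\<bar>z\<bar> + \<bar>y\<bar> + \<bar>q\<bar> * T)"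
    proof (rule mult_left_mono)
      have "\<bar>q * t\<bar> \<le> \<bar>q\<bar> * T" using t by (simp add: abs_mult mult_left_mono)
      then show "\<bar>z - (y + q * t)\<bar> \<le> \<bar>z\<bar> + \<bar>y\<bar> + \<bar>q\<bar> * T" by linarith
    qed (use M_pos in simp)
    also have "\<dots> \<le> ?C" using Bf_nonneg M_pos by simp
    finally show ?thesis .
  qed
  show "\<bar>?h s\<bar> \<le> ?C" for s
  proof -
    have eq: "?h s = (LINT x|lborel. (f (u s x) - q * u s x) * tent \<eta> (x - (y + q * s))) - (LINT x|lborel. f (u s x) * tent \<eta> (x - z))"
      by (rule Bochner_Integration.integral_diff[OF ii iv])
    have "\<bar>LINT x|lborel. (f (u s x) - q * u s x) * tent \<eta> (x - (y + q * s))\<bar> \<le> (Bf + \<bar>q\<bar> * M) * 1"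
      using integral_mult_bounded[of lborel "\<lambda>x. tent \<eta> (x - (y + q * s))" "\<lambda>x. f (u s x) - q * u s x" "Bf + \<bar>q\<bar> * M"]
        tent_integral[OF \<eta>] tent_nonneg[OF \<eta>] flux_diff_bound by simp
    moreover have "\<bar>LINT x|lborel. f (u s x) * tent \<eta> (x - z)\<bar> \<le> Bf * 1"
      using integral_mult_bounded[of lborel "\<lambda>x. tent \<eta> (x - z)" "\<lambda>x. f (u s x)" Bf]
        tent_integral[OF \<eta>] tent_nonneg[OF \<eta>] fu_bound by simp
    moreover have "0 \<le> M * (\<bar>z\<bar> + \<bar>y\<bar> + \<bar>q\<bar> * T)" using M_pos T by simp
    moreover have "\<bar>a - b\<bar> \<le> k + (2 * Bf + m)"
      if "\<bar>a\<bar> \<le> (Bf + m) * 1" "\<bar>b\<bar> \<le> Bf * 1" "0 \<le> k" for a b k m :: real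
      using that unfolding abs_le_iff mult_1_right by linarith
    ultimately show ?thesis unfolding eq by blast
  qed
  fix \<psi> \<psi>' :: "real \<Rightarrow> real"
  assume \<psi>: "\<And>t. (\<psi> has_real_derivative \<psi>' t) (at t)" and \<psi>'c: "continuous_on UNIV \<psi>'"
    and supp: "\<And>t. t \<notin> {-3..T} \<Longrightarrow> \<psi> t = 0 \<and> \<psi>' t = 0"
  define \<phi> where "\<phi> w = \<psi> (fst w) * bump \<eta> (y + q * fst w) z (snd w)" for w
  define \<phi>t where "\<phi>t w = \<psi>' (fst w) * bump \<eta> (y + q * fst w) z (snd w) - q * \<psi> (fst w) * tent \<eta> (snd w - (y + q * fst w))" for w
  define \<phi>x where "\<phi>x w = \<psi> (fst w) * (tent \<eta> (snd w - (y + q * fst w)) - tent \<eta> (snd w - z))" for w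
  \<comment> \<open>\<open>T + 3\<close> bounds the absolute time on \<open>[-3, T]\<close>, so
    \<open>R\<close> covers the moving window with its mollified edges.\<close>
  define R where "R = \<bar>y\<bar> + \<bar>z\<bar> + \<bar>q\<bar> * (T + 3) + \<eta>"
  define S where "S = {-3..T} \<times> {-R..R}"
  have S: "compact S" unfolding S_def by (intro compact_Times compact_Icc)
  have out: "\<phi> w = 0 \<and> \<phi>t w = 0 \<and> \<phi>x w = 0" if "w \<notin> S" for w
  proof (cases "fst w \<in> {-3..T}")
    case False
    then show ?thesis using supp by (simp add: \<phi>_def \<phi>t_def \<phi>x_def)
  next
    case True
    then have far: "R < \<bar>snd w\<bar>" using that by (cases w) (auto simp: S_def)
    have "\<bar>q * fst w\<bar> \<le> \<bar>q\<bar> * (T + 3)" using True T by (auto simp: abs_mult intro!: mult_left_mono)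
    then have "\<eta> \<le> \<bar>snd w - (y + q * fst w)\<bar>" "\<eta> \<le> \<bar>snd w - z\<bar>"
      "snd w \<notin> {min (y + q * fst w) z - \<eta>..max (y + q * fst w) z + \<eta>}"
      using far \<eta> by (auto simp: R_def abs_le_iff not_le)
    then show ?thesis
      using tent_outside[OF \<eta>] bump_outside[OF \<eta>] by (simp add: \<phi>_def \<phi>t_def \<phi>x_def)
  qed
  have \<psi>c: "continuous_on UNIV \<psi>" using \<psi> by (meson DERIV_isCont continuous_at_imp_continuous_on)
  have \<phi>tc: "continuous_on U \<phi>t" for U unfolding \<phi>t_def bump_def
    by (intro continuous_intros continuous_on_compose2[OF \<psi>'c] continuous_on_compose2[OF \<psi>c]
       continuous_on_compose2[OF step_cont[of UNIV]] continuous_on_compose2[OF tent_cont[of UNIV]]) auto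
  have \<phi>xc: "continuous_on U \<phi>x" for U unfolding \<phi>x_def
    by (intro continuous_intros continuous_on_compose2[OF \<psi>c]
       continuous_on_compose2[OF step_cont[of UNIV]] continuous_on_compose2[OF tent_cont[of UNIV]]) auto
  have der: "(\<phi> has_derivative (\<lambda>(h, k). \<phi>t w * h + \<phi>x w * k)) (at w)" for w
  proof -
    have a: "((\<lambda>w. \<psi> (fst w)) has_derivative (\<lambda>hk. fst hk * \<psi>' (fst w))) (at w)"
      by (rule DERIV_compose_FDERIV[OF \<psi> has_derivative_fst[OF has_derivative_ident]])
    have b: "((\<lambda>w. step \<eta> (snd w - (y + q * fst w))) has_derivative (\<lambda>hk. (snd hk - q * fst hk) * tent \<eta> (snd w - (y + q * fst w)))) (at w)"
      by (rule DERIV_compose_FDERIV[OF DERIV_step[OF \<eta>]]) (auto intro!: derivative_eq_intros)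
    have d: "((\<lambda>w. step \<eta> (snd w - z)) has_derivative (\<lambda>hk. snd hk * tent \<eta> (snd w - z))) (at w)"
      by (rule DERIV_compose_FDERIV[OF DERIV_step[OF \<eta>]]) (auto intro!: derivative_eq_intros)
    show ?thesis unfolding \<phi>_def bump_def
      by (rule has_derivative_eq_rhs[OF has_derivative_mult[OF a has_derivative_diff[OF b d]]])
         (auto simp: \<phi>t_def \<phi>x_def bump_def fun_eq_iff algebra_simps)
  qed
  have "test_function \<phi> \<phi>t \<phi>x"
    unfolding test_function_def using der \<phi>tc \<phi>xc S out by blast
  from weak[OF this]
  have w: "(LINT w:{0<..} \<times> UNIV|lborel. u (fst w) (snd w) * \<phi>t w + f (u (fst w) (snd w)) * \<phi>x w)
      + \<psi> 0 * (LINT x|lborel. u0 x * bump \<eta> y z x) = 0"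
    by (simp add: \<phi>_def mult.left_commute)
  let ?F = "\<lambda>w. indicator ({0<..} \<times> UNIV) w *\<^sub>R (u (fst w) (snd w) * \<phi>t w + f (u (fst w) (snd w)) * \<phi>x w)"
  have [measurable]: "\<phi>t \<in> borel_measurable borel" "\<phi>x \<in> borel_measurable borel"
    using \<phi>tc \<phi>xc by (auto intro: borel_measurable_continuous_onI)
  obtain Ct where Ct: "\<And>w. w \<in> S \<Longrightarrow> \<bar>\<phi>t w\<bar> \<le> Ct"
    using compact_imp_bounded[OF compact_continuous_image[OF \<phi>tc S]] by (auto simp: bounded_iff)
  obtain Cx where Cx: "\<And>w. w \<in> S \<Longrightarrow> \<bar>\<phi>x w\<bar> \<le> Cx"
    using compact_imp_bounded[OF compact_continuous_image[OF \<phi>xc S]] by (auto simp: bounded_iff)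
  have "integrable lborel (\<lambda>w. indicator S w *\<^sub>R ?F w)"
  proof (rule integrableI_bounded_set_indicator[where B = "M * Ct + Bf * Cx"])
    show "S \<in> sets lborel" using S by (simp add: borel_compact)
    show "emeasure lborel S < \<infinity>" using S by (rule emeasure_compact_finite)
    have "(\<lambda>w. u (fst w) (snd w) * \<phi>t w + f (u (fst w) (snd w)) * \<phi>x w) \<in> borel_measurable borel"
      using u_measurable measurable_compose[OF u_measurable f_measurable] by measurable
    moreover have "{0<..} \<times> UNIV \<in> sets (borel :: (real \<times> real) measure)"
      by (intro borel_open open_Times) auto
    ultimately show "?F \<in> borel_measurable lborel" by simp
    show "AE w in lborel. w \<in> S \<longrightarrow> norm (?F w) \<le> M * Ct + Bf * Cx"
    proof (intro AE_I2 impI)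
      fix w assume "w \<in> S"
      note b = Ct[OF this] Cx[OF this]
      have "\<bar>u (fst w) (snd w) * \<phi>t w\<bar> \<le> M * Ct" "\<bar>f (u (fst w) (snd w)) * \<phi>x w\<bar> \<le> Bf * Cx"
        unfolding abs_mult using b u_bound fu_bound M_pos Bf_nonneg by (auto intro!: mult_mono)
      then show "norm (?F w) \<le> M * Ct + Bf * Cx" by (auto simp: indicator_def)
    qed
  qed
  moreover have "(\<lambda>w. indicator S w *\<^sub>R ?F w) = ?F"
  proof
    show "indicator S w *\<^sub>R ?F w = ?F w" for w using out[of w] by (cases "w \<in> S") auto
  qed
  ultimately have "integrable lborel ?F" by (simp only:)
  then have int: "integrable (lborel \<Otimes>\<^sub>M lborel) (\<lambda>(t, x). ?F (t, x))"
    by (simp add: lborel_prod case_prod_beta')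
  have "(LINT w:{0<..} \<times> UNIV|lborel. u (fst w) (snd w) * \<phi>t w + f (u (fst w) (snd w)) * \<phi>x w)
      = (LINT t|lborel. LINT x|lborel. ?F (t, x))"
    using lborel_pair.integral_fst[OF int]
    by (simp add: set_lebesgue_integral_def lborel_prod case_prod_beta')
  also have "\<dots> = (LINT t:{0<..}|lborel. \<psi>' t * ?g t + \<psi> t * ?h t)"
  proof -
    have "(LINT x|lborel. ?F (t, x)) = indicator {0<..} t *\<^sub>R (\<psi>' t * ?g t + \<psi> t * ?h t)" for t
    proof (cases "0 < t")
      case True
      have "(LINT x|lborel. ?F (t, x)) = (LINT x|lborel. \<psi>' t * (u t x * bump \<eta> (y + q * t) z x)
          + \<psi> t * ((f (u t x) - q * u t x) * tent \<eta> (x - (y + q * t)) - f (u t x) * tent \<eta> (x - z)))"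
        using True by (intro Bochner_Integration.integral_cong) (auto simp: \<phi>t_def \<phi>x_def algebra_simps)
      also have "\<dots> = \<psi>' t * ?g t + \<psi> t * ?h t"
        using ib ii iv by (subst Bochner_Integration.integral_add) auto
      finally show ?thesis using True by simp
    qed simp
    then show ?thesis by (simp add: set_lebesgue_integral_def)
  qed
  finally show "(LINT t:{0<..}|lborel. \<psi>' t * ?g t + \<psi> t * ?h t) + \<psi> 0 * (LINT x|lborel. u0 x * bump \<eta> y z x) = 0"
    using w by simp
qed

end

context entropy_flow
begin

definition N :: "real \<Rightarrow> real \<Rightarrow> real \<Rightarrow> real" where
  "N \<eta> t z = (LINT x|lborel. f (u t x) * tent \<eta> (x - z))"

text \<open>A mollified potential: \<open>\<partial>P/\<partial>z\<close> is the mollified solution and \<open>\<partial>P/\<partial>t\<close> minus the mollified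
  flux.\<close>

definition P :: "real \<Rightarrow> real \<Rightarrow> real \<Rightarrow> real" where
  "P \<eta> t z = (LINT x|lborel. u0 x * bump \<eta> 0 z x) - (LINT s:{0..t}|lborel. N \<eta> s z)"

lemma N_measurable [measurable]: "(\<lambda>t. N \<eta> t z) \<in> borel_measurable borel"
  unfolding N_def by measurable

context
  fixes \<eta> :: real assumes \<eta>: "0 < \<eta>"
begin

lemma fu_tent_integrable: "integrable lborel (\<lambda>x. f (u t x) * tent \<eta> (x - z))"
  by (rule integrable_mult_bounded[where C = Bf]) (use tent_integral[OF \<eta>] fu_bound in auto)

lemma u_tent_integrable: "integrable lborel (\<lambda>x. u t x * tent \<eta> (x - z))"
  by (rule integrable_mult_bounded[where C = M]) (use tent_integral[OF \<eta>] u_bound in auto)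

lemma abs_N_le: "\<bar>N \<eta> t z\<bar> \<le> Bf"
  using integral_mult_bounded[of lborel "\<lambda>x. tent \<eta> (x - z)" "\<lambda>x. f (u t x)" Bf]
    tent_integral[OF \<eta>] tent_nonneg[OF \<eta>] fu_bound by (simp add: N_def)

lemma N_set_integrable: "set_integrable lborel {\<alpha>..\<beta>} (\<lambda>s. N \<eta> s z)"
  by (rule set_integrable_bounded_Icc[of _ _ _ Bf]) (auto intro: abs_N_le)

lemma bump_integral_add:
  assumes g: "g \<in> borel_measurable borel" "\<And>x. \<bar>g x\<bar> \<le> M"
  shows "(LINT x|lborel. g x * bump \<eta> w z x) - (LINT x|lborel. g x * bump \<eta> w y x) = (LINT x|lborel. g x * bump \<eta> y z x)"
proof -
  have "(LINT x|lborel. g x * bump \<eta> w z x) - (LINT x|lborel. g x * bump \<eta> w y x)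
      = (LINT x|lborel. g x * bump \<eta> w z x - g x * bump \<eta> w y x)"
    by (rule Bochner_Integration.integral_diff[symmetric]; rule mult_bump_integrable[OF \<eta> g])
  also have "\<dots> = (LINT x|lborel. g x * bump \<eta> y z x)"
    by (simp add: bump_def algebra_simps)
  finally show ?thesis .
qed

lemma P_0: "P \<eta> 0 z = (LINT x|lborel. u0 x * bump \<eta> 0 z x)"
proof -
  have "(LINT s:{0..0}|lborel. N \<eta> s z) = 0"
    using set_borel_integral_eq_integral(2)[OF N_set_integrable[of 0 0 z]] by simp
  then show ?thesis by (simp add: P_def)
qed

section \<open>Lipschitz bounds and slices of the potential \<open>P\<close>\<close>

lemma P_time:
  assumes "0 \<le> \<tau>" "\<tau> \<le> t"
  shows "P \<eta> \<tau> z - P \<eta> t z = (LINT s:{\<tau>..t}|lborel. N \<eta> s z)"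
proof -
  have "integral {0..\<tau>} (\<lambda>s. N \<eta> s z) + integral {\<tau>..t} (\<lambda>s. N \<eta> s z) = integral {0..t} (\<lambda>s. N \<eta> s z)"
    using assms by (intro Henstock_Kurzweil_Integration.integral_combine set_borel_integral_eq_integral(1)[OF N_set_integrable]) auto
  then show ?thesis by (simp add: P_def set_borel_integral_eq_integral(2)[OF N_set_integrable])
qed

lemma N_integral_le:
  assumes "\<tau> \<le> t" "AE s in lborel. s \<in> {\<tau>..t} \<longrightarrow> N \<eta> s z \<le> B"
  shows "(LINT s:{\<tau>..t}|lborel. N \<eta> s z) \<le> (t - \<tau>) * B"
proof -
  have "(LINT s:{\<tau>..t}|lborel. N \<eta> s z) \<le> (LINT s:{\<tau>..t}|lborel. B)"
    using assms(2) by (intro set_integral_mono_AE N_set_integrable set_integrable_bounded_Icc[of _ _ _ "\<bar>B\<bar>"]) auto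
  also have "\<dots> = (t - \<tau>) * B" using assms(1) by (simp add: set_lebesgue_integral_def)
  finally show ?thesis .
qed

lemma P_time_lip:
  assumes "0 \<le> \<tau>" "\<tau> \<le> t"
  shows "\<bar>P \<eta> t z - P \<eta> \<tau> z\<bar> \<le> Bf * (t - \<tau>)"
proof -
  have "\<bar>LINT s:{\<tau>..t}|lborel. N \<eta> s z\<bar> = norm (integral {\<tau>..t} (\<lambda>s. N \<eta> s z))"
    by (simp add: set_borel_integral_eq_integral(2)[OF N_set_integrable])
  also have "\<dots> \<le> integral {\<tau>..t} (\<lambda>s. Bf)"
    by (rule integral_norm_bound_integral[OF set_borel_integral_eq_integral(1)[OF N_set_integrable] integrable_const_ivl])
       (simp add: abs_N_le)
  also have "\<dots> = Bf * (t - \<tau>)" using assms(2) by simp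
  finally show ?thesis using P_time[OF assms, of z] by linarith
qed

lemma P_slice_two_points:
  "AE t in lborel. t \<in> {0..T} \<longrightarrow> P \<eta> t z - P \<eta> t y = (LINT x|lborel. u t x * bump \<eta> y z x)"
proof (cases "0 \<le> T")
  case True
  from slice_identity[OF \<eta> True, of y 0 z] show ?thesis
  proof eventually_elim
    case (elim t)
    show ?case
    proof
      assume t: "t \<in> {0..T}"
      have "(LINT s:{0..t}|lborel. LINT x|lborel. f (u s x) * tent \<eta> (x - y) - f (u s x) * tent \<eta> (x - z))
          = (LINT s:{0..t}|lborel. N \<eta> s y - N \<eta> s z)"
        by (simp add: N_def fu_tent_integrable)
      also have "\<dots> = (LINT s:{0..t}|lborel. N \<eta> s y) - (LINT s:{0..t}|lborel. N \<eta> s z)"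
        by (intro set_integral_diff N_set_integrable)
      finally show "P \<eta> t z - P \<eta> t y = (LINT x|lborel. u t x * bump \<eta> y z x)"
        using elim t bump_integral_add[OF u0_measurable u0_bound, of 0 z y]
        by (simp add: P_def)
    qed
  qed
qed simp

text \<open>On almost every slice this is the bound \<open>M\<close> on \<open>u\<close>. A
  violation by \<open>e\<close> at one time would persist on \<open>[t, t + d]\<close>, since the
  two values of \<open>P\<close> move by at most \<open>2 Bf d < e\<close> together, and that
  interval has positive measure.\<close>

lemma P_space_lip:
  assumes "0 \<le> t" shows "\<bar>P \<eta> t z - P \<eta> t y\<bar> \<le> M * \<bar>z - y\<bar>"
proof (rule ccontr)
  define e where "e = \<bar>P \<eta> t z - P \<eta> t y\<bar> - M * \<bar>z - y\<bar>"
  assume "\<not> ?thesis"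
  then have e: "0 < e" by (simp add: e_def)
  define d where "d = e / (2 * Bf + 1)"
  have d: "0 < d" using e Bf_nonneg by (simp add: d_def)
  have "2 * Bf * d < e"
  proof -
    have "2 * Bf * d < (2 * Bf + 1) * d" using d by (simp add: algebra_simps)
    also have "\<dots> = e" using Bf_nonneg by (simp add: d_def)
    finally show ?thesis .
  qed
  have "AE s in lborel. s \<in> {0..t + d} \<longrightarrow> s \<notin> {t..t + d}"
    using P_slice_two_points[of "t + d" z y]
  proof eventually_elim
    case (elim s)
    show ?case
    proof (intro impI notI)
      assume s: "s \<in> {0..t + d}" "s \<in> {t..t + d}"
      have "\<bar>P \<eta> s z - P \<eta> s y\<bar> \<le> M * \<bar>z - y\<bar>" using elim s mult_bump_bound[OF \<eta>, of "u s" M y z] u_bound by simp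
      moreover have "\<bar>P \<eta> s z - P \<eta> t z\<bar> \<le> Bf * (s - t)" "\<bar>P \<eta> s y - P \<eta> t y\<bar> \<le> Bf * (s - t)"
        using s assms by (auto intro: P_time_lip)
      moreover have "Bf * (s - t) \<le> Bf * d" using s Bf_nonneg by (intro mult_left_mono) auto
      ultimately show False using \<open>2 * Bf * d < e\<close> unfolding e_def by linarith
    qed
  qed
  then have "AE s in lborel. s \<notin> {t..t + d}"
    by eventually_elim (use assms in auto)
  then have "emeasure lborel {t..t + d} = 0"
    by (subst (asm) AE_iff_null_sets[symmetric, unfolded null_sets_def]) auto
  then show False using d by simp
qed

text \<open>The null set of times must not depend on \<open>y\<close> and \<open>z\<close>: it is
  collected over rational points and integer time horizons, and Lipschitz continuity of both sides
  in space does the rest.\<close>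

lemma P_slice:
  "AE t in lborel. 0 < t \<longrightarrow> (\<forall>y z. P \<eta> t z - P \<eta> t y = (LINT x|lborel. u t x * bump \<eta> y z x))"
proof -
  have "AE t in lborel. \<forall>n::nat. \<forall>z\<in>\<rat>. t \<in> {0..real n} \<longrightarrow> P \<eta> t z - P \<eta> t 0 = (LINT x|lborel. u t x * bump \<eta> 0 z x)"
    by (intro AE_all_countable[THEN iffD2] allI AE_ball_countable[THEN iffD2] countable_rat ballI P_slice_two_points)
  then show ?thesis
  proof eventually_elim
    case (elim t)
    show ?case
    proof
      assume t: "0 < t"
      let ?I = "\<lambda>y z. LINT x|lborel. u t x * bump \<eta> y z x"
      have rat: "P \<eta> t z - P \<eta> t 0 = ?I 0 z" if "z \<in> \<rat>" for z
      proof -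
        obtain n :: nat where "t \<le> real n" using real_arch_simple by blast
        then show ?thesis using elim that t by auto
      qed
      have I: "?I 0 z - ?I 0 y = ?I y z" for y z by (rule bump_integral_add) (use u_bound in auto)
      have all: "P \<eta> t z - P \<eta> t 0 = ?I 0 z" for z
      proof (rule ccontr)
        define e where "e = \<bar>P \<eta> t z - P \<eta> t 0 - ?I 0 z\<bar>"
        assume "\<not> ?thesis"
        then have e: "0 < e" by (simp add: e_def)
        obtain r where r: "r \<in> \<rat>" "z < r" "r < z + e / (2 * M)"
          using Rats_dense_in_real[of z "z + e / (2 * M)"] e M_pos by auto
        have "\<bar>P \<eta> t z - P \<eta> t r\<bar> \<le> M * \<bar>z - r\<bar>" using t by (intro P_space_lip) auto
        moreover have "\<bar>?I z r\<bar> \<le> M * \<bar>r - z\<bar>" by (rule mult_bump_bound[OF \<eta>]) (use u_bound in auto)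
        moreover have "M * (r - z) < e / 2" using r M_pos by (simp add: field_simps)
        ultimately show False using rat[OF r(1)] I[of r z] r(2) unfolding e_def by simp
      qed
      show "\<forall>y z. P \<eta> t z - P \<eta> t y = ?I y z"
        using all I by (metis diff_diff_eq2 diff_add_cancel add_diff_cancel_right)
    qed
  qed
qed

text \<open>Testing against a window that moves with speed \<open>q\<close>; the bound is the inequality of Fenchel and
  Young under the integral.\<close>

lemma P_upper:
  assumes t: "0 < t"
  shows "P \<eta> t (y + q * t) \<le> P \<eta> 0 y + t * L q"
proof (rule ccontr)
  define e where "e = P \<eta> t (y + q * t) - (P \<eta> 0 y + t * L q)"
  assume "\<not> ?thesis"
  then have e: "0 < e" by (simp add: e_def)
  \<comment> \<open>A Lipschitz constant in \<open>s\<close>, for \<open>s \<ge> t\<close>, of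
    \<open>P \<eta> s (y + q s) - s L q\<close>; a violation at \<open>t\<close> thus persists on an
    interval of positive length.\<close>
  define k where "k = Bf + M * \<bar>q\<bar> + \<bar>L q\<bar>"
  have k: "0 \<le> k" using Bf_nonneg M_pos by (simp add: k_def)
  define d where "d = e / (k + 1)"
  have d: "0 < d" using e k by (simp add: d_def)
  have kd: "k * d < e"
  proof -
    have "k * d < (k + 1) * d" using d by (simp add: algebra_simps)
    also have "\<dots> = e" using k by (simp add: d_def)
    finally show ?thesis .
  qed
  have T: "0 \<le> t + d" using t d by simp
  have le: "AE s in lborel. s \<in> {0..t + d} \<longrightarrow> 0 < s \<longrightarrow> P \<eta> s (y + q * s) \<le> P \<eta> 0 y + s * L q"
    using slice_identity[OF \<eta> T, of y q 0] P_slice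
  proof eventually_elim
    case (elim s)
    show ?case
    proof (intro impI)
      assume s: "s \<in> {0..t + d}" "0 < s"
      have *: "- L q \<le> (LINT x|lborel. (f (u r x) - q * u r x) * tent \<eta> (x - (y + q * r)))" for r
      proof -
        have "(LINT x|lborel. - L q * tent \<eta> (x - (y + q * r)))
            \<le> (LINT x|lborel. (f (u r x) - q * u r x) * tent \<eta> (x - (y + q * r)))"
        proof (intro integral_mono mult_right_mono)
          show "integrable lborel (\<lambda>x. (f (u r x) - q * u r x) * tent \<eta> (x - (y + q * r)))"
            using fu_tent_integrable[of r "y + q * r"] u_tent_integrable[of r "y + q * r"]
            by (simp add: left_diff_distrib mult.assoc)
          show "- L q \<le> f (u r x) - q * u r x" for x
            using Fenchel_Young[of "u r x" q] u_bound[of r x] by (auto simp: abs_le_iff)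
        qed (use tent_integral[OF \<eta>] tent_nonneg[OF \<eta>] in auto)
        then show ?thesis using tent_integral(2)[OF \<eta>] by simp
      qed
      \<comment> \<open>The resting end of the window is placed at 0. Its flux
        \<open>N \<eta> r 0\<close> also makes up the change of \<open>P\<close> at 0 in time, and
        the two cancel.\<close>
      let ?K = "\<lambda>r. LINT x|lborel. (f (u r x) - q * u r x) * tent \<eta> (x - (y + q * r)) - f (u r x) * tent \<eta> (x - 0)"
      have K: "?K r = (LINT x|lborel. (f (u r x) - q * u r x) * tent \<eta> (x - (y + q * r))) - N \<eta> r 0" for r
        unfolding N_def
        using fu_tent_integrable[of r "y + q * r"] u_tent_integrable[of r "y + q * r"] fu_tent_integrable[of r 0]
        by (intro Bochner_Integration.integral_diff) (simp_all add: left_diff_distrib mult.assoc)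
      have "(LINT r:{0..s}|lborel. - L q - N \<eta> r 0) \<le> (LINT r:{0..s}|lborel. ?K r)"
      proof (rule set_integral_mono)
        show "set_integrable lborel {0..s} (\<lambda>r. - L q - N \<eta> r 0)"
          using abs_N_le by (intro set_integrable_bounded_Icc[of _ _ _ "\<bar>L q\<bar> + Bf"]) (auto, smt (verit))
        show "set_integrable lborel {0..s} ?K"
        proof (rule set_integrable_bounded_Icc[of _ _ _ "(Bf + \<bar>q\<bar> * M) + Bf"])
          show "\<bar>?K r\<bar> \<le> (Bf + \<bar>q\<bar> * M) + Bf" for r
          proof -
            have "\<bar>LINT x|lborel. (f (u r x) - q * u r x) * tent \<eta> (x - (y + q * r))\<bar> \<le> (Bf + \<bar>q\<bar> * M) * 1"
              using integral_mult_bounded[of lborel "\<lambda>x. tent \<eta> (x - (y + q * r))" "\<lambda>x. f (u r x) - q * u r x" "Bf + \<bar>q\<bar> * M"]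
                tent_integral[OF \<eta>] tent_nonneg[OF \<eta>] flux_diff_bound by simp
            then show ?thesis unfolding K using abs_N_le[of r 0]
              by (intro order_trans[OF abs_triangle_ineq4] add_mono) auto
          qed
        qed measurable
        show "- L q - N \<eta> r 0 \<le> ?K r" for r unfolding K using *[of r] by simp
      qed
      moreover have "(LINT r:{0..s}|lborel. - L q - N \<eta> r 0) = s * (- L q) - (LINT r:{0..s}|lborel. N \<eta> r 0)"
        using s set_integral_diff(2)[OF set_integrable_bounded_Icc[of "\<lambda>_. - L q" 0 s "\<bar>L q\<bar>"] N_set_integrable[of 0 s 0]]
        by (simp add: set_lebesgue_integral_def)
      ultimately have "- s * L q - (LINT r:{0..s}|lborel. N \<eta> r 0) + (LINT x|lborel. u0 x * bump \<eta> y 0 x)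
          \<le> (LINT x|lborel. u s x * bump \<eta> (y + q * s) 0 x)"
        using elim(1) s by simp
      also have "\<dots> = P \<eta> s 0 - P \<eta> s (y + q * s)" using elim(2) s by simp
      also have "P \<eta> s 0 = P \<eta> 0 0 - (LINT r:{0..s}|lborel. N \<eta> r 0)"
        by (simp add: P_0) (simp add: P_def)
      also have "(LINT x|lborel. u0 x * bump \<eta> y 0 x) = P \<eta> 0 0 - P \<eta> 0 y"
        unfolding P_0 by (rule bump_integral_add[OF u0_measurable u0_bound, symmetric])
      finally show "P \<eta> s (y + q * s) \<le> P \<eta> 0 y + s * L q" by simp
    qed
  qed
  have "AE s in lborel. s \<notin> {t..t + d}"
    using le
  proof eventually_elim
    case (elim s)
    show ?case
    proof
      assume s: "s \<in> {t..t + d}"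
      have "P \<eta> s (y + q * s) \<le> P \<eta> 0 y + s * L q" using elim s t by auto
      moreover have "\<bar>P \<eta> s (y + q * s) - P \<eta> t (y + q * s)\<bar> \<le> Bf * (s - t)"
        using s t by (intro P_time_lip) auto
      moreover have "\<bar>P \<eta> t (y + q * s) - P \<eta> t (y + q * t)\<bar> \<le> M * \<bar>y + q * s - (y + q * t)\<bar>"
        using t by (intro P_space_lip) auto
      moreover have "M * \<bar>y + q * s - (y + q * t)\<bar> = M * \<bar>q\<bar> * (s - t)"
        using s by (simp add: abs_mult flip: right_diff_distrib)
      moreover have "s * L q - t * L q \<le> \<bar>L q\<bar> * (s - t)"
        using s mult_right_mono[of "L q" "\<bar>L q\<bar>" "s - t"] by (simp add: algebra_simps)
      moreover have "Bf * (s - t) + M * \<bar>q\<bar> * (s - t) + \<bar>L q\<bar> * (s - t) = k * (s - t)"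
        by (simp add: k_def algebra_simps)
      moreover have "k * (s - t) \<le> k * d" using s k by (intro mult_left_mono) auto
      ultimately show False using kd unfolding e_def by linarith
    qed
  qed
  then have "emeasure lborel {t..t + d} = 0"
    by (subst (asm) AE_iff_null_sets[symmetric, unfolded null_sets_def]) auto
  then show False using d by simp
qed

end

end

section \<open>Identification with the Lax-Oleinik solution\<close>

text \<open>The sharp limit of \<open>bump\<close> with the same sign convention; for
  \<open>y \<le> z\<close> it is the indicator of the half-open interval from \<open>y\<close>
  included to \<open>z\<close> excluded.\<close>

definition window :: "real \<Rightarrow> real \<Rightarrow> real \<Rightarrow> real" where
  "window y z x = indicator {0..} (x - y) - indicator {0..} (x - z)"

lemma window_measurable [measurable]: "window y z \<in> borel_measurable borel"
  unfolding window_def by measurable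

lemma bump_minus_window:
  "0 < \<eta> \<Longrightarrow> \<bar>bump \<eta> y z x - window y z x\<bar> \<le> indicator {y - \<eta>..y + \<eta>} x + indicator {z - \<eta>..z + \<eta>} x"
  using step_minus_indicator[of \<eta> "x - y"] step_minus_indicator[of \<eta> "x - z"]
  unfolding bump_def window_def indicator_def by (simp add: algebra_simps)

lemma window_integrable: "integrable lborel (window y z)"
proof (rule Bochner_Integration.integrable_bound)
  show "integrable lborel (indicator {min y z..max y z} :: real \<Rightarrow> real)"
    by (intro integrable_real_indicator) (auto simp: emeasure_lborel_Icc_eq)
  show "AE x in lborel. norm (window y z x) \<le> norm (indicator {min y z..max y z} x :: real)"
    by (intro AE_I2) (auto simp: window_def indicator_def)
qed simp

lemma window_integral:
  assumes "y \<le> z" and [measurable]: "g \<in> borel_measurable borel"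
  shows "(LINT x|lborel. g x * window y z x) = (LINT x:{y..z}|lborel. g x)"
  unfolding set_lebesgue_integral_def
proof (rule integral_cong_AE)
  show "AE x in lborel. g x * window y z x = indicator {y..z} x *\<^sub>R g x"
    using AE_lborel_singleton[of z] by eventually_elim (use assms(1) in \<open>auto simp: window_def indicator_def\<close>)
qed measurable

lemma bump_window_integral:
  assumes \<eta>: "0 < \<eta>" and g: "g \<in> borel_measurable borel" "\<And>x. \<bar>g x\<bar> \<le> M"
  shows "\<bar>(LINT x|lborel. g x * bump \<eta> y z x) - (LINT x|lborel. g x * window y z x)\<bar> \<le> 4 * M * \<eta>"
proof -
  have M: "0 \<le> M" using g(2)[of 0] by linarith
  have ind: "integrable lborel (\<lambda>x. indicator {y - \<eta>..y + \<eta>} x + indicator {z - \<eta>..z + \<eta>} x :: real)"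
    by (intro Bochner_Integration.integrable_add integrable_real_indicator) (auto simp: emeasure_lborel_Icc_eq)
  have int: "integrable lborel (\<lambda>x. g x * (bump \<eta> y z x - window y z x))"
    by (rule integrable_mult_bounded[OF _ _ g(2)]) (use bump_integrable[OF \<eta>] window_integrable g(1) in auto)
  have "(LINT x|lborel. g x * bump \<eta> y z x) - (LINT x|lborel. g x * window y z x)
      = (LINT x|lborel. g x * (bump \<eta> y z x - window y z x))"
    unfolding right_diff_distrib
    by (rule Bochner_Integration.integral_diff[symmetric]; rule integrable_mult_bounded[OF _ _ g(2)])
       (use bump_integrable[OF \<eta>] window_integrable g(1) in auto)
  also have "\<bar>\<dots>\<bar> \<le> (LINT x|lborel. \<bar>g x * (bump \<eta> y z x - window y z x)\<bar>)" by (rule integral_abs_bound)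
  also have "\<dots> \<le> (LINT x|lborel. M * (indicator {y - \<eta>..y + \<eta>} x + indicator {z - \<eta>..z + \<eta>} x))"
  proof (rule integral_mono[OF integrable_abs[OF int]])
    show "\<bar>g x * (bump \<eta> y z x - window y z x)\<bar> \<le> M * (indicator {y - \<eta>..y + \<eta>} x + indicator {z - \<eta>..z + \<eta>} x)" for x
      unfolding abs_mult by (intro mult_mono g(2) bump_minus_window[OF \<eta>] M) auto
  qed (use ind in simp)
  also have "\<dots> = 4 * M * \<eta>"
    using \<eta> by (subst Bochner_Integration.integral_mult_right_zero, subst Bochner_Integration.integral_add)
      (auto simp: emeasure_lborel_Icc_eq intro!: integrable_real_indicator)
  finally show ?thesis .
qed

context entropy_flow
begin

definition W :: "real \<Rightarrow> real" where "W y = (LINT x|lborel. u0 x * window 0 y x)"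

lemma W_diff: "W z - W y = (LINT x|lborel. u0 x * window y z x)"
proof -
  have "W z - W y = (LINT x|lborel. u0 x * window 0 z x - u0 x * window 0 y x)"
    unfolding W_def
    by (rule Bochner_Integration.integral_diff[symmetric]; rule integrable_mult_bounded[OF _ _ u0_bound])
       (use window_integrable in auto)
  also have "\<dots> = (LINT x|lborel. u0 x * window y z x)" by (simp add: window_def algebra_simps)
  finally show ?thesis .
qed

lemma P_0_W: "0 < \<eta> \<Longrightarrow> \<bar>P \<eta> 0 y - W y\<bar> \<le> 4 * M * \<eta>"
  using bump_window_integral[of \<eta> u0 M 0 y] u0_bound by (simp add: P_0 W_def)

lemma W_lipschitz: "\<bar>W z - W y\<bar> \<le> M * \<bar>z - y\<bar>"
proof (rule field_le_epsilon)
  fix e :: real assume e: "0 < e"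
  have \<eta>: "0 < e / (4 * M)" using e M_pos by simp
  have "\<bar>W z - W y\<bar> \<le> \<bar>LINT x|lborel. u0 x * bump (e / (4 * M)) y z x\<bar> + 4 * M * (e / (4 * M))"
    using bump_window_integral[OF \<eta> u0_measurable u0_bound, of y z] unfolding W_diff by linarith
  also have "\<dots> \<le> M * \<bar>z - y\<bar> + e"
    using mult_bump_bound[OF \<eta> u0_measurable u0_bound, of y z] M_pos by simp
  finally show "\<bar>W z - W y\<bar> \<le> M * \<bar>z - y\<bar> + e" .
qed

sublocale lax_oleinik M A \<delta> p f a W
  by unfold_locales (rule W_lipschitz)

text \<open>\<open>P_upper\<close> is applied along the optimal segment, from the foot
  \<open>Y t x\<close> with speed \<open>Q t x\<close>.\<close>

lemma P_le_V:
  assumes \<eta>: "0 < \<eta>" and t: "0 < t" shows "P \<eta> t x \<le> V t x + 4 * M * \<eta>"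
proof -
  have "P \<eta> t (Y t x + Q t x * t) \<le> P \<eta> 0 (Y t x) + t * L (Q t x)" by (rule P_upper[OF \<eta> t])
  moreover have "Y t x + Q t x * t = x" using t by (simp add: Q_def)
  ultimately show ?thesis using P_0_W[OF \<eta>, of "Y t x"] by (simp add: V_def E_def Q_def)
qed

section \<open>The bound of \<open>V\<close> by \<open>P\<close>, going backward in time\<close>

context
  fixes \<eta> :: real assumes \<eta>: "0 < \<eta>"
begin

text \<open>The touching argument: if the difference quotients of \<open>P\<close> on both sides of \<open>y\<close> are
  compatible with the slope \<open>w\<close>, the one-sided condition forces \<open>u\<close> to be close to \<open>w\<close> near \<open>y\<close>.\<close>

lemma N_touch:
  assumes \<sigma>: "0 < \<sigma>" and d: "0 < d" and w: "\<bar>w\<bar> \<le> M"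
    and slice: "\<And>y z. P \<eta> \<sigma> z - P \<eta> \<sigma> y = (LINT x|lborel. u \<sigma> x * bump \<eta> y z x)"
    and right: "d * (w - e) \<le> P \<eta> \<sigma> (y + d) - P \<eta> \<sigma> y"
    and left: "P \<eta> \<sigma> y - P \<eta> \<sigma> (y - d) \<le> d * (w + e)"
  shows "N \<eta> \<sigma> y \<le> f w + A * (e + c * ((d + 2 * \<eta>) powr (1 / p) / \<sigma> powr (1 / p)) + 4 * M * \<eta> / d)"
proof -
  let ?om = "c * ((d + 2 * \<eta>) powr (1 / p) / \<sigma> powr (1 / p))"
  let ?e = "e + ?om + 4 * M * \<eta> / d"
  let ?I = "{y - \<eta>..y + \<eta>}"
  have [measurable]: "u \<sigma> \<in> borel_measurable borel" by measurable
  have om: "u \<sigma> x' \<le> u \<sigma> x + ?om"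
    if "x < x' \<longrightarrow> u \<sigma> x' - u \<sigma> x \<le> c * ((x' - x) powr (1 / p) / \<sigma> powr (1 / p))" "x < x'" "x' - x \<le> d + 2 * \<eta>" for x x'
  proof -
    have "c * ((x' - x) powr (1 / p) / \<sigma> powr (1 / p)) \<le> ?om"
      using that c_nonneg p_pos by (intro mult_left_mono divide_right_mono powr_mono2) auto
    then show ?thesis using that by linarith
  qed
  have om_nonneg: "0 \<le> ?om" using c_nonneg by simp
  have ub: "integrable lborel (\<lambda>x. u \<sigma> x * bump \<eta> y z x)" for y z
    by (rule mult_bump_integrable[OF \<eta>]) (use u_bound in auto)
  have ind: "integrable lborel (\<lambda>x. 2 * M * indicator ?I x :: real)" "(LINT x|lborel. 2 * M * indicator ?I x :: real) = 4 * M * \<eta>"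
    using \<eta> by (auto intro!: integrable_real_indicator simp: emeasure_lborel_Icc_eq)
  have pair: "AE xy in lborel \<Otimes>\<^sub>M lborel. fst xy < snd xy \<longrightarrow>
      u \<sigma> (snd xy) - u \<sigma> (fst xy) \<le> c * ((snd xy - fst xy) powr (1 / p) / \<sigma> powr (1 / p))"
    using one_sided[OF \<sigma>] unfolding lborel_prod case_prod_beta' .
  \<comment> \<open>The condition holds for almost all pairs. Both orders of Fubini are needed: the
    lower bound on \<open>u\<close> freezes the left point of a pair, the upper bound the right
    one.\<close>
  have above: "AE x in lborel. AE x' in lborel. x < x' \<longrightarrow>
      u \<sigma> x' - u \<sigma> x \<le> c * ((x' - x) powr (1 / p) / \<sigma> powr (1 / p))"
    using lborel_pair.AE_pair[OF pair] by simp
  have below: "AE x' in lborel. AE x in lborel. x < x' \<longrightarrow>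
      u \<sigma> x' - u \<sigma> x \<le> c * ((x' - x) powr (1 / p) / \<sigma> powr (1 / p))"
  proof (rule lborel_pair.AE_commute[THEN iffD1, OF _ above])
    have "(\<lambda>z. u \<sigma> (snd z) - u \<sigma> (fst z)) \<in> borel_measurable (borel \<Otimes>\<^sub>M borel)"
      by measurable
    moreover have "(\<lambda>z. c * ((snd z - fst z) powr (1 / p) / \<sigma> powr (1 / p))) \<in> borel_measurable (borel \<Otimes>\<^sub>M borel)"
      by measurable
    ultimately show "{z \<in> space (lborel \<Otimes>\<^sub>M lborel). fst z < snd z \<longrightarrow>
      u \<sigma> (snd z) - u \<sigma> (fst z) \<le> c * ((snd z - fst z) powr (1 / p) / \<sigma> powr (1 / p))} \<in> sets (lborel \<Otimes>\<^sub>M lborel)"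
      by measurable
  qed
  \<comment> \<open>The mollified mean of \<open>u\<close> over \<open>[y, y + d]\<close> is at
    least \<open>w - e\<close>, and points to the right of \<open>x\<close> exceed
    \<open>u \<sigma> x\<close> by at most \<open>?om\<close>. So \<open>u \<sigma> x\<close> cannot
    be much below \<open>w\<close>.\<close>
  have "AE x in lborel. x \<in> ?I \<longrightarrow> w - ?e \<le> u \<sigma> x"
    using above
  proof eventually_elim
    case (elim x)
    show ?case
    proof
      assume x: "x \<in> ?I"
      have "(LINT x'|lborel. u \<sigma> x' * bump \<eta> y (y + d) x')
          \<le> (LINT x'|lborel. (u \<sigma> x + ?om) * bump \<eta> y (y + d) x' + 2 * M * indicator ?I x')"
      proof (rule integral_mono_AE[OF ub])
        show "integrable lborel (\<lambda>x'. (u \<sigma> x + ?om) * bump \<eta> y (y + d) x' + 2 * M * indicator ?I x')"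
          using bump_integrable[OF \<eta>] ind by (intro Bochner_Integration.integrable_add) auto
        show "AE x' in lborel. u \<sigma> x' * bump \<eta> y (y + d) x' \<le> (u \<sigma> x + ?om) * bump \<eta> y (y + d) x' + 2 * M * indicator ?I x'"
          using elim
        proof eventually_elim
          case (elim x')
          have b: "0 \<le> bump \<eta> y (y + d) x'" "bump \<eta> y (y + d) x' \<le> 1"
            using d bump_nonneg[OF \<eta>] bump_le_1[OF \<eta>] by auto
          \<comment> \<open>In the last case \<open>x'\<close> may lie left of \<open>x\<close>,
            where the condition says nothing; the crude bound \<open>2 M\<close> on a set of length
            \<open>2 \<eta>\<close> costs \<open>4 M \<eta>\<close>. In the second case the distance
            is at most \<open>d + 2 \<eta>\<close>, as \<open>x\<close> may be \<open>\<eta>\<close>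
            left of \<open>y\<close> and the window reaches \<open>\<eta>\<close> beyond
            \<open>y + d\<close>.\<close>
          consider "bump \<eta> y (y + d) x' = 0" | "x < x'" "x' \<le> y + d + \<eta>" | "x' \<in> ?I"
            using bump_outside[OF \<eta>, of x' y "y + d"] d x by fastforce
          then show ?case
          proof cases
            case 1 then show ?thesis using M_pos by simp
          next
            case 2
            then have "u \<sigma> x' \<le> u \<sigma> x + ?om" using elim x by (intro om) auto
            then have "u \<sigma> x' * bump \<eta> y (y + d) x' \<le> (u \<sigma> x + ?om) * bump \<eta> y (y + d) x'"
              using b by (intro mult_right_mono)
            then show ?thesis using M_pos by (smt (verit) indicator_pos_le mult_nonneg_nonneg)
          next
            case 3
            have "(u \<sigma> x' - (u \<sigma> x + ?om)) * bump \<eta> y (y + d) x' \<le> (2 * M) * bump \<eta> y (y + d) x'"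
              using u_bound[of \<sigma> x] u_bound[of \<sigma> x'] om_nonneg b by (intro mult_right_mono) auto
            also have "\<dots> \<le> 2 * M * 1" using b M_pos by (intro mult_left_mono) auto
            finally show ?thesis using 3 by (simp add: left_diff_distrib)
          qed
        qed
      qed
      also have "\<dots> = (u \<sigma> x + ?om) * d + 4 * M * \<eta>"
        using bump_integrable[OF \<eta>] ind bump_integral[OF \<eta>]
        by (subst Bochner_Integration.integral_add) auto
      finally have "d * (w - e) \<le> (u \<sigma> x + ?om) * d + 4 * M * \<eta>" using right slice[of "y + d" y] by simp
      then show "w - ?e \<le> u \<sigma> x" using d by (simp add: field_simps)
    qed
  qed
  \<comment> \<open>The mirror image: points left of \<open>x\<close> lie at most \<open>?om\<close>
    below \<open>u \<sigma> x\<close>, while their mean is at most \<open>w + e\<close>.\<close>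
  moreover have "AE x in lborel. x \<in> ?I \<longrightarrow> u \<sigma> x \<le> w + ?e"
    using below
  proof eventually_elim
    case (elim x)
    show ?case
    proof
      assume x: "x \<in> ?I"
      have "(LINT x'|lborel. (u \<sigma> x - ?om) * bump \<eta> (y - d) y x' - 2 * M * indicator ?I x')
          \<le> (LINT x'|lborel. u \<sigma> x' * bump \<eta> (y - d) y x')"
      proof (rule integral_mono_AE[OF _ ub])
        show "integrable lborel (\<lambda>x'. (u \<sigma> x - ?om) * bump \<eta> (y - d) y x' - 2 * M * indicator ?I x')"
          using bump_integrable[OF \<eta>] ind by (intro Bochner_Integration.integrable_diff) auto
        show "AE x' in lborel. (u \<sigma> x - ?om) * bump \<eta> (y - d) y x' - 2 * M * indicator ?I x' \<le> u \<sigma> x' * bump \<eta> (y - d) y x'"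
          using elim
        proof eventually_elim
          case (elim x')
          have b: "0 \<le> bump \<eta> (y - d) y x'" "bump \<eta> (y - d) y x' \<le> 1"
            using d bump_nonneg[OF \<eta>] bump_le_1[OF \<eta>] by auto
          consider "bump \<eta> (y - d) y x' = 0" | "x' < x" "y - d - \<eta> \<le> x'" | "x' \<in> ?I"
            using bump_outside[OF \<eta>, of x' "y - d" y] d x by fastforce
          then show ?case
          proof cases
            case 1 then show ?thesis using M_pos by simp
          next
            case 2
            then have "u \<sigma> x \<le> u \<sigma> x' + ?om" using elim x by (intro om) auto
            then have "(u \<sigma> x - ?om) * bump \<eta> (y - d) y x' \<le> u \<sigma> x' * bump \<eta> (y - d) y x'"
              using b by (intro mult_right_mono) auto
            then show ?thesis using M_pos by (smt (verit) indicator_pos_le mult_nonneg_nonneg)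
          next
            case 3
            have "((u \<sigma> x - ?om) - u \<sigma> x') * bump \<eta> (y - d) y x' \<le> (2 * M) * bump \<eta> (y - d) y x'"
              using u_bound[of \<sigma> x] u_bound[of \<sigma> x'] om_nonneg b by (intro mult_right_mono) auto
            also have "\<dots> \<le> 2 * M * 1" using b M_pos by (intro mult_left_mono) auto
            finally show ?thesis using 3 by (simp add: left_diff_distrib)
          qed
        qed
      qed
      moreover have "(LINT x'|lborel. (u \<sigma> x - ?om) * bump \<eta> (y - d) y x' - 2 * M * indicator ?I x')
          = (u \<sigma> x - ?om) * d - 4 * M * \<eta>"
        using bump_integrable[OF \<eta>] ind bump_integral[OF \<eta>]
        by (subst Bochner_Integration.integral_diff) auto
      ultimately have "(u \<sigma> x - ?om) * d - 4 * M * \<eta> \<le> d * (w + e)" using left slice[of y "y - d"] by simp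
      then show "u \<sigma> x \<le> w + ?e" using d by (simp add: field_simps)
    qed
  qed
  ultimately have "AE x in lborel. f (u \<sigma> x) * tent \<eta> (x - y) \<le> (f w + A * ?e) * tent \<eta> (x - y)"
  proof eventually_elim
    case (elim x)
    show ?case
    proof (cases "x \<in> ?I")
      case True
      then have "\<bar>u \<sigma> x - w\<bar> \<le> ?e" using elim by (auto simp: abs_le_iff)
      then have "A * \<bar>u \<sigma> x - w\<bar> \<le> A * ?e" using A_pos by (intro mult_left_mono) auto
      moreover have "\<bar>f (u \<sigma> x) - f w\<bar> \<le> A * \<bar>u \<sigma> x - w\<bar>"
        using u_bound[of \<sigma> x] w by (intro f_lip) (auto simp: abs_le_iff)
      ultimately have "f (u \<sigma> x) \<le> f w + A * ?e" by linarith
      then show ?thesis using tent_nonneg[OF \<eta>] by (intro mult_right_mono)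
    next
      case False
      then have "tent \<eta> (x - y) = 0" by (intro tent_outside[OF \<eta>]) auto
      then show ?thesis by simp
    qed
  qed
  then have "N \<eta> \<sigma> y \<le> (LINT x|lborel. (f w + A * ?e) * tent \<eta> (x - y))"
    unfolding N_def using tent_integral[OF \<eta>]
    by (intro integral_mono_AE fu_tent_integrable[OF \<eta>]) auto
  then show ?thesis using tent_integral[OF \<eta>] by simp
qed

text \<open>The errors come, in this order, from the change of slope of the touching function over a distance
  \<open>d\<close>, the motion of \<open>P\<close> during a time \<open>h\<close>, the one-sided condition, the width of the mollifier, and the
  change of slope during a time \<open>h\<close>.\<close>

definition err :: "real \<Rightarrow> real \<Rightarrow> real \<Rightarrow> real" where
  "err \<rho> d h = (d / \<rho> / \<delta>) powr (1 / p) + 2 * Bf * h / d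
     + c * ((d + 2 * \<eta>) powr (1 / p) / \<rho> powr (1 / p)) + 4 * M * \<eta> / d + (A * h / \<rho> / \<delta>) powr (1 / p)"

text \<open>The minimizer \<open>y\<close> at time \<open>\<tau>\<close> is kept as competitor at
  \<open>\<tau> - h\<close>. Going back, \<open>P\<close> gains at most about \<open>h f w\<close>
  by the touching argument, while the cost drops by at least \<open>h f w'\<close>; the Hoelder
  bound on \<open>G\<close> makes \<open>w\<close> and \<open>w'\<close> close. Keeping the time and
  \<open>r\<close> above \<open>\<rho>\<close> makes all these errors uniform.\<close>

lemma backward_step:
  assumes \<rho>: "0 < \<rho>" and d: "0 < d" and h: "0 < h" and \<tau>: "\<rho> \<le> \<tau> - h" and r: "\<rho> \<le> r"
  shows "\<exists>y. P \<eta> (\<tau> - h) y + (r + h) * L ((x - y) / (r + h))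
    \<le> P \<eta> \<tau> y' + r * L ((x - y') / r) + h * (A * err \<rho> d h)"
proof -
  have r0: "0 < r" using \<rho> r by simp
  have \<tau>0: "0 \<le> \<tau>" using \<rho> \<tau> h by simp
  obtain y where y: "y \<in> {x - r * A..x + r * A}"
    "\<And>y'. P \<eta> \<tau> y + r * L ((x - y) / r) \<le> P \<eta> \<tau> y' + r * L ((x - y') / r)"
    using minimizer_exists[of "P \<eta> \<tau>" r x] P_space_lip[OF \<eta> \<tau>0] r0 by blast
  define q w where "q = (x - y) / r" and "w = G q"
  have w: "\<bar>w\<bar> \<le> M" unfolding w_def by (rule abs_G_le)
  define e1 where "e1 = (d / \<rho> / \<delta>) powr (1 / p)"
  have G1: "\<bar>G q' - w\<bar> \<le> e1" if "\<bar>q' - q\<bar> \<le> d / r" for q'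
  proof -
    have "\<bar>G q' - w\<bar> \<le> (\<bar>q' - q\<bar> / \<delta>) powr (1 / p)" unfolding w_def by (rule G_Hoelder)
    also have "\<dots> \<le> e1" unfolding e1_def
    proof (intro powr_mono2 divide_right_mono)
      have "d / r \<le> d / \<rho>" using d \<rho> r by (intro divide_left_mono) auto
      then show "\<bar>q' - q\<bar> \<le> d / \<rho>" using that by linarith
    qed (use p_pos \<delta>_pos in auto)
    finally show ?thesis .
  qed
  \<comment> \<open>Minimality of \<open>y\<close> against \<open>y + d\<close> bounds the increment
    of \<open>P\<close> below by the change of cost, whose slope stays within \<open>e1\<close> of
    \<open>w\<close> over the distance \<open>d\<close>.\<close>
  have right: "d * (w - e1) \<le> P \<eta> \<tau> (y + d) - P \<eta> \<tau> y"
  proof -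
    define q' where "q' = (x - (y + d)) / r"
    have dq: "q - q' = d / r" by (simp add: q_def q'_def flip: diff_divide_distrib)
    have "\<bar>q' - q\<bar> \<le> d / r" using dq divide_pos_pos[OF d r0] by linarith
    then have "w - e1 \<le> G q'" using G1[of q'] by linarith
    then have "d * (w - e1) \<le> d * G q'" using d by (intro mult_left_mono) auto
    also have "\<dots> = r * ((q - q') * G q')" using r0 by (simp add: dq)
    also have "\<dots> \<le> r * (L q - L q')" using r0 by (intro mult_left_mono L_diff_ge) auto
    also have "\<dots> \<le> P \<eta> \<tau> (y + d) - P \<eta> \<tau> y" using y(2)[of "y + d"] by (simp add: q_def q'_def right_diff_distrib)
    finally show ?thesis .
  qed
  have left: "P \<eta> \<tau> y - P \<eta> \<tau> (y - d) \<le> d * (w + e1)"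
  proof -
    define q' where "q' = (x - (y - d)) / r"
    have dq: "q' - q = d / r" by (simp add: q_def q'_def flip: diff_divide_distrib)
    have "\<bar>q' - q\<bar> \<le> d / r" using dq divide_pos_pos[OF d r0] by linarith
    then have "G q' \<le> w + e1" using G1[of q'] by linarith
    have "P \<eta> \<tau> y - P \<eta> \<tau> (y - d) \<le> r * (L q' - L q)" using y(2)[of "y - d"] by (simp add: q_def q'_def right_diff_distrib)
    also have "\<dots> \<le> r * ((q' - q) * G q')" using r0 by (intro mult_left_mono L_diff_le) auto
    also have "\<dots> = d * G q'" using r0 by (simp add: dq)
    also have "\<dots> \<le> d * (w + e1)" using d \<open>G q' \<le> w + e1\<close> by (intro mult_left_mono) auto
    finally show ?thesis .
  qed
  let ?om = "c * ((d + 2 * \<eta>) powr (1 / p) / \<rho> powr (1 / p))"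
  let ?e = "e1 + 2 * Bf * h / d"
  have "AE \<sigma> in lborel. \<sigma> \<in> {\<tau> - h..\<tau>} \<longrightarrow> N \<eta> \<sigma> y \<le> f w + A * (?e + ?om + 4 * M * \<eta> / d)"
    using P_slice[OF \<eta>]
  proof eventually_elim
    case (elim \<sigma>)
    show ?case
    proof
      assume \<sigma>: "\<sigma> \<in> {\<tau> - h..\<tau>}"
      then have \<sigma>0: "0 < \<sigma>" "\<rho> \<le> \<sigma>" using \<rho> \<tau> by auto
      \<comment> \<open>Minimality was used at time \<open>\<tau>\<close>, but \<open>u\<close> is
        needed at \<open>\<sigma>\<close>. Each of the two values of \<open>P\<close> in a quotient
        moves by at most \<open>Bf h\<close>, whence the error \<open>2 Bf h / d\<close>.\<close>
      have near: "\<bar>P \<eta> \<tau> z - P \<eta> \<sigma> z\<bar> \<le> Bf * h" for z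
      proof -
        have "\<bar>P \<eta> \<tau> z - P \<eta> \<sigma> z\<bar> \<le> Bf * (\<tau> - \<sigma>)" using \<sigma> \<sigma>0 by (intro P_time_lip[OF \<eta>]) auto
        also have "\<dots> \<le> Bf * h" using \<sigma> Bf_nonneg by (intro mult_left_mono) auto
        finally show ?thesis .
      qed
      have de: "d * (w - ?e) = d * (w - e1) - 2 * (Bf * h)" "d * (w + ?e) = d * (w + e1) + 2 * (Bf * h)"
        using d by (simp_all add: algebra_simps)
      have "N \<eta> \<sigma> y \<le> f w + A * (?e + c * ((d + 2 * \<eta>) powr (1 / p) / \<sigma> powr (1 / p)) + 4 * M * \<eta> / d)"
      proof (rule N_touch[OF \<sigma>0(1) d w])
        show "P \<eta> \<sigma> z - P \<eta> \<sigma> y = (LINT x|lborel. u \<sigma> x * bump \<eta> y z x)" for y z using elim \<sigma>0 by blast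
        show "d * (w - ?e) \<le> P \<eta> \<sigma> (y + d) - P \<eta> \<sigma> y"
          unfolding de using right near[of "y + d"] near[of y] by linarith
        show "P \<eta> \<sigma> y - P \<eta> \<sigma> (y - d) \<le> d * (w + ?e)"
          unfolding de using left near[of "y - d"] near[of y] by linarith
      qed
      also have "\<dots> \<le> f w + A * (?e + ?om + 4 * M * \<eta> / d)"
        using A_pos c_nonneg \<sigma>0 \<rho> p_pos
        by (intro add_left_mono mult_left_mono add_right_mono divide_left_mono powr_mono2) auto
      finally show "N \<eta> \<sigma> y \<le> f w + A * (?e + ?om + 4 * M * \<eta> / d)" .
    qed
  qed
  then have "(LINT \<sigma>:{\<tau> - h..\<tau>}|lborel. N \<eta> \<sigma> y) \<le> (\<tau> - (\<tau> - h)) * (f w + A * (?e + ?om + 4 * M * \<eta> / d))"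
    using h by (intro N_integral_le[OF \<eta>]) auto
  then have 1: "P \<eta> (\<tau> - h) y \<le> P \<eta> \<tau> y + h * (f w + A * (?e + ?om + 4 * M * \<eta> / d))"
    using P_time[OF \<eta>, of "\<tau> - h" \<tau> y] \<rho> \<tau> h by simp
  define w' where "w' = G ((x - y) / (r + h))"
  have 2: "(r + h) * L ((x - y) / (r + h)) \<le> r * L ((x - y) / r) - h * f w'"
    unfolding w'_def by (rule perspective_increment[OF r0 h])
  have "\<bar>(x - y) / r - (x - y) / (r + h)\<bar> \<le> A * h / \<rho>"
  proof -
    have "(x - y) / r - (x - y) / (r + h) = (x - y) * h / (r * (r + h))"
      using r0 h by (simp add: field_simps)
    also have "\<bar>\<dots>\<bar> = \<bar>x - y\<bar> * h / (r * (r + h))" using r0 h by (simp add: abs_mult)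
    also have "\<dots> \<le> (r * A) * h / (r * (r + h))"
      using y(1) r0 h by (intro divide_right_mono mult_right_mono) auto
    also have "\<dots> = A * h / (r + h)" using r0 by simp
    also have "\<dots> \<le> A * h / \<rho>" using A_pos h r \<rho> by (intro divide_left_mono) auto
    finally show ?thesis .
  qed
  then have "(\<bar>(x - y) / r - (x - y) / (r + h)\<bar> / \<delta>) powr (1 / p) \<le> (A * h / \<rho> / \<delta>) powr (1 / p)"
    using \<delta>_pos p_pos by (intro powr_mono2 divide_right_mono) auto
  with G_Hoelder[of "(x - y) / r" "(x - y) / (r + h)"]
  have ww: "\<bar>w - w'\<bar> \<le> (A * h / \<rho> / \<delta>) powr (1 / p)" by (simp add: w_def w'_def q_def)
  have "f w - f w' \<le> A * \<bar>w - w'\<bar>"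
    using f_lip[of w w'] G_mem unfolding w_def w'_def by (simp add: abs_le_iff)
  also have "\<dots> \<le> A * (A * h / \<rho> / \<delta>) powr (1 / p)" using ww A_pos by (intro mult_left_mono) auto
  finally have "h * (f w - f w') \<le> h * (A * (A * h / \<rho> / \<delta>) powr (1 / p))" using h by (intro mult_left_mono) auto
  then have "P \<eta> (\<tau> - h) y + (r + h) * L ((x - y) / (r + h))
      \<le> P \<eta> \<tau> y + r * L ((x - y) / r) + h * (A * err \<rho> d h)"
    using 1 2 by (simp add: err_def e1_def algebra_simps)
  with y(2)[of y'] show ?thesis by (intro exI[of _ y]) linarith
qed

text \<open>As \<open>r\<close> may not be smaller than \<open>\<rho>\<close>, the iteration starts
  at time \<open>t - \<rho>\<close>, from the competitor \<open>x\<close> itself at cost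
  \<open>\<rho> L 0\<close>.\<close>

lemma backward_iterate:
  assumes \<rho>: "0 < \<rho>" and d: "0 < d" and h: "0 < h"
  shows "\<rho> \<le> t - \<rho> - real n * h \<Longrightarrow>
    \<exists>y. P \<eta> (t - \<rho> - real n * h) y + (\<rho> + real n * h) * L ((x - y) / (\<rho> + real n * h))
      \<le> P \<eta> (t - \<rho>) x + \<rho> * L 0 + real n * h * (A * err \<rho> d h)"
proof (induction n)
  case 0
  show ?case by (intro exI[of _ x]) simp
next
  case (Suc n)
  have le: "\<rho> \<le> (t - \<rho> - real n * h) - h" using Suc.prems by (simp add: algebra_simps)
  then obtain y' where y': "P \<eta> (t - \<rho> - real n * h) y' + (\<rho> + real n * h) * L ((x - y') / (\<rho> + real n * h))
      \<le> P \<eta> (t - \<rho>) x + \<rho> * L 0 + real n * h * (A * err \<rho> d h)" using Suc.IH h by auto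
  have r: "\<rho> \<le> \<rho> + real n * h" using h by simp
  from backward_step[OF \<rho> d h le r, of x y'] obtain y where
    "P \<eta> (t - \<rho> - real n * h - h) y + (\<rho> + real n * h + h) * L ((x - y) / (\<rho> + real n * h + h))
      \<le> P \<eta> (t - \<rho> - real n * h) y' + (\<rho> + real n * h) * L ((x - y') / (\<rho> + real n * h)) + h * (A * err \<rho> d h)"
    by blast
  moreover have "t - \<rho> - real n * h - h = t - \<rho> - real (Suc n) * h" "\<rho> + real n * h + h = \<rho> + real (Suc n) * h"
    by (simp_all add: algebra_simps)
  ultimately show ?case using y' by (intro exI[of _ y]) (simp add: algebra_simps)
qed

text \<open>The steps lead from time \<open>t - \<rho>\<close> down to \<open>\<rho>\<close>. The
  layers of length \<open>\<rho>\<close> at both ends, where the errors are not controlled, are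
  crossed with the Lipschitz bound on \<open>P\<close> and a resting path of cost
  \<open>\<rho> L 0\<close>.\<close>

lemma V_le_P:
  assumes \<rho>: "0 < \<rho>" "2 * \<rho> < t" and d: "0 < d"
  shows "V t x \<le> P \<eta> t x + 2 * \<rho> * (Bf + \<bar>L 0\<bar>) + 4 * M * \<eta> + t * (A * err \<rho> d \<eta>)"
proof -
  \<comment> \<open>Enough steps for \<open>h \<le> \<eta>\<close>, so that \<open>\<eta>\<close>
    can replace \<open>h\<close> in the error; \<open>Suc\<close> keeps \<open>n\<close>
    positive.\<close>
  define n where "n = Suc (nat \<lceil>(t - 2 * \<rho>) / \<eta>\<rceil>)"
  define h where "h = (t - 2 * \<rho>) / real n"
  have h: "0 < h" using \<rho> by (simp add: h_def n_def)
  have nh: "real n * h = t - 2 * \<rho>" by (simp add: h_def n_def)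
  have "(t - 2 * \<rho>) / \<eta> \<le> real n" unfolding n_def by linarith
  then have "h \<le> \<eta>" using \<eta> by (simp add: h_def n_def field_simps)
  have err: "err \<rho> d h \<le> err \<rho> d \<eta>" unfolding err_def
    using \<open>h \<le> \<eta>\<close> h Bf_nonneg d A_pos \<delta>_pos \<rho> p_pos
    by (intro add_mono order_refl divide_right_mono mult_left_mono powr_mono2) auto
  have err0: "0 \<le> err \<rho> d \<eta>" unfolding err_def
    using \<eta> d Bf_nonneg c_nonneg M_pos by simp
  have t: "0 < t" using \<rho> by simp
  obtain y where "P \<eta> (t - \<rho> - real n * h) y + (\<rho> + real n * h) * L ((x - y) / (\<rho> + real n * h))
      \<le> P \<eta> (t - \<rho>) x + \<rho> * L 0 + real n * h * (A * err \<rho> d h)"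
    using backward_iterate[OF \<rho>(1) d h, of t n x] nh by auto
  then have y: "P \<eta> \<rho> y + (t - \<rho>) * L ((x - y) / (t - \<rho>)) \<le> P \<eta> (t - \<rho>) x + \<rho> * L 0 + (t - 2 * \<rho>) * (A * err \<rho> d h)"
    unfolding nh by simp
  have "(t - 2 * \<rho>) * (A * err \<rho> d h) \<le> (t - 2 * \<rho>) * (A * err \<rho> d \<eta>)"
    using err \<rho> A_pos by (intro mult_left_mono) auto
  also have "\<dots> \<le> t * (A * err \<rho> d \<eta>)" using err0 \<rho> A_pos by (intro mult_right_mono) auto
  finally have e: "(t - 2 * \<rho>) * (A * err \<rho> d h) \<le> t * (A * err \<rho> d \<eta>)" .
  have "V t x \<le> W y + t * L ((x - y) / t)" using V_le[OF t, of x y] by (simp add: E_def)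
  moreover have "t * L ((x - y) / t) \<le> (t - \<rho>) * L ((x - y) / (t - \<rho>)) + \<rho> * L 0"
    using perspective_le[of "t - \<rho>" \<rho> "x - y" 0] \<rho> by simp
  moreover have "\<bar>P \<eta> 0 y - W y\<bar> \<le> 4 * M * \<eta>" by (rule P_0_W[OF \<eta>])
  moreover have "\<bar>P \<eta> \<rho> y - P \<eta> 0 y\<bar> \<le> Bf * (\<rho> - 0)" using \<rho> by (intro P_time_lip[OF \<eta>]) auto
  moreover have "\<bar>P \<eta> t x - P \<eta> (t - \<rho>) x\<bar> \<le> Bf * (t - (t - \<rho>))" using \<rho> by (intro P_time_lip[OF \<eta>]) auto
  moreover have "\<rho> * L 0 \<le> \<rho> * \<bar>L 0\<bar>" using \<rho> by (intro mult_left_mono) auto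
  moreover have "2 * \<rho> * (Bf + \<bar>L 0\<bar>) = 2 * (Bf * \<rho>) + 2 * (\<rho> * \<bar>L 0\<bar>)" by (simp add: algebra_simps)
  ultimately show ?thesis using y e by simp
qed

end

text \<open>Both the touching distance \<open>d\<close> and the quotient of mollifier width by
  \<open>d\<close> must vanish; the square root balances them.\<close>

lemma err_sqrt_tendsto:
  assumes \<rho>: "0 < \<rho>" and h: "h \<longlonglongrightarrow> 0" "\<And>n::nat. 0 < h n"
  shows "(\<lambda>n. err (h n) \<rho> (sqrt (h n)) (h n)) \<longlonglongrightarrow> 0"
proof -
  have s: "(\<lambda>n. sqrt (h n)) \<longlonglongrightarrow> 0" using tendsto_real_sqrt[OF h(1)] by simp
  have eq: "err (h n) \<rho> (sqrt (h n)) (h n) = (sqrt (h n) / \<rho> / \<delta>) powr (1 / p) + 2 * Bf * sqrt (h n)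
     + c * ((sqrt (h n) + 2 * h n) powr (1 / p) / \<rho> powr (1 / p)) + 4 * M * sqrt (h n) + (A * h n / \<rho> / \<delta>) powr (1 / p)" for n
  proof -
    have "k * h n / sqrt (h n) = k * sqrt (h n)" for k
      using h(2)[of n] real_div_sqrt[of "h n"] by (simp flip: times_divide_eq_right)
    then show ?thesis by (simp only: err_def[OF h(2)])
  qed
  have pw: "(\<lambda>n. (g n) powr (1 / p)) \<longlonglongrightarrow> 0" if "g \<longlonglongrightarrow> 0" "\<And>n. 0 \<le> g n" for g :: "nat \<Rightarrow> real"
    using that p_pos by (intro tendsto_zero_powrI[where b = "1 / p"]) auto
  have "(\<lambda>n. (sqrt (h n) / \<rho> / \<delta>) powr (1 / p)) \<longlonglongrightarrow> 0"
    using s \<rho> \<delta>_pos h(2) by (intro pw) (auto intro!: tendsto_divide_zero divide_nonneg_pos simp: less_imp_le)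
  moreover have "(\<lambda>n. (A * h n / \<rho> / \<delta>) powr (1 / p)) \<longlonglongrightarrow> 0"
    using h \<rho> \<delta>_pos A_pos by (intro pw) (auto intro!: tendsto_divide_zero tendsto_mult_right_zero divide_nonneg_pos simp: less_imp_le)
  moreover have "(\<lambda>n. (sqrt (h n) + 2 * h n) powr (1 / p)) \<longlonglongrightarrow> 0"
    using h s by (intro pw) (auto intro!: tendsto_add_zero tendsto_mult_right_zero add_nonneg_nonneg simp: less_imp_le)
  ultimately show ?thesis unfolding eq
    by (intro tendsto_add_zero tendsto_mult_right_zero tendsto_divide_zero s)
qed

text \<open>\<open>\<rho>\<close> is fixed first, so that the end layers cost at most
  \<open>e / 2\<close>. Only then does the mollifier width tend to 0, because the remaining error is
  not uniform in \<open>\<rho>\<close>.\<close>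

lemma P_tendsto_V:
  assumes t: "0 < t" and h: "h \<longlonglongrightarrow> 0" "\<And>n::nat. 0 < h n"
  shows "(\<lambda>n. P (h n) t x) \<longlonglongrightarrow> V t x"
proof (rule LIMSEQ_I)
  fix e :: real assume e: "0 < e"
  define k where "k = 2 * (Bf + \<bar>L 0\<bar>) + 1"
  have k: "0 < k" using Bf_nonneg by (simp add: k_def)
  define \<rho> where "\<rho> = min (t / 4) (e / (2 * k))"
  have \<rho>: "0 < \<rho>" "2 * \<rho> < t" using t e k by (auto simp: \<rho>_def)
  have "\<rho> * k \<le> e / 2" using k by (simp add: \<rho>_def min_def field_simps)
  moreover have "2 * \<rho> * (Bf + \<bar>L 0\<bar>) \<le> \<rho> * k" using \<rho> by (simp add: k_def algebra_simps)
  ultimately have small: "2 * \<rho> * (Bf + \<bar>L 0\<bar>) \<le> e / 2" by linarith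
  have "(\<lambda>n. 4 * M * h n + t * (A * err (h n) \<rho> (sqrt (h n)) (h n))) \<longlonglongrightarrow> 0"
    by (intro tendsto_add_zero tendsto_mult_right_zero h err_sqrt_tendsto \<rho>)
  then have "\<forall>\<^sub>F n in sequentially. 4 * M * h n + t * (A * err (h n) \<rho> (sqrt (h n)) (h n)) < e / 2"
    using e by (intro order_tendstoD(2)) auto
  moreover have "(\<lambda>n. 4 * M * h n) \<longlonglongrightarrow> 0" by (intro tendsto_mult_right_zero h)
  then have "\<forall>\<^sub>F n in sequentially. 4 * M * h n < e" using e by (intro order_tendstoD(2)) auto
  ultimately have "\<forall>\<^sub>F n in sequentially. norm (P (h n) t x - V t x) < e"
  proof eventually_elim
    case (elim n)
    have "V t x \<le> P (h n) t x + 2 * \<rho> * (Bf + \<bar>L 0\<bar>) + 4 * M * h n + t * (A * err (h n) \<rho> (sqrt (h n)) (h n))"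
      by (rule V_le_P[OF h(2) \<rho>]) (use h(2) in simp)
    then show ?case using P_le_V[OF h(2) t, of n x] elim small by (simp add: abs_less_iff)
  qed
  then show "\<exists>no. \<forall>n\<ge>no. norm (P (h n) t x - V t x) < e" by (simp add: eventually_sequentially)
qed

text \<open>On almost every slice the potentials have \<open>u t\<close> as mollified slope and
  converge to \<open>V t\<close>, a primitive of \<open>v t\<close>, so \<open>u t\<close> and
  \<open>v t\<close> have equal integrals over intervals. Joint measurability carries the equality
  from slices to the plane.\<close>

lemma u_eq_v: "AE (t, x) in lborel. 0 < t \<longrightarrow> u t x = v t x"
proof -
  define h where "h n = 1 / real (Suc n)" for n
  have h: "h \<longlonglongrightarrow> 0" "\<And>n. 0 < h n"
    unfolding h_def using LIMSEQ_inverse_real_of_nat by (simp only: inverse_eq_divide) simp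
  have "AE t in lborel. \<forall>n. 0 < t \<longrightarrow> (\<forall>y z. P (h n) t z - P (h n) t y = (LINT x|lborel. u t x * bump (h n) y z x))"
    by (intro AE_all_countable[THEN iffD2] allI P_slice h)
  then have "AE t in lborel. AE x in lborel. 0 < t \<longrightarrow> u t x = v t x"
  proof eventually_elim
    case (elim t)
    show ?case
    proof (cases "0 < t")
      case t: True
      have meas: "u t \<in> borel_measurable borel" "v t \<in> borel_measurable borel"
        by measurable (rule v_measurable_snd[OF t])
      have int: "(LINT x:{y..z}|lborel. u t x) = (LINT x:{y..z}|lborel. v t x)" if yz: "y \<le> z" for y z
      proof -
        have "(\<lambda>n. LINT x|lborel. u t x * bump (h n) y z x) \<longlonglongrightarrow> V t z - V t y"
        proof -
          have "(\<lambda>n. P (h n) t z - P (h n) t y) \<longlonglongrightarrow> V t z - V t y"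
            by (intro tendsto_diff P_tendsto_V[OF t h])
          then show ?thesis using elim t by simp
        qed
        moreover have "(\<lambda>n. LINT x|lborel. u t x * bump (h n) y z x) \<longlonglongrightarrow> (LINT x|lborel. u t x * window y z x)"
        proof (rule Lim_null[THEN iffD2], rule Lim_null_comparison)
          show "\<forall>\<^sub>F n in sequentially. norm ((LINT x|lborel. u t x * bump (h n) y z x) - (LINT x|lborel. u t x * window y z x)) \<le> 4 * M * h n"
            using bump_window_integral[OF h(2) meas(1) u_bound] by simp
          show "(\<lambda>n. 4 * M * h n) \<longlonglongrightarrow> 0" by (intro tendsto_mult_right_zero h)
        qed
        ultimately have "(LINT x:{y..z}|lborel. u t x) = V t z - V t y"
          using window_integral[OF yz meas(1)] LIMSEQ_unique by metis
        moreover have "(LINT x:{y..z}|lborel. v t x) = V t z - V t y"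
          using set_borel_integral_eq_integral(2)[OF set_integrable_bounded_Icc[OF meas(2) abs_v_le]]
            V_integral[OF t yz] by (simp add: integral_unique)
        ultimately show ?thesis by simp
      qed
      have "AE x in lborel. \<forall>n::nat. x \<in> {- real n..real n} \<longrightarrow> u t x = v t x"
        unfolding AE_all_countable
        by (intro allI AE_eq_if_interval_integrals_eq[where C = M] meas int) (auto simp: u_bound abs_v_le)
      then show ?thesis
      proof eventually_elim
        case (elim x)
        obtain n :: nat where "\<bar>x\<bar> \<le> real n" using real_arch_simple by blast
        then have "x \<in> {- real n..real n}" by auto
        with elim show ?case by blast
      qed
    qed simp
  qed
  moreover have [measurable]: "(\<lambda>z. if 0 < fst z then v (fst z) (snd z) else 0) \<in> borel_measurable (borel \<Otimes>\<^sub>M borel)"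
    using v_measurable by (simp add: case_prod_beta')
  have "{z \<in> space (lborel \<Otimes>\<^sub>M lborel). 0 < fst z \<longrightarrow> u (fst z) (snd z) = (if 0 < fst z then v (fst z) (snd z) else 0)}
      \<in> sets (lborel \<Otimes>\<^sub>M lborel)"
    by measurable
  ultimately have "AE z in lborel \<Otimes>\<^sub>M lborel. 0 < fst z \<longrightarrow> u (fst z) (snd z) = (if 0 < fst z then v (fst z) (snd z) else 0)"
    by (intro lborel_pair.AE_pair_measure) auto
  then show ?thesis unfolding lborel_prod by (auto simp: case_prod_beta' elim: eventually_mono)
qed

text \<open>\<open>W\<close> is constant on either side of the support of \<open>u0\<close>, which
  is the situation of \<open>v_eq_0\<close>.\<close>

lemma v_support:
  assumes Z: "compact Z" "AE x in lborel. x \<notin> Z \<longrightarrow> u0 x = 0"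
  obtains R where "0 \<le> R" "\<And>t x. 0 < t \<Longrightarrow> R + t * A < \<bar>x\<bar> \<Longrightarrow> v t x = 0"
proof -
  obtain R where R: "0 < R" "\<And>x. x \<in> Z \<Longrightarrow> \<bar>x\<bar> < R"
    using compact_imp_bounded[OF Z(1)] bounded_pos_less[of Z] by auto
  have W: "W y = W z" if "R \<le> y \<and> R \<le> z \<or> y \<le> - R \<and> z \<le> - R" for y z
  proof -
    have "AE x in lborel. u0 x * window z y x = 0"
      using Z(2)
    proof eventually_elim
      case (elim x)
      show ?case
      proof (cases "x \<in> Z")
        case True
        then have "\<bar>x\<bar> < R" by (rule R(2))
        then have "window z y x = 0" using that by (auto simp: window_def indicator_def)
        then show ?thesis by simp
      qed (use elim in simp)
    qed
    then have "(LINT x|lborel. u0 x * window z y x) = 0" by (rule integral_eq_zero_AE)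
    then show ?thesis using W_diff[of y z] by simp
  qed
  show thesis
  proof (rule that)
    show "0 \<le> R" using R(1) by simp
    show "v t x = 0" if "0 < t" "R + t * A < \<bar>x\<bar>" for t x
      by (rule v_eq_0[OF that(1) _ _ that(2)]) (use W in auto)
  qed
qed

end

section \<open>Reduction to convex fluxes\<close>

text \<open>The forward quotient at \<open>v\<close> is compared with the backward quotient at
  \<open>w\<close>. Both use points between \<open>v\<close> and \<open>w\<close> only, so convexity
  on \<open>K\<close> suffices even if \<open>v\<close> and \<open>w\<close> are its ends.\<close>

lemma convex_on_deriv_mono:
  fixes f :: "real \<Rightarrow> real"
  assumes "convex_on K f" and "\<And>x. (f has_real_derivative a x) (at x)"
    and vw: "v \<in> K" "w \<in> K" "v < w"
  shows "a v \<le> a w"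
proof (rule tendsto_le[of "at_right 0"])
  have "((\<lambda>h. (f (v + h) - f v) / h) \<longlongrightarrow> a v) (at 0)"
    using assms(2)[of v] by (simp add: DERIV_def)
  then show "((\<lambda>h. (f (v + h) - f v) / h) \<longlongrightarrow> a v) (at_right 0)" by (rule tendsto_within_subset) simp
  have "((\<lambda>h. (f (w + h) - f w) / h) \<longlongrightarrow> a w) (at 0)"
    using assms(2)[of w] by (simp add: DERIV_def)
  then have "((\<lambda>h. (f (w + h) - f w) / h) \<longlongrightarrow> a w) (at_left 0)" by (rule tendsto_within_subset) simp
  then have "((\<lambda>h. (f (w - h) - f w) / (- h)) \<longlongrightarrow> a w) (at_right 0)"
    unfolding filterlim_at_left_to_right[of _ _ 0] by simp
  then show "((\<lambda>h. (f w - f (w - h)) / h) \<longlongrightarrow> a w) (at_right 0)"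
    by (simp add: diff_divide_distrib)
  have "\<forall>\<^sub>F h in at_right 0. h \<in> {0<..<w - v}" using vw by (intro eventually_at_right_real) auto
  then show "\<forall>\<^sub>F h in at_right 0. (f (v + h) - f v) / h \<le> (f w - f (w - h)) / h"
  proof eventually_elim
    case (elim h)
    \<comment> \<open>\<open>v + h\<close> and \<open>w - h\<close> are convex combinations with the
      weights \<open>\<mu>\<close> and \<open>1 - \<mu>\<close> exchanged, so the two convexity
      inequalities add up to \<open>f v + f w\<close>.\<close>
    define \<mu> where "\<mu> = h / (w - v)"
    have \<mu>: "0 \<le> \<mu>" "\<mu> \<le> 1" "\<mu> * (w - v) = h" using elim vw by (auto simp: \<mu>_def)
    have conv: "f ((1 - t) *\<^sub>R v + t *\<^sub>R w) \<le> (1 - t) * f v + t * f w" if "0 \<le> t" "t \<le> 1" for t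
      using convex_onD[OF assms(1) that vw(1,2)] .
    have e: "v + h = (1 - \<mu>) *\<^sub>R v + \<mu> *\<^sub>R w" "w - h = (1 - (1 - \<mu>)) *\<^sub>R v + (1 - \<mu>) *\<^sub>R w"
      using \<mu>(3) by (auto simp: algebra_simps)
    have "f (v + h) \<le> (1 - \<mu>) * f v + \<mu> * f w" unfolding e(1) by (rule conv[OF \<mu>(1,2)])
    moreover have "f (w - h) \<le> (1 - (1 - \<mu>)) * f v + (1 - \<mu>) * f w"
      unfolding e(2) by (rule conv) (use \<mu> in auto)
    moreover have "(1 - \<mu>) * f v + \<mu> * f w + ((1 - (1 - \<mu>)) * f v + (1 - \<mu>) * f w) = f v + f w"
      by (simp add: algebra_simps)
    ultimately have "f (v + h) - f v \<le> f w - f (w - h)" by linarith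
    then show ?case using elim by (intro divide_right_mono) auto
  qed
qed simp

lemma convex_case:
  fixes M p s :: real and f u0 :: "real \<Rightarrow> real" and u :: "real \<Rightarrow> real \<Rightarrow> real"
  assumes M: "0 < M" and C1: "f C1_differentiable_on UNIV" and degen: "degeneracy_parameter f {-M..M} p"
    and s: "s = 1 / p" "0 < s"
    and u0: "u0 \<in> borel_measurable lborel" "AE x in lborel. \<bar>u0 x\<bar> \<le> M"
    and ws: "weak_solution f u0 {-M..M} u" and conv: "convex_on {-M..M} f" and osc: "one_sided_Hoelder s u"
  shows "\<exists>v. ae_equal u v \<and>
    v \<in> Lip_Lq_loc s (1 / s) \<and>
    (\<forall>t>0. v t \<in> BVs_loc s) \<and>
    (compactly_supported u0 \<longrightarrow>
       v \<in> Lip_Lq s (1 / s) UNIV \<and>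
       (\<exists>C\<ge>0. \<forall>t>0. TVs s UNIV (v t) \<le> ennreal (C * (1 + 1 / t))))"
proof -
  have p: "0 < p" "1 / s = p" using s by auto
  define a where "a = deriv f"
  define \<delta> where "\<delta> = (INF (v, w) \<in> {(v, w). v \<in> {-M..M} \<and> w \<in> {-M..M} \<and> v \<noteq> w}. \<bar>deriv f v - deriv f w\<bar> / \<bar>v - w\<bar> powr p)"
  have \<delta>: "0 < \<delta>" using degen by (simp add: degeneracy_parameter_def \<delta>_def)
  obtain D where D: "\<And>x. (f has_vector_derivative D x) (at x)" "continuous_on UNIV D"
    using C1 unfolding C1_differentiable_on_def by auto
  have aD: "a = D" unfolding a_def
    using D(1) by (auto simp: fun_eq_iff has_real_derivative_iff_has_vector_derivative intro!: DERIV_imp_deriv)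
  have f_deriv: "(f has_real_derivative a x) (at x)" for x
    using D(1) by (simp add: aD has_real_derivative_iff_has_vector_derivative)
  have "bounded (D ` {-M..M})"
    by (intro compact_imp_bounded compact_continuous_image continuous_on_subset[OF D(2)]) auto
  then obtain B where "\<forall>y\<in>D ` {-M..M}. norm y \<le> B" unfolding bounded_iff by blast
  then have B: "\<bar>a x\<bar> \<le> B" if "x \<in> {-M..M}" for x using that by (simp add: aD)
  define A where "A = \<bar>B\<bar> + 1"
  have f_lip: "\<bar>f v - f w\<bar> \<le> A * \<bar>v - w\<bar>" if "v \<in> {-M..M}" "w \<in> {-M..M}" for v w
  proof -
    have "norm (f v - f w) \<le> A * norm (v - w)"
    proof (rule field_differentiable_bound[of "{-M..M}" f a])
      show "(f has_field_derivative a z) (at z within {-M..M})" for z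
        by (rule has_field_derivative_at_within[OF f_deriv])
      show "norm (a z) \<le> A" if "z \<in> {-M..M}" for z using B[OF that] by (simp add: A_def)
    qed (use that in auto)
    then show ?thesis by simp
  qed
  \<comment> \<open>The infimum controls only the absolute difference of slopes; convexity supplies
    its sign.\<close>
  have degenerate: "\<delta> * (w - v) powr p \<le> a w - a v" if vw: "-M \<le> v" "v < w" "w \<le> M" for v w
  proof -
    have "\<delta> \<le> (case (v, w) of (v, w) \<Rightarrow> \<bar>deriv f v - deriv f w\<bar> / \<bar>v - w\<bar> powr p)"
      unfolding \<delta>_def by (rule cINF_lower) (use vw in \<open>auto intro!: bdd_belowI2[of _ 0]\<close>)
    then have "\<delta> * (w - v) powr p \<le> \<bar>a w - a v\<bar>"
      using vw by (simp add: a_def pos_le_divide_eq abs_minus_commute)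
    moreover have "a v \<le> a w" using vw by (intro convex_on_deriv_mono[OF conv f_deriv]) auto
    ultimately show ?thesis by simp
  qed
  \<comment> \<open>Truncation to \<open>K\<close> yields representatives bounded at every point. It
    is monotone and does not expand distances, so the one-sided condition survives at every
    \<open>t > 0\<close>, even at exceptional times where \<open>u t\<close> leaves
    \<open>K\<close>.\<close>
  define clamp where "clamp x = max (- M) (min M x)" for x
  have clamp: "\<bar>clamp x\<bar> \<le> M" "\<bar>x\<bar> \<le> M \<Longrightarrow> clamp x = x" for x using M by (auto simp: clamp_def)
  have clamp_le: "clamp y - clamp x \<le> b" if "y - x \<le> b" "0 \<le> b" for x y b
    using that by (auto simp: clamp_def max_def min_def)
  have [measurable]: "clamp \<in> borel_measurable borel" unfolding clamp_def[abs_def] by measurable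
  define u' where "u' t x = (if 0 < t then clamp (u t x) else 0)" for t x
  define u0' where "u0' x = clamp (u0 x)" for x
  have [measurable]: "u0 \<in> borel_measurable borel" using u0(1) by simp
  define T where "T = {0::real<..} \<times> (UNIV :: real set)"
  have T[measurable]: "T \<in> sets borel" unfolding T_def by (intro borel_open open_Times) auto
  have um[measurable]: "(\<lambda>z. indicator T z * u (fst z) (snd z)) \<in> borel_measurable borel"
    using ws by (simp add: weak_solution_def set_borel_measurable_def case_prod_beta' T_def)
  have "u' (fst z) (snd z) = indicator T z * clamp (indicator T z * u (fst z) (snd z))" for z
    by (simp add: u'_def T_def indicator_def mem_Times_iff)
  then have um': "(\<lambda>z. u' (fst z) (snd z)) \<in> borel_measurable borel"
    using measurable_compose[OF um \<open>clamp \<in> borel_measurable borel\<close>] by simp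
  have f_cont: "continuous_on UNIV f" using f_deriv by (meson DERIV_isCont continuous_at_imp_continuous_on)
  have [measurable]: "f \<in> borel_measurable borel" using f_cont by (rule borel_measurable_continuous_onI)
  have ae: "AE z in lborel. 0 < fst z \<longrightarrow> u' (fst z) (snd z) = u (fst z) (snd z)"
  proof -
    have "AE z in lborel. 0 < fst z \<longrightarrow> u (fst z) (snd z) \<in> {-M..M}"
      using ws by (simp add: weak_solution_def case_prod_beta')
    then show ?thesis by eventually_elim (auto simp: u'_def intro!: clamp(2))
  qed
  have ae0: "AE x in lborel. u0' x = u0 x"
    using u0(2) by eventually_elim (auto simp: u0'_def intro!: clamp(2))
  obtain c where c: "0 < c" "\<And>t. 0 < t \<Longrightarrow> AE (x, y) in lborel. x < y \<longrightarrow> u t y - u t x \<le> c * ((y - x) powr s / t powr s)"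
    using osc unfolding one_sided_Hoelder_def by blast
  interpret entropy_flow M A \<delta> p f a u0' u' c
  proof
    show "\<bar>u0' x\<bar> \<le> M" for x by (simp add: u0'_def clamp)
    show "u0' \<in> borel_measurable borel" unfolding u0'_def by measurable
    show "\<bar>u' t x\<bar> \<le> M" for t x using M by (simp add: u'_def clamp)
    show "AE (x, y) in lborel. x < y \<longrightarrow> u' t y - u' t x \<le> c * ((y - x) powr (1 / p) / t powr (1 / p))" if "0 < t" for t
      using c(2)[OF that]
    proof eventually_elim
      case (elim z)
      then show ?case using that c(1) by (auto simp: u'_def s(1) split: prod.splits intro!: clamp_le)
    qed
    fix \<phi> \<phi>t \<phi>x assume tf: "test_function \<phi> \<phi>t \<phi>x"
    have [measurable]: "\<phi>t \<in> borel_measurable borel" "\<phi>x \<in> borel_measurable borel"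
      using tf by (auto simp: test_function_def intro: borel_measurable_continuous_onI)
    have "\<phi> differentiable (at z)" for z using tf unfolding test_function_def differentiable_def by blast
    then have "continuous_on UNIV \<phi>" by (intro continuous_at_imp_continuous_on) (auto intro: differentiable_imp_continuous_within)
    then have "continuous_on UNIV (\<lambda>x. \<phi> (0, x))" by (rule continuous_on_compose2) (auto intro!: continuous_intros)
    then have [measurable]: "(\<lambda>x. \<phi> (0, x)) \<in> borel_measurable borel" by (rule borel_measurable_continuous_onI)
    have "(LINT z:T|lborel. u' (fst z) (snd z) * \<phi>t z + f (u' (fst z) (snd z)) * \<phi>x z)
        = (LINT z:T|lborel. u (fst z) (snd z) * \<phi>t z + f (u (fst z) (snd z)) * \<phi>x z)"
      unfolding set_lebesgue_integral_def
    proof (rule integral_cong_AE)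
      show "(\<lambda>z. indicator T z *\<^sub>R (u' (fst z) (snd z) * \<phi>t z + f (u' (fst z) (snd z)) * \<phi>x z)) \<in> borel_measurable lborel"
        using um' measurable_compose[OF um' \<open>f \<in> borel_measurable borel\<close>] by measurable
      \<comment> \<open>Measurability of \<open>u\<close> is assumed on \<open>t > 0\<close> only;
        the extra indicator brings in the extension by 0, which is Borel.\<close>
      have eq: "indicator T z *\<^sub>R (u (fst z) (snd z) * \<phi>t z + f (u (fst z) (snd z)) * \<phi>x z)
          = indicator T z *\<^sub>R ((indicator T z * u (fst z) (snd z)) * \<phi>t z + f (indicator T z * u (fst z) (snd z)) * \<phi>x z)" for z
        by (auto simp: indicator_def)
      show "(\<lambda>z. indicator T z *\<^sub>R (u (fst z) (snd z) * \<phi>t z + f (u (fst z) (snd z)) * \<phi>x z)) \<in> borel_measurable lborel"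
        unfolding eq using measurable_compose[OF um \<open>f \<in> borel_measurable borel\<close>] by measurable
      show "AE z in lborel. indicator T z *\<^sub>R (u' (fst z) (snd z) * \<phi>t z + f (u' (fst z) (snd z)) * \<phi>x z)
          = indicator T z *\<^sub>R (u (fst z) (snd z) * \<phi>t z + f (u (fst z) (snd z)) * \<phi>x z)"
        using ae by eventually_elim (auto simp: T_def indicator_def)
    qed
    moreover have "(LINT x|lborel. u0' x * \<phi> (0, x)) = (LINT x|lborel. u0 x * \<phi> (0, x))"
      using ae0 by (intro integral_cong_AE) (auto simp: u0'_def)
    moreover have "(LINT z:T|lborel. u (fst z) (snd z) * \<phi>t z + f (u (fst z) (snd z)) * \<phi>x z) + (LINT x|lborel. u0 x * \<phi> (0, x)) = 0"
      using ws tf by (simp add: weak_solution_def case_prod_beta' T_def)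
    ultimately show "(LINT z:{0<..} \<times> UNIV|lborel. u' (fst z) (snd z) * \<phi>t z + f (u' (fst z) (snd z)) * \<phi>x z)
        + (LINT x|lborel. u0' x * \<phi> (0, x)) = 0" by (simp add: T_def)
  qed (use M \<delta> p f_deriv f_lip degenerate um' c(1) in \<open>auto simp: A_def\<close>)
  have "ae_equal u v"
    unfolding ae_equal_def case_prod_beta'
    using ae u_eq_v[unfolded case_prod_beta'] by eventually_elim auto
  moreover have "v \<in> Lip_Lq s (1 / s) UNIV \<and> (\<exists>C\<ge>0. \<forall>t>0. TVs s UNIV (v t) \<le> ennreal (C * (1 + 1 / t)))"
    if cs: "compactly_supported u0"
  proof -
    obtain Z where Z: "compact Z" "AE x in lborel. x \<notin> Z \<longrightarrow> u0 x = 0"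
      using cs unfolding compactly_supported_def by blast
    have "AE x in lborel. x \<notin> Z \<longrightarrow> u0' x = 0" using Z(2) ae0 by eventually_elim simp
    then obtain R where R: "0 \<le> R" "\<And>t x. 0 < t \<Longrightarrow> R + t * A < \<bar>x\<bar> \<Longrightarrow> v t x = 0"
      using v_support[OF Z(1)] by blast
    have "0 \<le> (4 * R + 4 + 6 * A) / \<delta>" using R(1) A_pos \<delta>_pos by simp
    moreover have "\<forall>t>0. TVs s UNIV (v t) \<le> ennreal ((4 * R + 4 + 6 * A) / \<delta> * (1 + 1 / t))"
      using v_TVs_UNIV R unfolding s(1) by blast
    moreover have "v \<in> Lip_Lq s (1 / s) UNIV" using v_Lip_Lq_UNIV[OF R] by (simp add: p(2) s(1))
    ultimately show ?thesis by blast
  qed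
  moreover have "v \<in> Lip_Lq_loc s (1 / s)" using v_Lip_Lq_loc by (simp add: p(2) s(1))
  moreover have "\<forall>t>0. v t \<in> BVs_loc s" using v_BVs_loc by (simp add: s(1))
  ultimately show ?thesis by blast
qed

theorem theorem4p1:
  fixes M p s :: real
    and f u0 :: "real \<Rightarrow> real"
    and u :: "real \<Rightarrow> real \<Rightarrow> real"
  assumes "0 < M"
    and "f C1_differentiable_on UNIV"
    and "degeneracy_parameter f {-M..M} p"
    and "s = 1 / p" and "0 < s" and "s \<le> 1"
    and "u0 \<in> borel_measurable lborel"
    and "AE x in lborel. \<bar>u0 x\<bar> \<le> M"
    and "entropy_solution f u0 {-M..M} s u"
  shows "\<exists>v. ae_equal u v \<and>
    v \<in> Lip_Lq_loc s (1 / s) \<and>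
    (\<forall>t>0. v t \<in> BVs_loc s) \<and>
    (compactly_supported u0 \<longrightarrow>
       v \<in> Lip_Lq s (1 / s) UNIV \<and>
       (\<exists>C\<ge>0. \<forall>t>0. TVs s UNIV (v t) \<le> ennreal (C * (1 + 1 / t))))"
proof -
  have ws: "weak_solution f u0 {-M..M} u"
    and cases: "convex_on {-M..M} f \<and> one_sided_Hoelder s u \<or>
      concave_on {-M..M} f \<and> one_sided_Hoelder s (\<lambda>t x. - u t x)"
    using assms(9) by (auto simp: entropy_solution_def)
  show ?thesis
  proof (cases "convex_on {-M..M} f \<and> one_sided_Hoelder s u")
    case True
    then show ?thesis using convex_case[OF assms(1-5) assms(7,8) ws] by blast
  next
    case False
    with cases have conc: "concave_on {-M..M} f" and osc: "one_sided_Hoelder s (\<lambda>t x. - u t x)" by auto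
    text \<open>Reflection: \<open>- u\<close> solves the conservation law with the convex flux \<open>- f (- x)\<close>.\<close>
    let ?f = "\<lambda>x. - f (- x)"
    obtain D where D: "\<And>x. (f has_vector_derivative D x) (at x)" "continuous_on UNIV D"
      using assms(2) unfolding C1_differentiable_on_def by auto
    have fd: "(?f has_real_derivative D (- x)) (at x)" for x
    proof -
      have "(f has_real_derivative D (- x)) (at (- x))"
        using D(1) by (simp add: has_real_derivative_iff_has_vector_derivative)
      then have "((\<lambda>x. f (- x)) has_real_derivative D (- x) * (- 1)) (at x)"
        by (rule DERIV_chain2) (auto intro!: derivative_eq_intros)
      then show ?thesis using DERIV_minus by fastforce
    qed
    have "continuous_on UNIV (\<lambda>x. D (- x))"
      by (rule continuous_on_compose2[OF D(2)]) (auto intro!: continuous_intros)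
    then have C1: "?f C1_differentiable_on UNIV"
      unfolding C1_differentiable_on_def using fd
      by (intro exI[of _ "\<lambda>x. D (- x)"]) (auto simp: has_real_derivative_iff_has_vector_derivative)
    have deriv: "deriv ?f x = deriv f (- x)" for x
      using DERIV_imp_deriv[OF fd] DERIV_imp_deriv[of f "D (- x)" "- x"] D(1)[of "- x"]
      by (simp add: has_real_derivative_iff_has_vector_derivative)
    let ?K = "{(v, w). v \<in> {-M..M} \<and> w \<in> {-M..M} \<and> v \<noteq> w}"
    \<comment> \<open>The set of pairs is invariant under changing both signs, which exchanges the
      quotients of the two fluxes, so the infimum is the same.\<close>
    have "(\<lambda>(v, w). \<bar>deriv ?f v - deriv ?f w\<bar> / \<bar>v - w\<bar> powr p) ` ?K
        = (\<lambda>(v, w). \<bar>deriv f v - deriv f w\<bar> / \<bar>v - w\<bar> powr p) ` ?K"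
    proof -
      have K: "?K = (\<lambda>(v, w). (- v, - w)) ` ?K"
      proof (intro equalityI subsetI)
        fix z assume "z \<in> ?K"
        then show "z \<in> (\<lambda>(v, w). (- v, - w)) ` ?K"
          by (intro image_eqI[of _ _ "(- fst z, - snd z)"]) auto
      qed auto
      have "(\<lambda>(v, w). \<bar>deriv f v - deriv f w\<bar> / \<bar>v - w\<bar> powr p) ` (\<lambda>(v, w). (- v, - w)) ` ?K
          = (\<lambda>(v, w). \<bar>deriv ?f v - deriv ?f w\<bar> / \<bar>v - w\<bar> powr p) ` ?K"
        unfolding image_image by (intro image_cong) (auto simp: deriv abs_minus_commute)
      then show ?thesis using K by simp
    qed
    then have degen: "degeneracy_parameter ?f {-M..M} p"
      using assms(3) unfolding degeneracy_parameter_def by (simp only:)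
    have conv: "convex_on {-M..M} ?f"
    proof (rule convex_onI)
      fix t x y :: real assume t: "0 < t" "t < 1" and xy: "x \<in> {-M..M}" "y \<in> {-M..M}"
      have "convex_on {-M..M} (\<lambda>x. - f x)" using conc by (simp add: concave_on_def)
      from convex_onD[OF this, of t "- x" "- y"] t xy
      show "?f ((1 - t) *\<^sub>R x + t *\<^sub>R y) \<le> (1 - t) * ?f x + t * ?f y" by (simp add: algebra_simps)
    qed simp
    have ws': "weak_solution ?f (\<lambda>x. - u0 x) {-M..M} (\<lambda>t x. - u t x)"
      unfolding weak_solution_def
    proof (intro conjI allI impI)
      show "set_borel_measurable lborel ({0<..} \<times> UNIV) (\<lambda>(t, x). - u t x)"
        using ws unfolding weak_solution_def set_borel_measurable_def case_prod_beta' by simp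
      have "AE (t, x) in lborel. 0 < t \<longrightarrow> u t x \<in> {-M..M}" using ws by (simp add: weak_solution_def)
      then show "AE (t, x) in lborel. 0 < t \<longrightarrow> - u t x \<in> {-M..M}" by eventually_elim auto
      fix \<phi> \<phi>t \<phi>x assume "test_function \<phi> \<phi>t \<phi>x"
      then have *: "(LINT z:{0<..} \<times> UNIV|lborel. (case z of (t, x) \<Rightarrow> u t x * \<phi>t (t, x) + f (u t x) * \<phi>x (t, x)))
        + (LINT x|lborel. u0 x * \<phi> (0, x)) = 0"
        using ws unfolding weak_solution_def by blast
      have "(LINT z:{0<..} \<times> UNIV|lborel. (case z of (t, x) \<Rightarrow> - u t x * \<phi>t (t, x) + - f (- (- u t x)) * \<phi>x (t, x)))
          = (LINT z:{0<..} \<times> UNIV|lborel. - (case z of (t, x) \<Rightarrow> u t x * \<phi>t (t, x) + f (u t x) * \<phi>x (t, x)))"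
        by (intro arg_cong[where f = "\<lambda>g. LINT z:{0<..} \<times> UNIV|lborel. g z"]) (auto simp: fun_eq_iff)
      also have "\<dots> = - (LINT z:{0<..} \<times> UNIV|lborel. (case z of (t, x) \<Rightarrow> u t x * \<phi>t (t, x) + f (u t x) * \<phi>x (t, x)))"
        by (simp add: set_lebesgue_integral_def)
      finally show "(LINT z:{0<..} \<times> UNIV|lborel. (case z of (t, x) \<Rightarrow> - u t x * \<phi>t (t, x) + - f (- (- u t x)) * \<phi>x (t, x)))
        + (LINT x|lborel. - u0 x * \<phi> (0, x)) = 0"
        using * by simp
    qed
    have "(\<lambda>x. - u0 x) \<in> borel_measurable lborel" "AE x in lborel. \<bar>- u0 x\<bar> \<le> M" using assms(7,8) by auto
    from convex_case[OF assms(1) C1 degen assms(4,5) this ws' conv osc]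
    obtain v where v: "ae_equal (\<lambda>t x. - u t x) v" "v \<in> Lip_Lq_loc s (1 / s)" "\<And>t. t > 0 \<Longrightarrow> v t \<in> BVs_loc s"
      "compactly_supported (\<lambda>x. - u0 x) \<Longrightarrow> v \<in> Lip_Lq s (1 / s) UNIV \<and>
       (\<exists>C\<ge>0. \<forall>t>0. TVs s UNIV (v t) \<le> ennreal (C * (1 + 1 / t)))" by blast
    have cs: "compactly_supported (\<lambda>x. - u0 x) \<longleftrightarrow> compactly_supported u0" by (simp add: compactly_supported_def)
    have "AE (t, x) in lborel. 0 < t \<longrightarrow> - u t x = v t x" using v(1) by (simp add: ae_equal_def)
    then have "ae_equal u (\<lambda>t x. - v t x)" unfolding ae_equal_def by eventually_elim auto
    moreover have "(\<lambda>t x. - v t x) \<in> Lip_Lq s (1 / s) UNIV \<and>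
       (\<exists>C\<ge>0. \<forall>t>0. TVs s UNIV (\<lambda>x. - v t x) \<le> ennreal (C * (1 + 1 / t)))" if "compactly_supported u0"
      using v(4) that cs Lip_Lq_uminus order_trans[OF TVs_uminus] by blast
    ultimately show ?thesis
      using Lip_Lq_loc_uminus[OF v(2)] BVs_loc_uminus[OF v(3)] by (intro exI[of _ "\<lambda>t x. - v t x"]) blast
  qed
qed

end
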